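(* Let $N\ge 2$ and consider the half-duplex relay fading channel with one source, $N-1$ relays and one destination described in the context. The diversity-multiplexing tradeoff achieved by the nonorthogonal amplify-and-forward (NAF) protocol with $N-1$ relays (with suitable repetition gains satisfying their energy constraints) is $$d(r)=(1-r)+(N-1)(1-2r)^+,\qquad 0\le r\le 1,$$ where $(x)^+=\max\{x,0\}$.
   Context: Channel. All channels are flat, Rayleigh-fading and quasi-static: all channel gains are mutually independent zero-mean unit-variance circularly-symmetric complex Gaussian random variables, constant over a codeword (which spans a whole coherence interval). The source-destination gain is $g_1$; for relay $i\in\{1,\dots,N-1\}$ the source-relay gain is $h_{i+1}$ and the relay-destination gain is $g_{i+1}$. Noises are zero-mean, mutually independent, circularly-symmetric white complex Gaussian, of variance $\sigma_w^2$ at the relays and $\sigma_v^2$ at the destination, with $\sigma_v^2/\sigma_w^2$ a fixed constant. Each node has one antenna and may use average energy at most $E$ per transmitted symbol; $\rho=E/\sigma_v^2$ is the signal-to-noise ratio. Channel gains are known only at receiving nodes (the destination knows all channel gains and repetition gains); there is no feedback to transmitters. Half-duplex: a node cannot transmit and receive at the same time. NAF protocol with $N-1$ relays. A cooperation frame is two consecutive symbol-intervals, and a super-frame is $N-1$ consecutive cooperation frames. The source transmits a new symbol in every symbol-interval. Within each super-frame the relays take turns: in the $i$-th cooperation frame, relay $i$ listens in the first symbol-interval and in the second repeats its noisy observation scaled by its repetition gain $b_{i+1}$, where $|b_{i+1}|\le\sqrt{E/(|h_{i+1}|^2E+\sigma_w^2)}$ (average energy constraint). Thus during a super-frame the destination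 receives, for $i=1,\dots,N-1$, $$y_{1,i}=g_1x_{1,i}+v_{1,i},\qquad y_{2,i}=g_1x_{2,i}+g_{i+1}b_{i+1}(h_{i+1}x_{1,i}+w_{1,i})+v_{2,i},$$ where $x_{j,i}$ and $v_{j,i}$ are the source symbol and destination noise in the $j$-th symbol-interval of the $i$-th cooperation frame and $w_{1,i}$ is the noise at relay $i$. The source uses random Gaussian code-books with asymptotically large code-length, and the destination uses maximum-likelihood (ML) decoding. Diversity and multiplexing. For a family of codes indexed by $\rho$, with rate $R(\rho)$ bits per channel use and ML error probability $P_E(\rho)$ at the destination (averaged over the fading and the code ensemble), the multiplexing gain is $r=\lim_{\rho\to\infty}R(\rho)/\log\rho$ and the diversity gain is $d=-\lim_{\rho\to\infty}\log P_E(\rho)/\log\rho$; $d(r)$ is the diversity gain achieved at multiplexing gain $r$. *)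

theory Defs
  imports "HOL-Probability.Probability"
begin

text \<open>
  The circularly-symmetric complex normal law of mean 0 and variance \<open>s\<close> (\<open>s > 0\<close>), where
  \<open>s\<close> is the mean of \<open>\<bar>Z\<bar>\<^sup>2\<close>, so the real and imaginary parts each have variance \<open>s / 2\<close>.
\<close>

definition cnormal_density :: "real \<Rightarrow> complex \<Rightarrow> real" where
  "cnormal_density s z = exp (- (cmod z)\<^sup>2 / s) / (pi * s)"

definition cnormal :: "real \<Rightarrow> complex measure" where
  "cnormal s = density lborel (\<lambda>z. ennreal (cnormal_density s z))"

text \<open>
  A codeword spans \<open>L\<close> super-frames of \<open>N - 1\<close> cooperation frames of two symbol-intervals.
  The slot \<open>(k, i, j)\<close> is the \<open>j\<close>-th symbol-interval (\<open>j = 1, 2\<close>) of the \<open>i\<close>-th cooperation frame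
  of super-frame \<open>k\<close>.
\<close>

definition frames :: "nat \<Rightarrow> nat \<Rightarrow> (nat \<times> nat) set" where
  "frames N L = {..<L} \<times> {1..N - 1}"

definition slots :: "nat \<Rightarrow> nat \<Rightarrow> (nat \<times> nat \<times> nat) set" where
  "slots N L = {..<L} \<times> {1..N - 1} \<times> {1, 2}"

text \<open>
  \<open>g 1\<close> is the source-destination gain; relay \<open>i\<close> has source-relay gain \<open>h (i + 1)\<close>,
  relay-destination gain \<open>g (i + 1)\<close> and repetition gain \<open>\<beta> (i + 1)\<close>.
\<close>

definition fading :: "nat \<Rightarrow> ((nat \<Rightarrow> complex) \<times> (nat \<Rightarrow> complex)) measure" where
  "fading N = (\<Pi>\<^sub>M i\<in>{1..N}. cnormal 1) \<Otimes>\<^sub>M (\<Pi>\<^sub>M i\<in>{2..N}. cnormal 1)"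

definition codebook :: "nat \<Rightarrow> nat \<Rightarrow> nat \<Rightarrow> real \<Rightarrow> (nat \<Rightarrow> nat \<times> nat \<times> nat \<Rightarrow> complex) measure" where
  "codebook N L M E = (\<Pi>\<^sub>M m\<in>{..<M}. \<Pi>\<^sub>M p\<in>slots N L. cnormal E)"

definition relay_noise :: "nat \<Rightarrow> nat \<Rightarrow> real \<Rightarrow> (nat \<times> nat \<Rightarrow> complex) measure" where
  "relay_noise N L sw = (\<Pi>\<^sub>M q\<in>frames N L. cnormal sw)"

definition dest_noise :: "nat \<Rightarrow> nat \<Rightarrow> real \<Rightarrow> (nat \<times> nat \<times> nat \<Rightarrow> complex) measure" where
  "dest_noise N L sv = (\<Pi>\<^sub>M p\<in>slots N L. cnormal sv)"

fun received ::
  "(nat \<Rightarrow> complex) \<Rightarrow> (nat \<Rightarrow> complex) \<Rightarrow> (nat \<Rightarrow> complex) \<Rightarrow> (nat \<times> nat \<times> nat \<Rightarrow> complex) \<Rightarrow>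
   (nat \<times> nat \<Rightarrow> complex) \<Rightarrow> (nat \<times> nat \<times> nat \<Rightarrow> complex) \<Rightarrow> nat \<times> nat \<times> nat \<Rightarrow> complex" where
  "received g h \<beta> x w v (k, i, j) =
     (if j = 1 then g 1 * x (k, i, 1) + v (k, i, 1)
      else g 1 * x (k, i, 2)
           + g (i + 1) * \<beta> (i + 1) * (h (i + 1) * x (k, i, 1) + w (k, i)) + v (k, i, 2))"

text \<open>
  The conditional density of the received block \<open>y\<close> given the codeword \<open>x\<close> and all gains: the
  product density of the destination noise at the residual, averaged over the relay noise, which
  the destination does not observe.
\<close>

definition likelihood ::
  "nat \<Rightarrow> nat \<Rightarrow> real \<Rightarrow> real \<Rightarrow> (nat \<Rightarrow> complex) \<Rightarrow> (nat \<Rightarrow> complex) \<Rightarrow> (nat \<Rightarrow> complex) \<Rightarrow>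
   (nat \<times> nat \<times> nat \<Rightarrow> complex) \<Rightarrow> (nat \<times> nat \<times> nat \<Rightarrow> complex) \<Rightarrow> real" where
  "likelihood N L sw sv g h \<beta> x y =
     (\<integral>w. (\<Prod>p\<in>slots N L. cnormal_density sv (y p - received g h \<beta> x w (\<lambda>_. 0) p))
       \<partial>relay_noise N L sw)"

text \<open>Ties between maximisers of the likelihood are broken in favour of the smallest message.\<close>

definition ml_decode ::
  "nat \<Rightarrow> nat \<Rightarrow> nat \<Rightarrow> real \<Rightarrow> real \<Rightarrow> (nat \<Rightarrow> complex) \<Rightarrow> (nat \<Rightarrow> complex) \<Rightarrow> (nat \<Rightarrow> complex) \<Rightarrow>
   (nat \<Rightarrow> nat \<times> nat \<times> nat \<Rightarrow> complex) \<Rightarrow> (nat \<times> nat \<times> nat \<Rightarrow> complex) \<Rightarrow> nat" where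
  "ml_decode N L M sw sv g h \<beta> X y =
     (LEAST m. m < M \<and>
       (\<forall>m'<M. likelihood N L sw sv g h \<beta> (X m') y \<le> likelihood N L sw sv g h \<beta> (X m) y))"

text \<open>
  A repetition gain is a function of the relay's own source-relay gain, the only channel gain that
  the relay knows; \<open>sw\<close> is the relay noise variance.
\<close>

definition admissible_gain :: "real \<Rightarrow> real \<Rightarrow> (complex \<Rightarrow> complex) \<Rightarrow> bool" where
  "admissible_gain E sw b \<longleftrightarrow>
     b \<in> borel_measurable borel \<and> (\<forall>h. cmod (b h) \<le> sqrt (E / ((cmod h)\<^sup>2 * E + sw)))"

text \<open>
  The ML error probability for \<open>M\<close> equiprobable messages, averaged over the fading and over the
  random code-book (as well as over the noises).
\<close>

definition naf_error_prob ::
  "nat \<Rightarrow> nat \<Rightarrow> nat \<Rightarrow> real \<Rightarrow> real \<Rightarrow> real \<Rightarrow> (nat \<Rightarrow> complex \<Rightarrow> complex) \<Rightarrow> real" where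
  "naf_error_prob N L M E sw sv b =
     (\<Sum>m<M. \<P>(((g, h), X, w, v) in
               fading N \<Otimes>\<^sub>M codebook N L M E \<Otimes>\<^sub>M relay_noise N L sw \<Otimes>\<^sub>M dest_noise N L sv.
             let \<beta> = (\<lambda>i. b i (h i))
             in ml_decode N L M sw sv g h \<beta> X (received g h \<beta> (X m) w v) \<noteq> m)) / real M"

text \<open>Bits per channel use: a code-book of \<open>M\<close> codewords of \<open>2 * (N - 1) * L\<close> symbols.\<close>

definition code_rate :: "nat \<Rightarrow> nat \<Rightarrow> nat \<Rightarrow> real" where
  "code_rate N L M = log 2 (real M) / real (2 * (N - 1) * L)"

definition has_multiplexing_gain :: "(real \<Rightarrow> real) \<Rightarrow> real \<Rightarrow> bool" where
  "has_multiplexing_gain R r \<longleftrightarrow> ((\<lambda>\<rho>. R \<rho> / log 2 \<rho>) \<longlongrightarrow> r) at_top"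

text \<open>Positivity is required because \<open>log 2 0 = 0\<close> in HOL.\<close>

definition has_diversity_gain :: "(real \<Rightarrow> real) \<Rightarrow> real \<Rightarrow> bool" where
  "has_diversity_gain P d \<longleftrightarrow>
     (\<forall>\<^sub>F \<rho> in at_top. 0 < P \<rho>) \<and> ((\<lambda>\<rho>. - (log 2 (P \<rho>) / log 2 \<rho>)) \<longlongrightarrow> d) at_top"

end

theory Submission
  imports Defs
begin

text \<open>
  The repetition gain is \<open>1 / sqrt (1 + |h|^2)\<close>. Given the channel gains, each frame is a two-by-two
  Gaussian channel whose determinant \<open>D\<close> is of order \<open>(1 + \<rho> |g 1|^2)^2 + \<rho> |c|^2\<close>, where \<open>c\<close> is the gain
  of the relayed path.

  Upper bound: the Chernoff union bound gives a conditional error of at most \<open>min 1 (M / (\<Prod>D)^L)\<close>,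
  hence at most \<open>M^\<theta> / (\<Prod>D)^(L \<theta>)\<close> for every \<open>\<theta>\<close> in \<open>[0, 1]\<close>. With \<open>L \<theta> = u / (2 (N - 1)) + w\<close> and
  \<open>u, w < 1\<close>, bound \<open>D\<close> below by its first summand for the share \<open>u\<close> and by its second for the share
  \<open>w\<close>; the negative moments of orders \<open>u\<close> and \<open>w\<close> of the fading are finite, so the error exponent is at
  least \<open>u (1 - r) + (N - 1) w (1 - 2 r)\<close>. Let \<open>u\<close> tend to 1, and \<open>w\<close> to 1 or 0 according to the sign
  of \<open>1 - 2 r\<close>. Here \<open>\<theta> \<le> 1\<close> needs only \<open>L \<ge> 2\<close>.

  Lower bound: given the gains, the probability of a correct decision is at most \<open>sqrt ((\<Prod>D)^L / M)\<close>,
  which stays below 1 if \<open>|g 1|^2\<close> is below a constant times \<open>\<rho>^(r' - 1)\<close> and the other \<open>|g i|^2\<close>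
  below a constant times \<open>\<rho>^(- max (1 - 2 r') 0)\<close>, for \<open>r' < r\<close> (or \<open>r' = 0\<close> if \<open>r = 0\<close>). The
  probability of this event has the exponent of the theorem at \<open>r'\<close>.
\<close>

section \<open>Complex Gaussian integrals\<close>

text \<open>The block length stays fixed while \<rho> grows, so no law of large numbers along the
  codeword is available. The interpolation \<open>min 1 x \<le> x powr \<theta>\<close> is used
  because a power of a product of determinants still factorises over the relays once the direct gain
  is separated: the fading average splits into one moment for the direct link and
  \<open>N - 1\<close> equal moments for the relays. The shares stay below 1 because
  \<open>sqmod\<close> of a gain has positive density at 0, which makes its moment of order -1
  infinite; hence the exponent is reached only in the limit.

  The converse has to work with very weak information on the rate. The multiplexing gain fixes
  \<open>M\<close> only up to a factor \<rho>^(o(1)), and moving down to a smaller rate absorbs it.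
  At rate 0 there is nothing below, and all that is known is \<open>2 \<le> M\<close>, so the bound
  must say something about two codewords. This is why the event is cut with an explicit small
  constant: it keeps the product of all determinants below \<open>3 / 2\<close> in that
  case.\<close>

lemma nn_integral_lborel_translate:
  fixes a :: complex
  assumes [measurable]: "f \<in> borel_measurable borel"
  shows "(\<integral>\<^sup>+x. f (x + a) \<partial>lborel) = (\<integral>\<^sup>+x. f x \<partial>lborel)"
proof -
  have "(\<integral>\<^sup>+x. f x \<partial>lborel) = (\<integral>\<^sup>+x. f x \<partial>distr lborel borel ((+) a))" by (simp add: lborel_distr_plus)
  also have "\<dots> = (\<integral>\<^sup>+x. f (x + a) \<partial>lborel)" by (subst nn_integral_distr) (auto simp: add.commute)
  finally show ?thesis by simp
qed

lemma nn_integral_lborel_scale_complex: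
  fixes c :: real
  assumes [measurable]: "f \<in> borel_measurable borel" and c: "c > 0"
  shows "(\<integral>\<^sup>+x. f (x :: complex) \<partial>lborel) = ennreal (c\<^sup>2) * (\<integral>\<^sup>+x. f (c *\<^sub>R x) \<partial>lborel)"
proof -
  have "(lborel :: complex measure) = density (distr lborel borel (\<lambda>x. 0 + c *\<^sub>R x)) (\<lambda>_. ennreal (\<bar>c\<bar> ^ DIM(complex)))"
    using c by (intro lborel_affine) auto
  then have "(lborel :: complex measure) = density (distr lborel borel (\<lambda>x. c *\<^sub>R x)) (\<lambda>_. ennreal (c\<^sup>2))" by simp
  then have "(\<integral>\<^sup>+x. f (x :: complex) \<partial>lborel) =
      (\<integral>\<^sup>+x. f (x :: complex) \<partial>density (distr lborel borel (\<lambda>x. c *\<^sub>R x)) (\<lambda>_. ennreal (c\<^sup>2)))"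
    by simp
  also have "\<dots> = ennreal (c\<^sup>2) * (\<integral>\<^sup>+x. f (c *\<^sub>R x) \<partial>lborel)"
    by (simp add: nn_integral_density nn_integral_distr nn_integral_cmult)
  finally show ?thesis .
qed

lemma cnormal_density_measurable [measurable]: "cnormal_density s \<in> borel_measurable borel"
  unfolding cnormal_density_def by measurable

lemma cnormal_density_nonneg [simp]: "0 < s \<Longrightarrow> 0 \<le> cnormal_density s z"
  by (simp add: cnormal_density_def)

lemma cnormal_density_pos: "0 < s \<Longrightarrow> 0 < cnormal_density s z"
  by (simp add: cnormal_density_def)

lemma nn_integral_cnormal_density:
  assumes s: "s > 0"
  shows "(\<integral>\<^sup>+z. ennreal (cnormal_density s z) \<partial>lborel) = 1"
proof -
  \<comment> \<open>The real and imaginary parts are independent real normals of variance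
    \<open>s / 2\<close>, one for each basis vector.\<close>
  define f where "f = (\<lambda>(b::complex). normal_density 0 (sqrt (s / 2)))"
  have *: "cnormal_density s z = (\<Prod>b\<in>Basis. f b (z \<bullet> b))" for z using s
    by (simp add: cnormal_density_def f_def Basis_complex_def normal_density_def inner_complex_def
          cmod_power2 real_sqrt_mult exp_add[symmetric] field_simps)
  have "(\<integral>\<^sup>+z. ennreal (cnormal_density s z) \<partial>lborel) = (\<integral>\<^sup>+z. (\<Prod>b\<in>Basis. ennreal (f b (z \<bullet> b))) \<partial>lborel)"
    by (simp add: * f_def prod_ennreal)
  also have "\<dots> = (\<Prod>b\<in>(Basis::complex set). (\<integral>\<^sup>+x. f b x \<partial>lborel))" by (rule nn_integral_lborel_prod) (auto simp: f_def)
  also have "\<dots> = 1" using s by (simp add: f_def nn_integral_eq_integral)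
  finally show ?thesis .
qed

lemma sets_cnormal [measurable_cong, simp]: "sets (cnormal s) = sets borel"
  by (simp add: cnormal_def)

lemma measurable_cnormal_eq [simp]: "measurable (cnormal s) K = measurable borel K"
  by (rule measurable_cong_sets) auto

lemma space_cnormal [simp]: "space (cnormal s) = UNIV"
  by (simp add: cnormal_def)

lemma prob_space_cnormal:
  assumes "s > 0" shows "prob_space (cnormal s)"
  by (rule prob_spaceI) (simp add: cnormal_def emeasure_density nn_integral_cnormal_density assms)

lemma nn_integral_cnormal:
  assumes [measurable]: "f \<in> borel_measurable borel"
  shows "(\<integral>\<^sup>+z. f z \<partial>cnormal s) = (\<integral>\<^sup>+z. ennreal (cnormal_density s z) * f z \<partial>lborel)"
  unfolding cnormal_def by (subst nn_integral_density) auto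

lemma nn_integral_cnormal_shift:
  assumes [measurable]: "f \<in> borel_measurable borel"
  shows "(\<integral>\<^sup>+z. f (a + z) \<partial>cnormal s) = (\<integral>\<^sup>+y. ennreal (cnormal_density s (y - a)) * f y \<partial>lborel)"
proof -
  have "(\<integral>\<^sup>+z. f (a + z) \<partial>cnormal s) = (\<integral>\<^sup>+z. ennreal (cnormal_density s ((z + a) - a)) * f (z + a) \<partial>lborel)"
    by (subst nn_integral_cnormal) (auto simp: add.commute)
  also have "\<dots> = (\<integral>\<^sup>+y. ennreal (cnormal_density s (y - a)) * f y \<partial>lborel)"
    by (rule nn_integral_lborel_translate) measurable
  finally show ?thesis .
qed

section \<open>Gaussian averages of exponentials of quadratics\<close>

abbreviation sqmod :: "complex \<Rightarrow> real" where
  "sqmod z \<equiv> (cmod z)\<^sup>2"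

lemma cmod_diff_power2: "sqmod (a - b) = sqmod a - 2 * Re (cnj a * b) + sqmod b"
  by (simp only: cmod_power2) (simp add: power2_eq_square algebra_simps)

text \<open>Completing the square: the tilted density is \<open>K\<close> times a normal density of
  variance \<open>s'\<close> centred at \<beta> scaled by \<open>s'\<close>, which has mass 1.
  \<open>\<alpha>\<close> may be negative as long as the new precision
  \<open>1 / s + \<alpha>\<close> stays positive; the value \<open>- 1 / 2\<close> is used later to
  integrate a growing exponential.\<close>

lemma cnormal_exp_quadratic:
  assumes s: "s > 0" and al: "1 + \<alpha> * s > 0"
  shows "(\<integral>\<^sup>+x. ennreal (exp (2 * Re (cnj \<beta> * x) - \<alpha> * sqmod x)) \<partial>cnormal s) =
     ennreal (exp (s * sqmod \<beta> / (1 + \<alpha> * s)) / (1 + \<alpha> * s))"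
proof -
  define s' where "s' = s / (1 + \<alpha> * s)"
  have s': "s' > 0" using s al by (simp add: s'_def)
  define K where "K = exp (s' * sqmod \<beta>) / (1 + \<alpha> * s)"
  have K: "K \<ge> 0" using al by (simp add: K_def)
  have *: "cnormal_density s x * exp (2 * Re (cnj \<beta> * x) - \<alpha> * sqmod x) = K * cnormal_density s' (x - s' *\<^sub>R \<beta>)" for x
  proof -
    have inv: "1 / s' = 1 / s + \<alpha>" using s al by (simp add: s'_def field_simps)
    have a: "sqmod (x - s' *\<^sub>R \<beta>) = sqmod x - 2 * s' * Re (cnj \<beta> * x) + s'\<^sup>2 * sqmod \<beta>"
      unfolding cmod_diff_power2 by (simp add: algebra_simps power_mult_distrib)
    have "- sqmod (x - s' *\<^sub>R \<beta>) / s' = - (sqmod x * (1 / s')) + 2 * Re (cnj \<beta> * x) - s' * sqmod \<beta>"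
      unfolding a using s' by (simp add: field_simps power2_eq_square)
    also have "\<dots> = - sqmod x / s + (2 * Re (cnj \<beta> * x) - \<alpha> * sqmod x) - s' * sqmod \<beta>"
      unfolding inv by (simp add: algebra_simps)
    finally have e: "- sqmod x / s + (2 * Re (cnj \<beta> * x) - \<alpha> * sqmod x)
        = s' * sqmod \<beta> + - sqmod (x - s' *\<^sub>R \<beta>) / s'" by linarith
    have ps: "pi * s' * (1 + \<alpha> * s) = pi * s" using al by (simp add: s'_def)
    have "cnormal_density s x * exp (2 * Re (cnj \<beta> * x) - \<alpha> * sqmod x)
      = exp (- sqmod x / s + (2 * Re (cnj \<beta> * x) - \<alpha> * sqmod x)) / (pi * s)"
      by (simp only: exp_add cnormal_density_def) simp
    also have "\<dots> = exp (s' * sqmod \<beta>) * exp (- sqmod (x - s' *\<^sub>R \<beta>) / s') / (pi * s' * (1 + \<alpha> * s))"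
      unfolding e ps exp_add by simp
    also have "\<dots> = K * cnormal_density s' (x - s' *\<^sub>R \<beta>)" by (simp add: K_def cnormal_density_def field_simps)
    finally show ?thesis .
  qed
  have "(\<integral>\<^sup>+x. ennreal (exp (2 * Re (cnj \<beta> * x) - \<alpha> * sqmod x)) \<partial>cnormal s) =
     (\<integral>\<^sup>+x. ennreal K * ennreal (cnormal_density s' (x + (- s' *\<^sub>R \<beta>))) \<partial>lborel)"
  proof (subst nn_integral_cnormal, measurable, rule nn_integral_cong)
    fix x
    have "ennreal (cnormal_density s x) * ennreal (exp (2 * Re (cnj \<beta> * x) - \<alpha> * sqmod x)) =
      ennreal (K * cnormal_density s' (x - s' *\<^sub>R \<beta>))"
      using s by (subst ennreal_mult[symmetric]) (simp_all only: * cnormal_density_nonneg exp_ge_zero)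
    then show "ennreal (cnormal_density s x) * ennreal (exp (2 * Re (cnj \<beta> * x) - \<alpha> * sqmod x)) =
      ennreal K * ennreal (cnormal_density s' (x + (- s' *\<^sub>R \<beta>)))"
      using s' K by (simp add: ennreal_mult)
  qed
  also have "\<dots> = ennreal K * (\<integral>\<^sup>+x. ennreal (cnormal_density s' (x + (- s' *\<^sub>R \<beta>))) \<partial>lborel)"
    by (rule nn_integral_cmult) measurable
  also have "\<dots> = ennreal K" by (subst nn_integral_lborel_translate) (use s' in \<open>auto simp: nn_integral_cnormal_density\<close>)
  finally show ?thesis by (simp add: K_def s'_def)
qed

text \<open>Integrating out a Gaussian input seen through a gain \<open>\<gamma>\<close> divides the
  precision \<open>t\<close> by \<open>1 + t * s * sqmod \<gamma>\<close>. This serves both for the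
  second symbol of a frame and for the relay noise.\<close>

lemma cnormal_exp_square:
  assumes s: "s > 0" and t: "t \<ge> 0"
  shows "(\<integral>\<^sup>+x. ennreal (exp (- t * sqmod (e - \<gamma> * x))) \<partial>cnormal s) =
     ennreal (exp (- t * sqmod e / (1 + t * s * sqmod \<gamma>)) / (1 + t * s * sqmod \<gamma>))"
proof -
  define \<beta> where "\<beta> = of_real t * cnj \<gamma> * e"
  define D where "D = 1 + t * sqmod \<gamma> * s"
  have D: "D > 0" unfolding D_def using s t by (intro add_pos_nonneg) auto
  have *: "exp (- t * sqmod (e - \<gamma> * x)) = exp (- t * sqmod e) * exp (2 * Re (cnj \<beta> * x) - (t * sqmod \<gamma>) * sqmod x)" for x
    unfolding exp_add[symmetric] cmod_diff_power2 \<beta>_def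
    by (simp add: algebra_simps norm_mult power_mult_distrib)
  have "(\<integral>\<^sup>+x. ennreal (exp (- t * sqmod (e - \<gamma> * x))) \<partial>cnormal s) =
    ennreal (exp (- t * sqmod e)) * (\<integral>\<^sup>+x. ennreal (exp (2 * Re (cnj \<beta> * x) - (t * sqmod \<gamma>) * sqmod x)) \<partial>cnormal s)"
    unfolding * by (subst nn_integral_cmult[symmetric]) (auto simp: ennreal_mult)
  also have "\<dots> = ennreal (exp (- t * sqmod e)) * ennreal (exp (s * sqmod \<beta> / D) / D)"
    by (subst cnormal_exp_quadratic) (use s D in \<open>auto simp: D_def\<close>)
  also have "\<dots> = ennreal (exp (- t * sqmod e + s * sqmod \<beta> / D) / D)"
    using D by (simp add: ennreal_mult[symmetric] exp_add[symmetric])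
  also have "- t * sqmod e + s * sqmod \<beta> / D = - t * sqmod e / D"
  proof -
    have "s * sqmod \<beta> = t * sqmod e * (D - 1)"
      unfolding \<beta>_def D_def by (simp add: norm_mult power_mult_distrib) (simp add: algebra_simps power2_eq_square)
    then have "s * sqmod \<beta> / D = t * sqmod e - t * sqmod e / D"
      using D by (simp add: right_diff_distrib diff_divide_distrib)
    then show ?thesis by simp
  qed
  finally show ?thesis by (simp add: D_def mult_ac)
qed

text \<open>Destination noise and forwarded relay noise are independent, so their variances add.
  This gives the likelihood a closed form.\<close>

lemma cnormal_density_convolution:
  assumes s: "s > 0" and v: "v > 0"
  shows "(\<integral>\<^sup>+x. ennreal (cnormal_density v (e - \<gamma> * x)) \<partial>cnormal s) = ennreal (cnormal_density (v + sqmod \<gamma> * s) e)"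
proof -
  define V where "V = v + sqmod \<gamma> * s"
  have V: "V > 0" unfolding V_def using s v by (intro add_pos_nonneg) auto
  have D: "1 + 1 / v * s * sqmod \<gamma> = V / v" using v by (simp add: V_def field_simps)
  have "(\<integral>\<^sup>+x. ennreal (cnormal_density v (e - \<gamma> * x)) \<partial>cnormal s) =
    (\<integral>\<^sup>+x. ennreal (1 / (pi * v)) * ennreal (exp (- (1 / v) * sqmod (e - \<gamma> * x))) \<partial>cnormal s)"
    using v by (intro nn_integral_cong) (simp add: ennreal_mult[symmetric] cnormal_density_def)
  also have "\<dots> = ennreal (1 / (pi * v)) * ennreal (exp (- (1 / v) * sqmod e / (V / v)) / (V / v))"
    by (subst nn_integral_cmult, simp, subst cnormal_exp_square) (use s v D in auto)
  also have "\<dots> = ennreal (cnormal_density V e)" using v V by (simp add: ennreal_mult[symmetric] cnormal_density_def)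
  finally show ?thesis by (simp add: V_def)
qed

text \<open>
  One cooperation frame is the channel with rows \<open>(g, 0)\<close> and \<open>(c, g)\<close>; its Gaussian average is
  \<open>exp (- frame_form) / frame_det\<close>. The argument \<open>a\<close> of \<open>frame_det\<close> is the squared modulus of
  \<open>g\<close>, and likewise its argument \<open>c\<close>.
\<close>

definition frame_det :: "real \<Rightarrow> real \<Rightarrow> real \<Rightarrow> real \<Rightarrow> real \<Rightarrow> real" where
  "frame_det E t1 t2 a c = (1 + t1 * E * a) * (1 + t2 * E * a) + t2 * E * c"

definition frame_form ::
  "real \<Rightarrow> real \<Rightarrow> real \<Rightarrow> complex \<Rightarrow> complex \<Rightarrow> complex \<Rightarrow> complex \<Rightarrow> real" where
  "frame_form E t1 t2 g c y1 y2 = (let t = t2 / (1 + t2 * E * sqmod g) in t1 * sqmod y1 + t * sqmod y2 -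
     E * sqmod (of_real t1 * cnj g * y1 + of_real t * cnj c * y2) / (1 + (t1 * sqmod g + t * sqmod c) * E))"

lemma frame_form_scale:
  "frame_form E t1 t2 g c (r *\<^sub>R y1) (r *\<^sub>R y2) = r\<^sup>2 * frame_form E t1 t2 g c y1 y2"
proof -
  have *: "of_real t1 * cnj g * (r *\<^sub>R y1) + of_real t * cnj c * (r *\<^sub>R y2)
    = r *\<^sub>R (of_real t1 * cnj g * y1 + of_real t * cnj c * y2)" for t
    by (simp add: algebra_simps scaleR_conv_of_real)
  show ?thesis unfolding frame_form_def Let_def *
    by (simp only: norm_scaleR power_mult_distrib power2_abs) (simp add: algebra_simps)
qed

text \<open>Cauchy-Schwarz with weights \<open>t1\<close> and \<open>t\<close>: the squared
  correlation is at most \<open>P * S\<close>. The error bound uses it to drop the exponential and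
  keep only the determinant.\<close>

lemma frame_form_nonneg:
  assumes E: "E > 0" and t1: "t1 \<ge> 0" and t2: "t2 \<ge> 0"
  shows "0 \<le> frame_form E t1 t2 g c y1 y2"
proof -
  define t where "t = t2 / (1 + t2 * E * sqmod g)"
  have t: "t \<ge> 0" unfolding t_def using E t2 by (intro divide_nonneg_nonneg) auto
  define S where "S = t1 * sqmod y1 + t * sqmod y2"
  define P where "P = t1 * sqmod g + t * sqmod c"
  have S: "S \<ge> 0" and P: "P \<ge> 0" using t1 t by (auto simp: S_def P_def)
  have n: "cmod (of_real t1 * cnj g * y1 + of_real t * cnj c * y2) \<le> t1 * cmod g * cmod y1 + t * cmod c * cmod y2"
    by (rule order.trans[OF norm_triangle_ineq]) (use t1 t in \<open>simp add: norm_mult\<close>)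
  have "sqmod (of_real t1 * cnj g * y1 + of_real t * cnj c * y2) \<le> (t1 * cmod g * cmod y1 + t * cmod c * cmod y2)\<^sup>2"
    by (rule power_mono[OF n]) simp
  also have "\<dots> \<le> P * S"
  proof -
    have "P * S - (t1 * cmod g * cmod y1 + t * cmod c * cmod y2)\<^sup>2 = t1 * t * (cmod g * cmod y2 - cmod c * cmod y1)\<^sup>2"
      unfolding P_def S_def by (simp add: power2_eq_square algebra_simps)
    moreover have "0 \<le> t1 * t * (cmod g * cmod y2 - cmod c * cmod y1)\<^sup>2" using t1 t by simp
    ultimately show ?thesis by linarith
  qed
  finally have "E * sqmod (of_real t1 * cnj g * y1 + of_real t * cnj c * y2) \<le> S * (1 + P * E)"
    using E S by (simp add: algebra_simps) (smt (verit) mult_left_mono mult.left_commute mult.commute)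
  moreover have "1 + P * E > 0" using P E by (intro add_pos_nonneg) auto
  ultimately show ?thesis unfolding frame_form_def Let_def t_def[symmetric] P_def[symmetric] S_def[symmetric]
    by (simp add: pos_divide_le_eq)
qed

text \<open>The second symbol reaches only \<open>y2\<close>, so integrating it first turns the
  precision \<open>t2\<close> into \<open>t\<close>; what remains is one Gaussian symbol observed
  through both \<open>g\<close> and \<open>c\<close>. The two normalising factors \<open>D2\<close>
  and \<open>1 + P * E\<close> multiply to the determinant.\<close>

lemma frame_integral:
  assumes E: "E > 0" and t1: "t1 \<ge> 0" and t2: "t2 \<ge> 0"
  shows "(\<integral>\<^sup>+x1. \<integral>\<^sup>+x2. ennreal (exp (- t1 * sqmod (y1 - g * x1) - t2 * sqmod (y2 - g * x2 - c * x1)))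
            \<partial>cnormal E \<partial>cnormal E) = ennreal (exp (- frame_form E t1 t2 g c y1 y2) / frame_det E t1 t2 (sqmod g) (sqmod c))"
proof -
  define D2 where "D2 = 1 + t2 * E * sqmod g"
  define t where "t = t2 / D2"
  have D2: "D2 > 0" unfolding D2_def using E t2 by (intro add_pos_nonneg) auto
  have t: "t \<ge> 0" unfolding t_def using D2 t2 by simp
  define P where "P = t1 * sqmod g + t * sqmod c"
  have P: "P \<ge> 0" using t1 t by (auto simp: P_def)
  have PE: "1 + P * E > 0" using P E by (intro add_pos_nonneg) auto
  define b where "b = of_real t1 * cnj g * y1 + of_real t * cnj c * y2"
  let ?e = "\<lambda>x1 x2. - t1 * sqmod (y1 - g * x1) - t2 * sqmod (y2 - g * x2 - c * x1)"
  have inner: "(\<integral>\<^sup>+x2. ennreal (exp (?e x1 x2)) \<partial>cnormal E) = ennreal (exp (- t1 * sqmod y1 - t * sqmod y2) / D2) *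
       ennreal (exp (2 * Re (cnj b * x1) - P * sqmod x1))" for x1
  proof -
    have "(\<integral>\<^sup>+x2. ennreal (exp (?e x1 x2)) \<partial>cnormal E)
      = (\<integral>\<^sup>+x2. ennreal (exp (- t1 * sqmod (y1 - g * x1))) * ennreal (exp (- t2 * sqmod ((y2 - c * x1) - g * x2))) \<partial>cnormal E)"
      by (intro nn_integral_cong) (simp add: ennreal_mult[symmetric] exp_add[symmetric] algebra_simps)
    also have "\<dots> = ennreal (exp (- t1 * sqmod (y1 - g * x1))) * ennreal (exp (- t2 * sqmod (y2 - c * x1) / D2) / D2)"
      by (subst nn_integral_cmult, simp, subst cnormal_exp_square) (use E t2 in \<open>auto simp: D2_def\<close>)
    also have "\<dots> = ennreal (exp (- t1 * sqmod (y1 - g * x1) - t * sqmod (y2 - c * x1)) / D2)"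
      using D2 by (simp add: ennreal_mult[symmetric] exp_add[symmetric] t_def)
    also have "- t1 * sqmod (y1 - g * x1) - t * sqmod (y2 - c * x1) =
      (- t1 * sqmod y1 - t * sqmod y2) + (2 * Re (cnj b * x1) - P * sqmod x1)"
      unfolding cmod_diff_power2 b_def P_def
      by (simp add: algebra_simps norm_mult power_mult_distrib)
    finally show ?thesis using D2 by (simp add: ennreal_mult[symmetric] exp_add)
  qed
  have "(\<integral>\<^sup>+x1. \<integral>\<^sup>+x2. ennreal (exp (?e x1 x2)) \<partial>cnormal E \<partial>cnormal E) =
    ennreal (exp (- t1 * sqmod y1 - t * sqmod y2) / D2) * ennreal (exp (E * sqmod b / (1 + P * E)) / (1 + P * E))"
    unfolding inner by (subst nn_integral_cmult, simp, subst cnormal_exp_quadratic) (use E PE in auto)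
  also have "\<dots> = ennreal (exp (- t1 * sqmod y1 - t * sqmod y2 + E * sqmod b / (1 + P * E)) / (D2 * (1 + P * E)))"
    using D2 PE by (simp add: ennreal_mult[symmetric] exp_add)
  also have "- t1 * sqmod y1 - t * sqmod y2 + E * sqmod b / (1 + P * E) = - frame_form E t1 t2 g c y1 y2"
    by (simp add: frame_form_def Let_def t_def D2_def b_def P_def)
  also have "D2 * (1 + P * E) = frame_det E t1 t2 (sqmod g) (sqmod c)"
  proof -
    have "D2 * t = t2" using D2 by (simp add: t_def)
    have "D2 * (1 + P * E) = D2 + D2 * t1 * sqmod g * E + (D2 * t) * sqmod c * E" by (simp add: P_def algebra_simps)
    then show ?thesis unfolding \<open>D2 * t = t2\<close> frame_det_def by (simp add: D2_def algebra_simps)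
  qed
  finally show ?thesis .
qed

lemma frame_det_pos:
  assumes "E \<ge> 0" "t1 \<ge> 0" "t2 \<ge> 0" "a \<ge> 0" "c \<ge> 0"
  shows "1 \<le> frame_det E t1 t2 a c"
proof -
  have "1 * 1 \<le> (1 + t1 * E * a) * (1 + t2 * E * a)" using assms by (intro mult_mono) auto
  then show ?thesis using assms unfolding frame_det_def by (simp add: add_increasing2)
qed

section \<open>Products over slots\<close>

lemma sigma_finite_cnormal: "s > 0 \<Longrightarrow> sigma_finite_measure (cnormal s)"
  by (rule prob_space_imp_sigma_finite[OF prob_space_cnormal])

lemma product_sigma_finite_cnormal: "s > 0 \<Longrightarrow> product_sigma_finite (\<lambda>_. cnormal s)"
  by (simp add: product_sigma_finite_def sigma_finite_cnormal)

lemma prob_space_PiM_cnormal: "s > 0 \<Longrightarrow> prob_space (\<Pi>\<^sub>M i\<in>I. cnormal s)"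
  by (intro prob_space_PiM prob_space_cnormal)

lemma measurable_component_cnormal:
  "i \<in> I \<Longrightarrow> (\<lambda>x. x i) \<in> borel_measurable (\<Pi>\<^sub>M i\<in>I. cnormal s)"
  using measurable_component_singleton[of i I "\<lambda>_. cnormal s"]
  by (simp add: measurable_cong_sets[OF refl sets_cnormal])

text \<open>The slots over an arbitrary set of frames, so that products and integrals over slots can
  be treated by induction on the frames, two slots at a time.\<close>

definition frame_slots :: "(nat \<times> nat) set \<Rightarrow> (nat \<times> nat \<times> nat) set" where
  "frame_slots A = {(k, i, j). (k, i) \<in> A \<and> j \<in> {1, 2}}"

lemma slots_eq_frame_slots: "slots N L = frame_slots (frames N L)"
  by (auto simp: slots_def frames_def frame_slots_def)

lemma frame_slots_empty [simp]: "frame_slots {} = {}"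
  by (simp add: frame_slots_def)

lemma frame_slots_insert:
  "frame_slots (insert (k, i) A) = insert (k, i, 1) (insert (k, i, 2) (frame_slots A))"
  by (auto simp: frame_slots_def)

lemma finite_frames [simp]: "finite (frames N L)"
  by (simp add: frames_def)

lemma finite_slots [simp]: "finite (slots N L)"
  by (simp add: slots_def)

lemma finite_frame_slots [simp]: "finite A \<Longrightarrow> finite (frame_slots A)"
proof (induction A rule: finite_induct)
  case (insert q A)
  then show ?case by (cases q) (simp add: frame_slots_insert)
qed simp

lemma prod_frame_slots:
  assumes "finite A"
  shows "(\<Prod>p\<in>frame_slots A. f p) = (\<Prod>(k, i)\<in>A. f (k, i, 1) * (f (k, i, 2) :: 'a :: comm_monoid_mult))"
  using assms
proof (induction A rule: finite_induct)
  case (insert q A)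
  obtain k i where q: "q = (k, i)" by fastforce
  have "(k, i, j) \<notin> frame_slots A" for j using insert(2) q by (auto simp: frame_slots_def)
  then show ?case using insert q by (simp add: frame_slots_insert mult_ac)
qed simp

text \<open>The integrand couples the two slots of a frame, so the product rule for single
  coordinates does not apply; the induction peels off two coordinates at once. The measure is
  general because the rule serves Gaussian symbols and noises as well as Lebesgue measure on the
  received block.\<close>

lemma nn_integral_frame_slots:
  fixes f :: "nat \<times> nat \<Rightarrow> complex \<Rightarrow> complex \<Rightarrow> ennreal"
  assumes \<mu>: "sigma_finite_measure \<mu>" and sets: "sets \<mu> = sets borel" and "finite A"
    and "\<And>q. q \<in> A \<Longrightarrow> case_prod (f q) \<in> borel_measurable (borel \<Otimes>\<^sub>M borel)"
  shows "(\<integral>\<^sup>+x. (\<Prod>(k, i)\<in>A. f (k, i) (x (k, i, 1)) (x (k, i, 2))) \<partial>(\<Pi>\<^sub>M p\<in>frame_slots A. \<mu>)) =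
    (\<Prod>q\<in>A. \<integral>\<^sup>+a. \<integral>\<^sup>+b. f q a b \<partial>\<mu> \<partial>\<mu>)"
  using assms(3,4)
proof (induction A rule: finite_induct)
  case empty
  show ?case by (simp add: PiM_empty nn_integral_count_space_finite)
next
  case (insert q A)
  obtain k i where q: "q = (k, i)" by fastforce
  interpret product_sigma_finite "\<lambda>_. \<mu>" using \<mu> by (simp add: product_sigma_finite_def)
  note [measurable_cong] = sets
  have notin: "(k, i, j) \<notin> frame_slots A" for j using insert(2) q by (auto simp: frame_slots_def)
  let ?PA = "(\<Pi>\<^sub>M p\<in>frame_slots A. \<mu>)"
  let ?P2 = "(\<Pi>\<^sub>M p\<in>insert (k, i, 2) (frame_slots A). \<mu>)"
  define G :: "(nat \<times> nat \<times> nat \<Rightarrow> complex) \<Rightarrow> ennreal"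
    where "G x = (\<Prod>(k, i)\<in>A. f (k, i) (x (k, i, 1)) (x (k, i, 2)))" for x
  have comp: "(\<lambda>x. x p) \<in> borel_measurable (\<Pi>\<^sub>M p\<in>S. \<mu>)" if "p \<in> S" for p and S :: "(nat \<times> nat \<times> nat) set"
    using measurable_component_singleton[OF that, of "\<lambda>_. \<mu>"] by (simp add: measurable_cong_sets[OF refl sets])
  have f_comp: "(\<lambda>x. f (k, i) (x (k, i, 1)) (x (k, i, 2))) \<in> borel_measurable (\<Pi>\<^sub>M p\<in>S. \<mu>)"
    if "(k, i) \<in> insert q A" "(k, i, 1) \<in> S" "(k, i, 2) \<in> S" for k i and S :: "(nat \<times> nat \<times> nat) set"
    using measurable_compose[OF measurable_Pair[OF comp[OF that(2)] comp[OF that(3)]] insert.prems[OF that(1)]] by simp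
  have Gm: "G \<in> borel_measurable (\<Pi>\<^sub>M p\<in>S. \<mu>)" if "frame_slots A \<subseteq> S" for S unfolding G_def using that
    by (intro borel_measurable_prod_ennreal) (auto intro!: f_comp simp: frame_slots_def simp del: One_nat_def split: prod.splits)
  have [measurable]: "case_prod (f (k, i)) \<in> borel_measurable (borel \<Otimes>\<^sub>M borel)" using insert.prems q by simp
  have [measurable]: "G \<in> borel_measurable ?PA" by (rule Gm) simp
  \<comment> \<open>\<open>G\<close> reads only slots of frames in \<open>A\<close>, so it passes
    through both new integrals.\<close>
  have Gupd: "G (x((k, i, j) := z)) = G x" for x j z unfolding G_def using insert(2) q by (intro prod.cong) auto
  have "(\<integral>\<^sup>+x. (\<Prod>(k, i)\<in>insert q A. f (k, i) (x (k, i, 1)) (x (k, i, 2))) \<partial>(\<Pi>\<^sub>M p\<in>frame_slots (insert q A). \<mu>))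
    = (\<integral>\<^sup>+x. f (k, i) (x (k, i, 1)) (x (k, i, 2)) * G x \<partial>(\<Pi>\<^sub>M p\<in>insert (k, i, 1) (insert (k, i, 2) (frame_slots A)). \<mu>))"
    using insert(1,2) by (simp add: q frame_slots_insert G_def)
  also have "\<dots> = (\<integral>\<^sup>+a. \<integral>\<^sup>+x. f (k, i) a (x (k, i, 2)) * G x \<partial>?P2 \<partial>\<mu>)" using insert(1) notin
    by (subst product_nn_integral_insert_rev)
       (auto intro!: nn_integral_cong borel_measurable_times_ennreal f_comp Gm simp: q Gupd[simplified])
  also have "\<dots> = (\<integral>\<^sup>+a. \<integral>\<^sup>+b. \<integral>\<^sup>+x. f (k, i) a b * G x \<partial>?PA \<partial>\<mu> \<partial>\<mu>)"
  proof (rule nn_integral_cong)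
    fix a
    have [measurable]: "G \<in> borel_measurable ?P2" by (rule Gm) auto
    have [measurable]: "(\<lambda>x. x (k, i, 2)) \<in> borel_measurable ?P2" by (rule comp) auto
    show "(\<integral>\<^sup>+x. f (k, i) a (x (k, i, 2)) * G x \<partial>?P2) = (\<integral>\<^sup>+b. \<integral>\<^sup>+x. f (k, i) a b * G x \<partial>?PA \<partial>\<mu>)" using insert(1) notin
      by (subst product_nn_integral_insert_rev)
         (auto intro!: nn_integral_cong simp: q Gupd[simplified])
  qed
  also have "\<dots> = (\<integral>\<^sup>+a. \<integral>\<^sup>+b. f (k, i) a b \<partial>\<mu> \<partial>\<mu>) * (\<integral>\<^sup>+x. G x \<partial>?PA)"
  proof -
    interpret \<mu>: sigma_finite_measure \<mu> by fact
    show ?thesis by (simp add: nn_integral_cmult nn_integral_multc)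
  qed
  finally show ?case using insert by (simp add: q G_def)
qed

text \<open>This makes the received block the variable of integration in place of the noise: the
  sent message then sits in the density, and the decoding regions no longer move with it. The
  restriction to \<open>I\<close> is there because points of a product space are
  \<open>undefined\<close> outside the index set.\<close>

lemma nn_integral_PiM_cnormal_shift:
  fixes F :: "('i \<Rightarrow> complex) \<Rightarrow> ennreal"
  assumes s: "s > 0" and "finite I" and "F \<in> borel_measurable (\<Pi>\<^sub>M i\<in>I. borel)"
  shows "(\<integral>\<^sup>+v. F (\<lambda>i\<in>I. a i + v i) \<partial>(\<Pi>\<^sub>M i\<in>I. cnormal s)) =
    (\<integral>\<^sup>+y. (\<Prod>i\<in>I. ennreal (cnormal_density s (y i - a i))) * F y \<partial>(\<Pi>\<^sub>M i\<in>I. lborel))"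
  using assms(2,3)
proof (induction I arbitrary: F rule: finite_induct)
  case empty
  show ?case by (simp add: PiM_empty nn_integral_count_space_finite)
next
  case (insert j I)
  let ?C = "\<Pi>\<^sub>M i\<in>I. cnormal s"
  let ?B = "\<Pi>\<^sub>M i\<in>I. (lborel :: complex measure)"
  interpret C: product_sigma_finite "\<lambda>_. cnormal s" by (rule product_sigma_finite_cnormal[OF s])
  interpret B: product_sigma_finite "\<lambda>_::'i. lborel :: complex measure"
    by (simp add: product_sigma_finite_def lborel.sigma_finite_measure_axioms)
  note [measurable] = insert.prems
  define G where "G x = (\<integral>\<^sup>+y. ennreal (cnormal_density s (y - a j)) * F (x(j := y)) \<partial>lborel)" for x
  have setsC: "sets (\<Pi>\<^sub>M i\<in>S. cnormal s) = sets (\<Pi>\<^sub>M i\<in>S. borel)" for S :: "'i set" by (intro sets_PiM_cong) auto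
  have setsB: "sets (\<Pi>\<^sub>M i\<in>S. lborel) = sets (\<Pi>\<^sub>M i\<in>S. (borel :: complex measure))" for S :: "'i set"
    by (intro sets_PiM_cong) auto
  have upd[measurable]: "(\<lambda>(x, y). x(j := y)) \<in> (\<Pi>\<^sub>M i\<in>I. borel) \<Otimes>\<^sub>M borel \<rightarrow>\<^sub>M (\<Pi>\<^sub>M i\<in>insert j I. (borel :: complex measure))"
    using measurable_add_dim[of j I "\<lambda>_. borel"] by simp
  have G[measurable]: "G \<in> borel_measurable (\<Pi>\<^sub>M i\<in>I. borel)" unfolding G_def by measurable
  have FC: "(\<lambda>v. F (\<lambda>i\<in>insert j I. a i + v i)) \<in> borel_measurable (\<Pi>\<^sub>M i\<in>insert j I. cnormal s)"
    unfolding measurable_cong_sets[OF setsC refl]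
    by (rule measurable_compose[OF _ insert.prems]) (intro measurable_restrict borel_measurable_add; simp)
  have "(\<integral>\<^sup>+v. F (\<lambda>i\<in>insert j I. a i + v i) \<partial>(\<Pi>\<^sub>M i\<in>insert j I. cnormal s)) =
    (\<integral>\<^sup>+v. \<integral>\<^sup>+z. F (\<lambda>i\<in>insert j I. a i + (v(j := z)) i) \<partial>cnormal s \<partial>?C)"
    by (subst C.product_nn_integral_insert[OF insert(1,2) FC]) simp
  also have "\<dots> = (\<integral>\<^sup>+v. G (\<lambda>i\<in>I. a i + v i) \<partial>?C)"
  proof (rule nn_integral_cong)
    fix v
    assume "v \<in> space ?C"
    have eq: "(\<lambda>i\<in>insert j I. a i + (v(j := z)) i) = (\<lambda>i\<in>I. a i + v i)(j := a j + z)" for z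
      using insert(2) by (auto simp: fun_eq_iff)
    have sp: "(\<lambda>i\<in>I. a i + v i) \<in> space (\<Pi>\<^sub>M i\<in>I. (borel :: complex measure))" by (simp add: space_PiM)
    have "(\<lambda>y. F ((\<lambda>i\<in>I. a i + v i)(j := y))) \<in> borel_measurable borel"
      using measurable_compose[OF measurable_compose[OF measurable_Pair1'[OF sp] upd] insert.prems]
      by simp
    from nn_integral_cnormal_shift[OF this, where a = "a j" and s = s]
    show "(\<integral>\<^sup>+z. F (\<lambda>i\<in>insert j I. a i + (v(j := z)) i) \<partial>cnormal s) = G (\<lambda>i\<in>I. a i + v i)" unfolding G_def eq .
  qed
  also have "\<dots> = (\<integral>\<^sup>+y. (\<Prod>i\<in>I. ennreal (cnormal_density s (y i - a i))) * G y \<partial>?B)" by (rule insert.IH) measurable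
  also have "\<dots> = (\<integral>\<^sup>+y. \<integral>\<^sup>+z. (\<Prod>i\<in>insert j I. ennreal (cnormal_density s ((y(j := z)) i - a i))) * F (y(j := z)) \<partial>lborel \<partial>?B)"
  proof (rule nn_integral_cong)
    fix y :: "'i \<Rightarrow> complex"
    assume "y \<in> space ?B"
    then have sp: "y \<in> space (\<Pi>\<^sub>M i\<in>I. (borel :: complex measure))" by (simp add: space_PiM)
    have [measurable]: "(\<lambda>z. F (y(j := z))) \<in> borel_measurable borel"
      using measurable_compose[OF measurable_compose[OF measurable_Pair1'[OF sp] upd] insert.prems]
      by (simp add: fun_upd_def)
    have "(\<Prod>i\<in>I. ennreal (cnormal_density s ((y(j := z)) i - a i))) = (\<Prod>i\<in>I. ennreal (cnormal_density s (y i - a i)))" for z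
      using insert(2) by (intro prod.cong) auto
    then show "(\<Prod>i\<in>I. ennreal (cnormal_density s (y i - a i))) * G y =
      (\<integral>\<^sup>+z. (\<Prod>i\<in>insert j I. ennreal (cnormal_density s ((y(j := z)) i - a i))) * F (y(j := z)) \<partial>lborel)"
      unfolding G_def using insert(1,2)
      by (subst nn_integral_cmult[symmetric]) (auto intro!: nn_integral_cong simp: mult_ac)
  qed
  also have "\<dots> = (\<integral>\<^sup>+y. (\<Prod>i\<in>insert j I. ennreal (cnormal_density s (y i - a i))) * F y \<partial>(\<Pi>\<^sub>M i\<in>insert j I. lborel))"
  proof (rule B.product_nn_integral_insert[OF insert(1,2), symmetric])
    show "(\<lambda>y. (\<Prod>i\<in>insert j I. ennreal (cnormal_density s (y i - a i))) * F y) \<in> borel_measurable (\<Pi>\<^sub>M i\<in>insert j I. lborel)"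
      unfolding measurable_cong_sets[OF setsB refl] by measurable
  qed
  finally show ?case .
qed

section \<open>The likelihood and the decoder\<close>

definition fwd_gain :: "(nat \<Rightarrow> complex) \<Rightarrow> (nat \<Rightarrow> complex) \<Rightarrow> nat \<Rightarrow> complex" where
  "fwd_gain g \<beta> i = g (i + 1) * \<beta> (i + 1)"

definition noise_var :: "real \<Rightarrow> real \<Rightarrow> complex \<Rightarrow> real" where
  "noise_var sw sv \<gamma> = sv + sqmod \<gamma> * sw"

lemma noise_var_pos: "sw > 0 \<Longrightarrow> sv > 0 \<Longrightarrow> noise_var sw sv \<gamma> > 0"
  unfolding noise_var_def by (intro add_pos_nonneg) auto

definition direct_residual where
  "direct_residual g x y k i = y (k, i, 1) - g (1::nat) * x (k, i, 1 :: nat) "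

definition relay_residual where
  "relay_residual g h \<beta> x y k i = y (k, i, 2) - g (1::nat) * x (k, i, 2) - fwd_gain g \<beta> i * h (i + 1) * x (k, i, 1 :: nat)"

text \<open>Each relay noise sample enters exactly one factor, the second slot of its own frame, so
  the average over the relay noise splits into one convolution per frame.\<close>

lemma likelihood_eq:
  assumes sw: "sw > 0" and sv: "sv > 0"
  shows "likelihood N L sw sv g h \<beta> x y = (\<Prod>(k, i)\<in>frames N L. cnormal_density sv (direct_residual g x y k i) *
       cnormal_density (noise_var sw sv (fwd_gain g \<beta> i)) (relay_residual g h \<beta> x y k i))"
proof -
  interpret product_sigma_finite "\<lambda>_. cnormal sw" by (rule product_sigma_finite_cnormal[OF sw])
  define A where "A q = cnormal_density sv (direct_residual g x y (fst q) (snd q))" for q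
  define B where "B q = relay_residual g h \<beta> x y (fst q) (snd q)" for q
  define \<gamma> where "\<gamma> q = fwd_gain g \<beta> (snd q)" for q :: "nat \<times> nat"
  define F where "F w = (\<Prod>q\<in>frames N L. A q * cnormal_density sv (B q - \<gamma> q * w q))" for w
  have A: "A q \<ge> 0" for q using sv by (simp add: A_def)
  have F0: "F w \<ge> 0" for w unfolding F_def using sv A by (intro prod_nonneg) auto
  have comp[measurable]: "(\<lambda>w. w q) \<in> borel_measurable (relay_noise N L sw)" if "q \<in> frames N L" for q
    unfolding relay_noise_def using that by (rule measurable_component_cnormal)
  have Fm[measurable]: "F \<in> borel_measurable (relay_noise N L sw)" unfolding F_def by measurable
  have eq: "(\<Prod>p\<in>slots N L. cnormal_density sv (y p - received g h \<beta> x w (\<lambda>_. 0) p)) = F w" for w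
    unfolding slots_eq_frame_slots prod_frame_slots[OF finite_frames] F_def
    by (intro prod.cong)
      (auto simp: A_def B_def \<gamma>_def direct_residual_def relay_residual_def fwd_gain_def algebra_simps)
  have "(\<integral>\<^sup>+w. ennreal (F w) \<partial>relay_noise N L sw) =
     (\<integral>\<^sup>+w. (\<Prod>q\<in>frames N L. ennreal (A q * cnormal_density sv (B q - \<gamma> q * w q))) \<partial>relay_noise N L sw)"
    unfolding F_def using A sv by (subst prod_ennreal) auto
  also have "\<dots> = (\<Prod>q\<in>frames N L. \<integral>\<^sup>+z. ennreal (A q * cnormal_density sv (B q - \<gamma> q * z)) \<partial>cnormal sw)"
    unfolding relay_noise_def
  proof (rule product_nn_integral_prod)
    fix q :: "nat \<times> nat"
    have "(\<lambda>z. ennreal (A q * cnormal_density sv (B q - \<gamma> q * z))) \<in> borel_measurable borel" by measurable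
    then show "(\<lambda>z. ennreal (A q * cnormal_density sv (B q - \<gamma> q * z))) \<in> borel_measurable (cnormal sw)" by simp
  qed simp
  also have "\<dots> = (\<Prod>q\<in>frames N L. ennreal (A q * cnormal_density (noise_var sw sv (\<gamma> q)) (B q)))"
  proof (rule prod.cong[OF refl])
    fix q
    show "(\<integral>\<^sup>+z. ennreal (A q * cnormal_density sv (B q - \<gamma> q * z)) \<partial>cnormal sw) =
      ennreal (A q * cnormal_density (noise_var sw sv (\<gamma> q)) (B q))"
      using A[of q] sv sw
      by (simp add: ennreal_mult' nn_integral_cmult cnormal_density_convolution noise_var_def)
  qed
  also have "\<dots> = ennreal (\<Prod>q\<in>frames N L. A q * cnormal_density (noise_var sw sv (\<gamma> q)) (B q))"
    using A noise_var_pos[OF sw sv] by (intro prod_ennreal) auto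
  finally have "(\<integral>\<^sup>+w. ennreal (F w) \<partial>relay_noise N L sw) = \<dots>" .
  moreover have "(\<Prod>q\<in>frames N L. A q * cnormal_density (noise_var sw sv (\<gamma> q)) (B q)) \<ge> 0"
    using A noise_var_pos[OF sw sv] by (intro prod_nonneg) auto
  ultimately have "(\<integral>w. F w \<partial>relay_noise N L sw) = (\<Prod>q\<in>frames N L. A q * cnormal_density (noise_var sw sv (\<gamma> q)) (B q))"
    using F0 by (subst integral_eq_nn_integral) auto
  then show ?thesis unfolding likelihood_def eq by (simp add: A_def B_def \<gamma>_def case_prod_unfold)
qed

lemma likelihood_pos:
  assumes "sw > 0" "sv > 0"
  shows "0 < likelihood N L sw sv g h \<beta> x y"
  unfolding likelihood_eq[OF assms] using assms noise_var_pos[OF assms]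
  by (intro prod_pos) (auto intro!: mult_pos_pos cnormal_density_pos)

text \<open>A point of the product space is \<open>undefined\<close> off the slots while
  \<open>received\<close> is not; the likelihood, and with it the decoder, cannot tell them
  apart.\<close>

lemma likelihood_cong_slots:
  assumes "sw > 0" "sv > 0" "\<And>p. p \<in> slots N L \<Longrightarrow> y p = y' p"
  shows "likelihood N L sw sv g h \<beta> x y = likelihood N L sw sv g h \<beta> x y'"
  unfolding likelihood_def using assms(3) by (intro Bochner_Integration.integral_cong prod.cong) auto

lemma frames_slotsD:
  assumes "(k, i) \<in> frames N L"
  shows "(k, i, 1) \<in> slots N L" "(k, i, 2) \<in> slots N L" "(k, i, Suc 0) \<in> slots N L"
     "1 \<in> {1..N}" "i + 1 \<in> {1..N}" "i + 1 \<in> {2..N}"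
  using assms by (auto simp: frames_def slots_def)

lemma borel_measurable_likelihood:
  assumes sw: "sw > 0" and sv: "sv > 0"
    and G: "\<And>i. i \<in> {1..N} \<Longrightarrow> (\<lambda>\<omega>. G \<omega> i) \<in> borel_measurable K"
    and H: "\<And>i. i \<in> {2..N} \<Longrightarrow> (\<lambda>\<omega>. H \<omega> i) \<in> borel_measurable K"
    and B: "\<And>i. i \<in> {2..N} \<Longrightarrow> (\<lambda>\<omega>. \<beta> \<omega> i) \<in> borel_measurable K"
    and X: "\<And>p. p \<in> slots N L \<Longrightarrow> (\<lambda>\<omega>. X \<omega> p) \<in> borel_measurable K"
    and Y: "\<And>p. p \<in> slots N L \<Longrightarrow> (\<lambda>\<omega>. Y \<omega> p) \<in> borel_measurable K"
  shows "(\<lambda>\<omega>. likelihood N L sw sv (G \<omega>) (H \<omega>) (\<beta> \<omega>) (X \<omega>) (Y \<omega>)) \<in> borel_measurable K"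
proof -
  have "(\<lambda>\<omega>. cnormal_density sv (direct_residual (G \<omega>) (X \<omega>) (Y \<omega>) k i) *
      cnormal_density (noise_var sw sv (fwd_gain (G \<omega>) (\<beta> \<omega>) i)) (relay_residual (G \<omega>) (H \<omega>) (\<beta> \<omega>) (X \<omega>) (Y \<omega>) k i))
      \<in> borel_measurable K" if q: "(k, i) \<in> frames N L" for k i
  proof -
    note q' = frames_slotsD[OF q]
    note [measurable] = G[OF q'(4)] G[OF q'(5)] H[OF q'(6)] B[OF q'(6)]
      X[OF q'(1)] X[OF q'(2)] Y[OF q'(1)] Y[OF q'(2)]
    show ?thesis unfolding cnormal_density_def noise_var_def fwd_gain_def direct_residual_def relay_residual_def
      by measurable
  qed
  then show ?thesis unfolding likelihood_eq[OF sw sv] by (intro borel_measurable_prod) (auto split: prod.splits)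
qed

text \<open>Among finitely many messages a maximiser exists, so the \<open>LEAST\<close> is
  attained, and the event becomes a finite Boolean combination of likelihood comparisons, from which
  measurability is read off. The second conjunct is the tie-break.\<close>

lemma ml_decode_eq_iff:
  assumes "m < M"
  shows "ml_decode N L M sw sv g h \<beta> X y = m \<longleftrightarrow>
    (\<forall>m'<M. likelihood N L sw sv g h \<beta> (X m') y \<le> likelihood N L sw sv g h \<beta> (X m) y) \<and>
    (\<forall>m'<m. \<exists>m''<M. likelihood N L sw sv g h \<beta> (X m') y < likelihood N L sw sv g h \<beta> (X m'') y)"
proof -
  define l where "l m = likelihood N L sw sv g h \<beta> (X m) y" for m
  define P where "P m \<longleftrightarrow> m < M \<and> (\<forall>m'<M. l m' \<le> l m)" for m
  have dec: "ml_decode N L M sw sv g h \<beta> X y = (LEAST m. P m)" unfolding ml_decode_def P_def l_def ..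
  have "Max (l ` {..<M}) \<in> l ` {..<M}" using assms by (intro Max_in) auto
  then obtain m0 where "m0 < M" "l m0 = Max (l ` {..<M})" by auto
  then have "P m0" by (auto simp: P_def)
  then have "P (LEAST m. P m)" by (rule LeastI)
  then have "(LEAST m. P m) = m \<longleftrightarrow> P m \<and> (\<forall>m'<m. \<not> P m')" by (metis Least_equality not_less_Least linorder_not_less)
  also have "\<dots> \<longleftrightarrow> (\<forall>m'<M. l m' \<le> l m) \<and> (\<forall>m'<m. \<exists>m''<M. l m' < l m'')"
    using assms unfolding P_def by (meson linorder_not_less order_less_trans)
  finally show ?thesis unfolding dec l_def .
qed

text \<open>Every tie is counted against the decoder here; the union bound can afford this.\<close>

lemma ml_decode_neqD:
  assumes "m < M" "ml_decode N L M sw sv g h \<beta> X y \<noteq> m"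
  shows "\<exists>m'\<in>{..<M} - {m}. likelihood N L sw sv g h \<beta> (X m) y \<le> likelihood N L sw sv g h \<beta> (X m') y"
proof (rule ccontr)
  assume *: "\<not> ?thesis"
  have "ml_decode N L M sw sv g h \<beta> X y = m" unfolding ml_decode_eq_iff[OF assms(1)]
  proof (intro conjI allI impI)
    fix m' assume "m' < M"
    then show "likelihood N L sw sv g h \<beta> (X m') y \<le> likelihood N L sw sv g h \<beta> (X m) y"
      using * by (cases "m' = m") (auto simp: not_le intro: less_imp_le)
  next
    fix m' assume "m' < m"
    then show "\<exists>m''<M. likelihood N L sw sv g h \<beta> (X m') y < likelihood N L sw sv g h \<beta> (X m'') y"
      using * assms(1) by (intro exI[of _ m]) (auto simp: not_le)
  qed
  then show False using assms(2) by simp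
qed

lemma ml_decode_cong_slots:
  assumes "sw > 0" "sv > 0" "\<And>p. p \<in> slots N L \<Longrightarrow> y p = y' p"
  shows "ml_decode N L M sw sv g h \<beta> X y = ml_decode N L M sw sv g h \<beta> X y'"
  unfolding ml_decode_def using likelihood_cong_slots[OF assms] by simp

lemma pred_ml_decode:
  assumes m: "m < M"
    and "\<And>m'. m' < M \<Longrightarrow> (\<lambda>\<omega>. likelihood N L sw sv (G \<omega>) (H \<omega>) (\<beta> \<omega>) (X \<omega> m') (Y \<omega>)) \<in> borel_measurable K"
  shows "Measurable.pred K (\<lambda>\<omega>. ml_decode N L M sw sv (G \<omega>) (H \<omega>) (\<beta> \<omega>) (X \<omega>) (Y \<omega>) = m)"
proof -
  define l where "l m' \<omega> = likelihood N L sw sv (G \<omega>) (H \<omega>) (\<beta> \<omega>) (X \<omega> m') (Y \<omega>)" for m' \<omega>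
  have less: "Measurable.pred K (\<lambda>\<omega>. l m1 \<omega> < l m2 \<omega>)" if "m1 < M" "m2 < M" for m1 m2
    unfolding l_def by (rule borel_measurable_pred_less[OF assms(2)[OF that(1)] assms(2)[OF that(2)]])
  have "Measurable.pred K (\<lambda>\<omega>. (\<forall>m'\<in>{..<M}. \<not> l m \<omega> < l m' \<omega>) \<and> (\<forall>m'\<in>{..<m}. \<exists>m''\<in>{..<M}. l m' \<omega> < l m'' \<omega>))"
    using m by (intro pred_intros_logic pred_intros_finite less) auto
  moreover have "ml_decode N L M sw sv (G \<omega>) (H \<omega>) (\<beta> \<omega>) (X \<omega>) (Y \<omega>) = m \<longleftrightarrow>
      (\<forall>m'\<in>{..<M}. \<not> l m \<omega> < l m' \<omega>) \<and> (\<forall>m'\<in>{..<m}. \<exists>m''\<in>{..<M}. l m' \<omega> < l m'' \<omega>)" for \<omega>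
    unfolding ml_decode_eq_iff[OF m] l_def[symmetric] Ball_def Bex_def lessThan_iff not_less ..
  ultimately show ?thesis by simp
qed

section \<open>Error events\<close>

lemma emeasure_pair_pred:
  assumes B: "sigma_finite_measure B" and P: "Measurable.pred (A \<Otimes>\<^sub>M B) P"
  shows "emeasure (A \<Otimes>\<^sub>M B) {x \<in> space (A \<Otimes>\<^sub>M B). P x} = (\<integral>\<^sup>+a. emeasure B {y \<in> space B. P (a, y)} \<partial>A)"
    and "(\<lambda>a. emeasure B {y \<in> space B. P (a, y)}) \<in> borel_measurable A"
proof -
  interpret sigma_finite_measure B by fact
  let ?e = "\<lambda>a. emeasure B {y \<in> space B. P (a, y)}"
  define Q where "Q = {x \<in> space (A \<Otimes>\<^sub>M B). P x}"
  have Q: "Q \<in> sets (A \<Otimes>\<^sub>M B)" using P unfolding Q_def by measurable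
  have *: "Pair a -` Q = {y \<in> space B. P (a, y)}" if "a \<in> space A" for a
    using that by (auto simp: Q_def space_pair_measure)
  have "emeasure (A \<Otimes>\<^sub>M B) Q = (\<integral>\<^sup>+a. emeasure B (Pair a -` Q) \<partial>A)" by (rule emeasure_pair_measure_alt[OF Q])
  also have "\<dots> = (\<integral>\<^sup>+a. ?e a \<partial>A)" by (intro nn_integral_cong) (simp add: *)
  finally show "emeasure (A \<Otimes>\<^sub>M B) {x \<in> space (A \<Otimes>\<^sub>M B). P x} = (\<integral>\<^sup>+a. ?e a \<partial>A)" unfolding Q_def .
  have "(\<lambda>a. emeasure B (Pair a -` Q)) \<in> borel_measurable A" by (rule measurable_emeasure_Pair[OF Q])
  then show "(\<lambda>a. ?e a) \<in> borel_measurable A" by (subst (asm) measurable_cong[of A _ "\<lambda>a. ?e a"]) (simp_all add: *)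
qed

lemma prob_space_fading: "prob_space (fading N)"
  unfolding fading_def
  by (intro prob_space_pair prob_space_PiM_cnormal) auto

lemma prob_space_codebook: "E > 0 \<Longrightarrow> prob_space (codebook N L M E)"
  unfolding codebook_def by (intro prob_space_PiM prob_space_PiM_cnormal)

lemma prob_space_relay_noise: "sw > 0 \<Longrightarrow> prob_space (relay_noise N L sw)"
  unfolding relay_noise_def by (intro prob_space_PiM_cnormal)

lemma prob_space_dest_noise: "sv > 0 \<Longrightarrow> prob_space (dest_noise N L sv)"
  unfolding dest_noise_def by (intro prob_space_PiM_cnormal)

lemma measurable_codebook_component:
  assumes "m < M" "p \<in> slots N L"
  shows "(\<lambda>X. X m p) \<in> borel_measurable (codebook N L M E)"
proof -
  have "(\<lambda>X. X m) \<in> codebook N L M E \<rightarrow>\<^sub>M (\<Pi>\<^sub>M p\<in>slots N L. cnormal E)"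
    unfolding codebook_def using assms(1) by (intro measurable_component_singleton) auto
  from measurable_compose[OF this measurable_component_cnormal[OF assms(2)]] show ?thesis .
qed

lemma borel_measurable_received:
  assumes p: "p \<in> slots N L"
    and G: "\<And>i. i \<in> {1..N} \<Longrightarrow> (\<lambda>\<omega>. G \<omega> i) \<in> borel_measurable K"
    and H: "\<And>i. i \<in> {2..N} \<Longrightarrow> (\<lambda>\<omega>. H \<omega> i) \<in> borel_measurable K"
    and B: "\<And>i. i \<in> {2..N} \<Longrightarrow> (\<lambda>\<omega>. \<beta> \<omega> i) \<in> borel_measurable K"
    and X: "\<And>p. p \<in> slots N L \<Longrightarrow> (\<lambda>\<omega>. X \<omega> p) \<in> borel_measurable K"
    and W: "\<And>q. q \<in> frames N L \<Longrightarrow> (\<lambda>\<omega>. W \<omega> q) \<in> borel_measurable K"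
    and V: "\<And>p. p \<in> slots N L \<Longrightarrow> (\<lambda>\<omega>. V \<omega> p) \<in> borel_measurable K"
  shows "(\<lambda>\<omega>. received (G \<omega>) (H \<omega>) (\<beta> \<omega>) (X \<omega>) (W \<omega>) (V \<omega>) p) \<in> borel_measurable K"
proof -
  obtain k i j where pe: "p = (k, i, j)" by (cases p)
  have q: "(k, i) \<in> frames N L" and j: "j \<in> {1, 2}" using p pe by (auto simp: frames_def slots_def)
  note q' = frames_slotsD[OF q]
  note [measurable] = G[OF q'(4)] G[OF q'(5)] H[OF q'(6)] B[OF q'(6)] X[OF q'(1)] X[OF q'(2)]
    V[OF q'(1)] V[OF q'(2)] W[OF q]
  show ?thesis using j unfolding pe by (cases "j = 1") (simp_all only: received.simps if_True if_False, measurable)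
qed

lemma pred_ml_decode_received:
  assumes sw: "sw > 0" and sv: "sv > 0" and m: "m < M"
    and G: "\<And>i. i \<in> {1..N} \<Longrightarrow> (\<lambda>\<omega>. G \<omega> i) \<in> borel_measurable K"
    and H: "\<And>i. i \<in> {2..N} \<Longrightarrow> (\<lambda>\<omega>. H \<omega> i) \<in> borel_measurable K"
    and B: "\<And>i. i \<in> {2..N} \<Longrightarrow> (\<lambda>\<omega>. \<beta> \<omega> i) \<in> borel_measurable K"
    and X: "\<And>m p. m < M \<Longrightarrow> p \<in> slots N L \<Longrightarrow> (\<lambda>\<omega>. X \<omega> m p) \<in> borel_measurable K"
    and W: "\<And>q. q \<in> frames N L \<Longrightarrow> (\<lambda>\<omega>. W \<omega> q) \<in> borel_measurable K"
    and V: "\<And>p. p \<in> slots N L \<Longrightarrow> (\<lambda>\<omega>. V \<omega> p) \<in> borel_measurable K"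
  shows "Measurable.pred K (\<lambda>\<omega>. ml_decode N L M sw sv (G \<omega>) (H \<omega>) (\<beta> \<omega>) (X \<omega>)
    (received (G \<omega>) (H \<omega>) (\<beta> \<omega>) (X \<omega> m) (W \<omega>) (V \<omega>)) = m)"
  by (intro pred_ml_decode[OF m] borel_measurable_likelihood[OF sw sv] borel_measurable_received G H B X W V m)

abbreviation codeword_measure :: "nat \<Rightarrow> nat \<Rightarrow> real \<Rightarrow> (nat \<times> nat \<times> nat \<Rightarrow> complex) measure" where
  "codeword_measure N L E \<equiv> \<Pi>\<^sub>M p\<in>slots N L. cnormal E"

text \<open>All randomness except the fading. The pairs are nested as in
  \<open>naf_error_prob\<close>, so the full space is the product of \<open>fading N\<close> with
  this one, and the gains can be fixed by a single application of Fubini.\<close>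

definition transmission where
  "transmission N L M E sw sv = codebook N L M E \<Otimes>\<^sub>M relay_noise N L sw \<Otimes>\<^sub>M dest_noise N L sv"

lemma prob_space_transmission:
  "E > 0 \<Longrightarrow> sw > 0 \<Longrightarrow> sv > 0 \<Longrightarrow> prob_space (transmission N L M E sw sv)"
  unfolding transmission_def
  by (intro prob_space_pair prob_space_codebook prob_space_relay_noise prob_space_dest_noise)

lemma transmission_components:
  shows "m < M \<Longrightarrow> p \<in> slots N L \<Longrightarrow> (\<lambda>\<omega>. fst \<omega> m p) \<in> borel_measurable (transmission N L M E sw sv)"
    and "q \<in> frames N L \<Longrightarrow> (\<lambda>\<omega>. fst (snd \<omega>) q) \<in> borel_measurable (transmission N L M E sw sv)"
    and "p \<in> slots N L \<Longrightarrow> (\<lambda>\<omega>. snd (snd \<omega>) p) \<in> borel_measurable (transmission N L M E sw sv)"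
  unfolding transmission_def
  by (auto intro!: measurable_compose[OF measurable_fst measurable_codebook_component]
      measurable_compose[OF measurable_compose[OF measurable_snd measurable_fst]]
      measurable_compose[OF measurable_compose[OF measurable_snd measurable_snd]]
      measurable_component_cnormal simp: relay_noise_def dest_noise_def)

lemma fading_components:
  shows "i \<in> {1..N} \<Longrightarrow> (\<lambda>\<omega>. fst \<omega> i) \<in> borel_measurable (fading N)"
    and "i \<in> {2..N} \<Longrightarrow> (\<lambda>\<omega>. snd \<omega> i) \<in> borel_measurable (fading N)"
  unfolding fading_def
  by (auto intro!: measurable_compose[OF measurable_fst] measurable_compose[OF measurable_snd]
      measurable_component_cnormal)

definition correct_event where
  "correct_event N L M sw sv g h \<beta> m = (\<lambda>(X, w, v). ml_decode N L M sw sv g h \<beta> X (received g h \<beta> (X m) w v) = m)"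

lemma pred_correct_event:
  assumes "sw > 0" "sv > 0" "m < M"
  shows "Measurable.pred (transmission N L M E sw sv) (correct_event N L M sw sv g h \<beta> m)"
  unfolding correct_event_def case_prod_unfold
  by (rule pred_ml_decode_received[OF assms]) (auto intro!: transmission_components)

definition cond_error where
  "cond_error N L M E sw sv g h \<beta> m = emeasure (transmission N L M E sw sv)
      {\<omega> \<in> space (transmission N L M E sw sv). \<not> correct_event N L M sw sv g h \<beta> m \<omega>}"

definition cond_correct where
  "cond_correct N L M E sw sv g h \<beta> m = emeasure (transmission N L M E sw sv)
      {\<omega> \<in> space (transmission N L M E sw sv). correct_event N L M sw sv g h \<beta> m \<omega>}"

lemma cond_error_le_1:
  assumes "E > 0" "sw > 0" "sv > 0"
  shows "cond_error N L M E sw sv g h \<beta> m \<le> 1"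
proof -
  interpret prob_space "transmission N L M E sw sv" by (rule prob_space_transmission[OF assms])
  show ?thesis unfolding cond_error_def by (rule emeasure_le_1)
qed

lemma cond_error_add_cond_correct:
  assumes "E > 0" "sw > 0" "sv > 0" "m < M"
  shows "cond_error N L M E sw sv g h \<beta> m + cond_correct N L M E sw sv g h \<beta> m = 1"
proof -
  interpret prob_space "transmission N L M E sw sv" by (rule prob_space_transmission[OF assms(1-3)])
  note [measurable] = pred_correct_event[OF assms(2-4), where N = N and L = L and E = E and g = g and h = h and \<beta> = \<beta>]
  show ?thesis unfolding cond_error_def cond_correct_def
    by (subst plus_emeasure) (auto simp: emeasure_space_1[symmetric] intro!: arg_cong[where f = "emeasure _"])
qed

text \<open>Fubini with the gains outermost. The factor \<open>real M\<close> clears the division,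
  so that the sum over messages can be handled in \<open>ennreal\<close>, where no question of
  integrability arises.\<close>

lemma naf_error_prob_eq:
  assumes E: "E > 0" and sw: "sw > 0" and sv: "sv > 0" and M: "M > 0"
    and b: "\<And>i. i \<in> {2..N} \<Longrightarrow> b i \<in> borel_measurable borel"
  shows "ennreal (real M * naf_error_prob N L M E sw sv b) =
      (\<Sum>m<M. \<integral>\<^sup>+(g, h). cond_error N L M E sw sv g h (\<lambda>i. b i (h i)) m \<partial>fading N)"
    and "m < M \<Longrightarrow> (\<lambda>(g, h). cond_error N L M E sw sv g h (\<lambda>i. b i (h i)) m) \<in> borel_measurable (fading N)"
proof -
  define T where "T = transmission N L M E sw sv"
  interpret T: prob_space T unfolding T_def by (rule prob_space_transmission[OF E sw sv])
  interpret F: prob_space "fading N" by (rule prob_space_fading)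
  interpret FT: prob_space "fading N \<Otimes>\<^sub>M T" by (intro prob_space_pair) unfold_locales
  let ?err = "\<lambda>m g h. cond_error N L M E sw sv g h (\<lambda>i. b i (h i)) m"
  define P where "P m = (\<lambda>((g, h), \<omega>). \<not> correct_event N L M sw sv g h (\<lambda>i. b i (h i)) m \<omega>)" for m
  have P: "Measurable.pred (fading N \<Otimes>\<^sub>M T) (P m)" if "m < M" for m
    unfolding P_def correct_event_def case_prod_unfold T_def
    by (intro pred_intros_logic(2) pred_ml_decode_received[OF sw sv that])
      (auto intro!: transmission_components fading_components measurable_compose[OF _ b]
        measurable_compose[OF measurable_fst fading_components(1)]
        measurable_compose[OF measurable_fst fading_components(2)]
        measurable_compose[OF measurable_snd transmission_components(1)]
        measurable_compose[OF measurable_snd transmission_components(2)]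
        measurable_compose[OF measurable_snd transmission_components(3)])
  have ce: "emeasure T {\<omega> \<in> space T. P m (gh, \<omega>)} = (case gh of (g, h) \<Rightarrow> ?err m g h)" for gh m
    by (simp add: P_def cond_error_def T_def split: prod.splits)
  show "m < M \<Longrightarrow> (\<lambda>(g, h). ?err m g h) \<in> borel_measurable (fading N)"
    using emeasure_pair_pred(2)[OF T.sigma_finite_measure_axioms P] unfolding ce .
  have eq: "ennreal (\<P>(\<omega> in fading N \<Otimes>\<^sub>M T. P m \<omega>)) = (\<integral>\<^sup>+(g, h). ?err m g h \<partial>fading N)" if "m < M" for m
    unfolding FT.emeasure_eq_measure[symmetric] emeasure_pair_pred(1)[OF T.sigma_finite_measure_axioms P[OF that]] ce ..
  have "real M * naf_error_prob N L M E sw sv b = (\<Sum>m<M. \<P>(\<omega> in fading N \<Otimes>\<^sub>M T. P m \<omega>))"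
    using M unfolding naf_error_prob_def T_def transmission_def P_def correct_event_def Let_def
    by (simp add: case_prod_unfold)
  then have "ennreal (real M * naf_error_prob N L M E sw sv b) = (\<Sum>m<M. ennreal (\<P>(\<omega> in fading N \<Otimes>\<^sub>M T. P m \<omega>)))"
    by (simp add: sum_ennreal)
  then show "ennreal (real M * naf_error_prob N L M E sw sv b) = (\<Sum>m<M. \<integral>\<^sup>+(g, h). ?err m g h \<partial>fading N)"
    by (simp add: eq)
qed

section \<open>The Chernoff factor of one frame\<close>

lemma cnormal_mgf:
  "s > 0 \<Longrightarrow> (\<integral>\<^sup>+x. ennreal (exp (2 * Re (cnj \<beta> * x))) \<partial>cnormal s) = ennreal (exp (s * sqmod \<beta>))"
  using cnormal_exp_quadratic[of s 0 \<beta>] by simp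

text \<open>The integrand is the square root of a likelihood ratio; \<open>e1\<close>, \<open>e2\<close> are the differences of two signals.\<close>

lemma frame_chernoff:
  fixes \<gamma> :: complex
  assumes sw: "sw > 0" and sv: "sv > 0"
  defines "s2 \<equiv> noise_var sw sv \<gamma>"
  shows "(\<integral>\<^sup>+w. \<integral>\<^sup>+v1. \<integral>\<^sup>+v2. ennreal (exp (- (sqmod (v1 + e1) - sqmod v1) / (2 * sv)
      - (sqmod (v2 + \<gamma> * w + e2) - sqmod (v2 + \<gamma> * w)) / (2 * s2))) \<partial>cnormal sv \<partial>cnormal sv \<partial>cnormal sw)
    = ennreal (exp (- (1 / (4 * sv)) * sqmod e1 - (1 / (4 * s2)) * sqmod e2))"
proof -
  have s2: "s2 > 0" unfolding s2_def by (rule noise_var_pos[OF sw sv])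
  define b1 where "b1 = - e1 / of_real (2 * sv)"
  define b2 where "b2 = - e2 / of_real (2 * s2)"
  define K where "K = exp (- sqmod e1 / (2 * sv) - sqmod e2 / (2 * s2))"
  have sq: "sqmod (u + e) - sqmod u = sqmod e + 2 * Re (cnj e * u)" for u e
    by (simp only: cmod_power2) (simp add: power2_eq_square algebra_simps)
  have split: "exp (- (sqmod (v1 + e1) - sqmod v1) / (2 * sv) - (sqmod (v2 + \<gamma> * w + e2) - sqmod (v2 + \<gamma> * w)) / (2 * s2))
    = K * exp (2 * Re (cnj (cnj \<gamma> * b2) * w)) * exp (2 * Re (cnj b1 * v1)) * exp (2 * Re (cnj b2 * v2))" for v1 v2 w
  proof -
    have 1: "2 * Re (cnj b1 * v1) = - (2 * Re (cnj e1 * v1)) / (2 * sv)" using sv by (simp add: b1_def field_simps)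
    have 2: "2 * Re (cnj b2 * v2) + 2 * Re (cnj (cnj \<gamma> * b2) * w) = - (2 * Re (cnj e2 * (v2 + \<gamma> * w))) / (2 * s2)"
      using s2 by (simp add: b2_def field_simps)
    show ?thesis unfolding sq K_def exp_add[symmetric]
      using 1 2 by (simp add: add_divide_distrib diff_divide_distrib del: times_complex.sel complex_cnj_mult)
  qed
  have "(\<integral>\<^sup>+w. \<integral>\<^sup>+v1. \<integral>\<^sup>+v2. ennreal (exp (- (sqmod (v1 + e1) - sqmod v1) / (2 * sv)
      - (sqmod (v2 + \<gamma> * w + e2) - sqmod (v2 + \<gamma> * w)) / (2 * s2))) \<partial>cnormal sv \<partial>cnormal sv \<partial>cnormal sw)
    = ennreal K * ennreal (exp (sw * sqmod (cnj \<gamma> * b2))) * ennreal (exp (sv * sqmod b1)) * ennreal (exp (sv * sqmod b2))"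
    unfolding split
    by (simp add: ennreal_mult K_def nn_integral_cmult nn_integral_multc cnormal_mgf sw sv
        del: times_complex.sel complex_cnj_mult)
  also have "\<dots> = ennreal (K * exp (sw * sqmod (cnj \<gamma> * b2) + sv * sqmod b1 + sv * sqmod b2))"
    by (simp add: ennreal_mult[symmetric] K_def exp_add[symmetric] add.assoc)
  also have "K * exp (sw * sqmod (cnj \<gamma> * b2) + sv * sqmod b1 + sv * sqmod b2)
     = exp (- (1 / (4 * sv)) * sqmod e1 - (1 / (4 * s2)) * sqmod e2)"
  proof -
    have 1: "sv * sqmod b1 = sqmod e1 / (4 * sv)"
      using sv by (simp add: b1_def norm_divide norm_mult power_divide power_mult_distrib power2_eq_square)
    have n: "sqmod b2 = sqmod e2 / (4 * s2\<^sup>2)"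
      using s2 by (simp add: b2_def norm_divide norm_mult power_divide power_mult_distrib)
    \<comment> \<open>The shares of relay noise and destination noise in the second slot add up to
      \<open>s2\<close>. The moment generating function gives back half of the exponent in
      \<open>K\<close>, hence the \<open>4\<close> in place of the \<open>2\<close>.\<close>
    have "sw * sqmod (cnj \<gamma> * b2) + sv * sqmod b2 = s2 * sqmod b2"
      by (simp add: s2_def noise_var_def norm_mult power_mult_distrib algebra_simps)
    also have "\<dots> = sqmod e2 / (4 * s2)" unfolding n using s2 by (simp add: power2_eq_square)
    finally have 2: "sw * sqmod (cnj \<gamma> * b2) + sv * sqmod b2 = sqmod e2 / (4 * s2)" .
    have "- sqmod e1 / (2 * sv) - sqmod e2 / (2 * s2) + (sw * sqmod (cnj \<gamma> * b2) + sv * sqmod b1 + sv * sqmod b2)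
      = - sqmod e1 / (2 * sv) + sqmod e1 / (4 * sv) - sqmod e2 / (2 * s2) + sqmod e2 / (4 * s2)"
      using 1 2 by linarith
    also have "\<dots> = - (1 / (4 * sv)) * sqmod e1 - (1 / (4 * s2)) * sqmod e2" using sv s2 by (simp add: field_simps)
    finally show ?thesis unfolding K_def exp_add[symmetric] by simp
  qed
  finally show ?thesis .
qed

section \<open>Pairwise error bound\<close>

text \<open>The precisions are a quarter of the inverse noise variances: this is what the noise
  average of the square root of the likelihood ratio leaves. Averaging over an independent Gaussian
  competitor then yields inverse determinants.\<close>

definition pairwise_bound where
  "pairwise_bound N L E sw sv g h \<beta> =
    (\<Prod>(k, i)\<in>frames N L. 1 / frame_det E (1 / (4 * sv)) (1 / (4 * noise_var sw sv (fwd_gain g \<beta> i)))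
       (sqmod (g 1)) (sqmod (fwd_gain g \<beta> i * h (i + 1))))"

lemma cnormal_density_ratio:
  "cnormal_density s z' = cnormal_density s z * (exp (- (sqmod z' - sqmod z) / (2 * s)))\<^sup>2"
proof -
  have "(exp (- (sqmod z' - sqmod z) / (2 * s)))\<^sup>2 = exp (- (sqmod z' - sqmod z) / s)"
    unfolding exp_double[symmetric] by (simp add: diff_divide_distrib)
  moreover have "exp (- sqmod z / s) * exp (- (sqmod z' - sqmod z) / s) = exp (- sqmod z' / s)"
    unfolding exp_add[symmetric] by (simp add: diff_divide_distrib)
  ultimately show ?thesis by (simp add: cnormal_density_def)
qed

text \<open>Union bound over the competitors, with the indicator of a lost comparison replaced by
  the square root \<open>R\<close> of the likelihood ratio. The noise average of \<open>R\<close> is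
  \<open>\<phi>\<close>; the average over the competing codeword is then bounded uniformly in the
  sent one.\<close>

lemma cond_error_le:
  assumes E: "E > 0" and sw: "sw > 0" and sv: "sv > 0" and m: "m < M"
  shows "cond_error N L M E sw sv g h \<beta> m \<le> ennreal (real M * pairwise_bound N L E sw sv g h \<beta>)"
proof -
  define T where "T = transmission N L M E sw sv"
  interpret T: prob_space T unfolding T_def by (rule prob_space_transmission[OF E sw sv])
  interpret D: prob_space "dest_noise N L sv" by (rule prob_space_dest_noise[OF sv])
  interpret W: prob_space "relay_noise N L sw" by (rule prob_space_relay_noise[OF sw])
  interpret WD: prob_space "relay_noise N L sw \<Otimes>\<^sub>M dest_noise N L sv" by (intro prob_space_pair) unfold_locales
  interpret PW: product_sigma_finite "\<lambda>_. cnormal sw" by (rule product_sigma_finite_cnormal[OF sw])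
  let ?WD = "relay_noise N L sw \<Otimes>\<^sub>M dest_noise N L sv"
  let ?CW = "\<Pi>\<^sub>M p\<in>slots N L. cnormal E"
  let ?CB = "codebook N L M E"
  define \<gamma> where "\<gamma> i = fwd_gain g \<beta> i" for i
  define s2 where "s2 i = noise_var sw sv (\<gamma> i)" for i
  have s2: "s2 i > 0" for i unfolding s2_def by (rule noise_var_pos[OF sw sv])
  define e1 where "e1 q x x' = g 1 * x (fst q, snd q, 1) - g 1 * x' (fst q, snd q, 1)"
    for q :: "nat \<times> nat" and x x' :: "nat \<times> nat \<times> nat \<Rightarrow> complex"
  \<comment> \<open>Arranged as the sent signal minus the signal of the competitor, so that
    \<open>frame_integral\<close> applies with the sent signal in the role of the received
    pair.\<close>
  define e2 where "e2 q x x' = (g 1 * x (fst q, snd q, 2) + \<gamma> (snd q) * h (snd q + 1) * x (fst q, snd q, 1))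
      - g 1 * x' (fst q, snd q, 2) - \<gamma> (snd q) * h (snd q + 1) * x' (fst q, snd q, 1)"
    for q :: "nat \<times> nat" and x x' :: "nat \<times> nat \<times> nat \<Rightarrow> complex"
  define r where "r q x x' w v1 v2 = exp (- (sqmod (v1 + e1 q x x') - sqmod v1) / (2 * sv)
      - (sqmod (v2 + \<gamma> (snd q) * w + e2 q x x') - sqmod (v2 + \<gamma> (snd q) * w)) / (2 * s2 (snd q)))"
    for q x x' w v1 v2
  define R where "R x x' w v = (\<Prod>(k, i)\<in>frames N L. r (k, i) x x' (w (k, i)) (v (k, i, 1)) (v (k, i, 2)))"
    for x x' w and v :: "nat \<times> nat \<times> nat \<Rightarrow> complex"
  have R0: "R x x' w v \<ge> 0" for x x' w v unfolding R_def r_def by (intro prod_nonneg) auto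
  \<comment> \<open>The likelihoods of the two codewords differ by the factor \<open>R ^ 2\<close>
    and are positive, so a lost or tied comparison means \<open>R ^ 2 \<ge> 1\<close>.\<close>
  have chernoff: "1 \<le> R x x' w v"
    if "likelihood N L sw sv g h \<beta> x (received g h \<beta> x w v) \<le> likelihood N L sw sv g h \<beta> x' (received g h \<beta> x w v)"
    for x x' w v
  proof -
    define y where "y = received g h \<beta> x w v"
    define l where "l x = likelihood N L sw sv g h \<beta> x y" for x
    have "cnormal_density sv (direct_residual g x' y k i) * cnormal_density (s2 i) (relay_residual g h \<beta> x' y k i)
       = cnormal_density sv (direct_residual g x y k i) * cnormal_density (s2 i) (relay_residual g h \<beta> x y k i)
          * (r (k, i) x x' (w (k, i)) (v (k, i, 1)) (v (k, i, 2)))\<^sup>2" for k i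
    proof -
      have 1: "direct_residual g x' y k i = v (k, i, 1) + e1 (k, i) x x'" "direct_residual g x y k i = v (k, i, 1)"
        by (simp_all add: direct_residual_def y_def e1_def)
      have 2: "relay_residual g h \<beta> x' y k i = v (k, i, 2) + \<gamma> i * w (k, i) + e2 (k, i) x x'"
        "relay_residual g h \<beta> x y k i = v (k, i, 2) + \<gamma> i * w (k, i)"
        by (simp_all add: relay_residual_def y_def e2_def \<gamma>_def fwd_gain_def algebra_simps)
      have 3: "(r (k, i) x x' (w (k, i)) (v (k, i, 1)) (v (k, i, 2)))\<^sup>2 =
        (exp (- (sqmod (direct_residual g x' y k i) - sqmod (direct_residual g x y k i)) / (2 * sv)))\<^sup>2 *
        (exp (- (sqmod (relay_residual g h \<beta> x' y k i) - sqmod (relay_residual g h \<beta> x y k i)) / (2 * s2 i)))\<^sup>2"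
        unfolding r_def 1 2 power_mult_distrib[symmetric] exp_add[symmetric] by (simp add: diff_divide_distrib)
      show ?thesis unfolding 3 using cnormal_density_ratio[of sv "direct_residual g x' y k i" "direct_residual g x y k i"]
          cnormal_density_ratio[of "s2 i" "relay_residual g h \<beta> x' y k i" "relay_residual g h \<beta> x y k i"]
        by (simp only: mult_ac)
    qed
    then have "l x' = l x * (R x x' w v)\<^sup>2"
      unfolding l_def likelihood_eq[OF sw sv] R_def prod_power_distrib prod.distrib[symmetric] \<gamma>_def[symmetric] s2_def[symmetric]
      by (intro prod.cong) auto
    moreover have "l x > 0" unfolding l_def by (rule likelihood_pos[OF sw sv])
    moreover have "l x \<le> l x'" using that by (simp add: l_def y_def)
    ultimately have "1 \<le> (R x x' w v)\<^sup>2" by simp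
    then show ?thesis using R0[of x x' w v] by (simp add: power2_nonneg_ge_1_iff abs_le_square_iff[of 1, simplified])
  qed
  have Rm: "(\<lambda>\<omega>. R (fst \<omega> m) (fst \<omega> m') (fst (snd \<omega>)) (snd (snd \<omega>))) \<in> borel_measurable T" if "m' < M" for m'
  proof -
    have "(\<lambda>\<omega>. r (k, i) (fst \<omega> m) (fst \<omega> m') (fst (snd \<omega>) (k, i)) (snd (snd \<omega>) (k, i, 1)) (snd (snd \<omega>) (k, i, 2)))
      \<in> borel_measurable T" if q: "(k, i) \<in> frames N L" for k i
    proof -
      note q' = frames_slotsD[OF q]
      note [measurable] = transmission_components(1)[OF m q'(1), of E sw sv, folded T_def]
        transmission_components(1)[OF m q'(2), of E sw sv, folded T_def]
        transmission_components(1)[OF \<open>m' < M\<close> q'(1), of E sw sv, folded T_def]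
        transmission_components(1)[OF \<open>m' < M\<close> q'(2), of E sw sv, folded T_def]
        transmission_components(2)[OF q, of M E sw sv, folded T_def]
        transmission_components(3)[OF q'(1), of M E sw sv, folded T_def]
        transmission_components(3)[OF q'(2), of M E sw sv, folded T_def]
      show ?thesis unfolding r_def e1_def e2_def fst_conv snd_conv by measurable
    qed
    then show ?thesis unfolding R_def by (intro borel_measurable_prod) (auto split: prod.splits)
  qed
  define \<phi> where "\<phi> x x' = (\<Prod>(k, i)\<in>frames N L. ennreal (exp (- (1 / (4 * sv)) * sqmod (e1 (k, i) x x')
      - (1 / (4 * s2 i)) * sqmod (e2 (k, i) x x'))))" for x x'
  \<comment> \<open>For fixed relay noise the destination noise factorises over the frames, and the
    resulting product factorises over the relay noise samples.\<close>
  have noise: "(\<integral>\<^sup>+w. \<integral>\<^sup>+v. ennreal (R x x' w v) \<partial>dest_noise N L sv \<partial>relay_noise N L sw) = \<phi> x x'" for x x'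
  proof -
    have "(\<integral>\<^sup>+v. ennreal (R x x' w v) \<partial>dest_noise N L sv) =
      (\<Prod>q\<in>frames N L. \<integral>\<^sup>+v1. \<integral>\<^sup>+v2. ennreal (r q x x' (w q) v1 v2) \<partial>cnormal sv \<partial>cnormal sv)" for w
    proof -
      have "(\<integral>\<^sup>+v. ennreal (R x x' w v) \<partial>dest_noise N L sv) =
        (\<integral>\<^sup>+v. (\<Prod>(k, i)\<in>frames N L. ennreal (r (k, i) x x' (w (k, i)) (v (k, i, 1)) (v (k, i, 2)))) \<partial>dest_noise N L sv)"
        unfolding R_def by (intro nn_integral_cong, subst prod_ennreal[symmetric]) (auto simp: r_def case_prod_unfold)
      also have "\<dots> = (\<Prod>q\<in>frames N L. \<integral>\<^sup>+v1. \<integral>\<^sup>+v2. ennreal (r q x x' (w q) v1 v2) \<partial>cnormal sv \<partial>cnormal sv)"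
        unfolding dest_noise_def slots_eq_frame_slots
        by (rule nn_integral_frame_slots[where f = "\<lambda>q a b. ennreal (r q x x' (w q) a b)"])
           (auto simp: r_def sigma_finite_cnormal sv)
      finally show ?thesis .
    qed
    then have "(\<integral>\<^sup>+w. \<integral>\<^sup>+v. ennreal (R x x' w v) \<partial>dest_noise N L sv \<partial>relay_noise N L sw) =
      (\<integral>\<^sup>+w. (\<Prod>q\<in>frames N L. \<integral>\<^sup>+v1. \<integral>\<^sup>+v2. ennreal (r q x x' (w q) v1 v2) \<partial>cnormal sv \<partial>cnormal sv) \<partial>relay_noise N L sw)"
      by simp
    also have "\<dots> = (\<Prod>q\<in>frames N L. \<integral>\<^sup>+w. \<integral>\<^sup>+v1. \<integral>\<^sup>+v2. ennreal (r q x x' w v1 v2) \<partial>cnormal sv \<partial>cnormal sv \<partial>cnormal sw)"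
      unfolding relay_noise_def
    proof (rule PW.product_nn_integral_prod)
      fix q assume "q \<in> frames N L"
      interpret sigma_finite_measure "cnormal sv" by (rule sigma_finite_cnormal[OF sv])
      show "(\<lambda>w. \<integral>\<^sup>+v1. \<integral>\<^sup>+v2. ennreal (r q x x' w v1 v2) \<partial>cnormal sv \<partial>cnormal sv) \<in> borel_measurable (cnormal sw)"
        unfolding r_def by measurable
    qed simp
    also have "\<dots> = \<phi> x x'" unfolding \<phi>_def r_def s2_def frame_chernoff[OF sw sv] case_prod_unfold by simp
    finally show ?thesis .
  qed
  define C where "C = ennreal (pairwise_bound N L E sw sv g h \<beta>)"
  \<comment> \<open>Integrating the competitor frame by frame gives
    \<open>exp (- frame_form) / frame_det\<close>, and the form is nonnegative whatever codeword was
    sent.\<close>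
  have \<phi>C: "(\<integral>\<^sup>+x'. \<phi> x x' \<partial>?CW) \<le> C" for x
  proof -
    have "(\<integral>\<^sup>+x'. \<phi> x x' \<partial>?CW) = (\<Prod>q\<in>frames N L. \<integral>\<^sup>+x1. \<integral>\<^sup>+x2. ennreal (exp (
          - (1 / (4 * sv)) * sqmod (g 1 * x (fst q, snd q, 1) - g 1 * x1)
          - (1 / (4 * s2 (snd q))) * sqmod ((g 1 * x (fst q, snd q, 2) + \<gamma> (snd q) * h (snd q + 1) * x (fst q, snd q, 1))
              - g 1 * x2 - \<gamma> (snd q) * h (snd q + 1) * x1))) \<partial>cnormal E \<partial>cnormal E)"
      (is "_ = prod ?I _")
      unfolding \<phi>_def e1_def e2_def slots_eq_frame_slots
      by (subst nn_integral_frame_slots[where \<mu> = "cnormal E", symmetric]) (auto simp: sigma_finite_cnormal E)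
    also have "\<dots> \<le> (\<Prod>q\<in>frames N L. ennreal (1 / frame_det E (1 / (4 * sv)) (1 / (4 * s2 (snd q)))
       (sqmod (g 1)) (sqmod (\<gamma> (snd q) * h (snd q + 1)))))"
    proof (rule prod_mono_ennreal)
      fix q :: "nat \<times> nat"
      have p: "0 < 1 / (4 * sv)" "0 < 1 / (4 * s2 (snd q))" using sv s2 by auto
      show "?I q \<le> ennreal (1 / frame_det E (1 / (4 * sv)) (1 / (4 * s2 (snd q)))
       (sqmod (g 1)) (sqmod (\<gamma> (snd q) * h (snd q + 1))))"
        using frame_form_nonneg[OF E less_imp_le[OF p(1)] less_imp_le[OF p(2)]]
          frame_det_pos[of E, OF less_imp_le[OF E] less_imp_le[OF p(1)] less_imp_le[OF p(2)]]
        by (subst frame_integral[OF E less_imp_le[OF p(1)] less_imp_le[OF p(2)]])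
           (auto intro!: ennreal_leI divide_right_mono order.trans[OF zero_le_one])
    qed
    also have "\<dots> = C"
    proof -
      have "frame_det E (1 / (4 * sv)) (1 / (4 * s2 i)) (sqmod (g 1)) (sqmod z) \<ge> 0" for i z
        using frame_det_pos[of E "1 / (4 * sv)" "1 / (4 * s2 i)" "sqmod (g 1)" "sqmod z"] E sv s2[of i] by simp
      then show ?thesis
        unfolding C_def pairwise_bound_def \<gamma>_def s2_def by (subst prod_ennreal) (auto simp: case_prod_unfold)
    qed
    finally show ?thesis .
  qed
  have pair: "(\<integral>\<^sup>+\<omega>. ennreal (R (fst \<omega> m) (fst \<omega> m') (fst (snd \<omega>)) (snd (snd \<omega>))) \<partial>T) \<le> C"
    if m': "m' \<in> {..<M} - {m}" for m'
  proof -
    have m'M: "m' < M" "m' \<noteq> m" using m' by auto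
    have "(\<integral>\<^sup>+\<omega>. ennreal (R (fst \<omega> m) (fst \<omega> m') (fst (snd \<omega>)) (snd (snd \<omega>))) \<partial>T) =
      (\<integral>\<^sup>+X. \<integral>\<^sup>+\<eta>. ennreal (R (X m) (X m') (fst \<eta>) (snd \<eta>)) \<partial>?WD \<partial>?CB)"
      using Rm[OF m'M(1)] unfolding T_def transmission_def
      by (subst WD.nn_integral_fst[symmetric]) auto
    also have "\<dots> = (\<integral>\<^sup>+X. \<integral>\<^sup>+w. \<integral>\<^sup>+v. ennreal (R (X m) (X m') w v) \<partial>dest_noise N L sv \<partial>relay_noise N L sw \<partial>?CB)"
    proof (rule nn_integral_cong)
      fix X
      have "(\<lambda>\<eta>. ennreal (R (X m) (X m') (fst \<eta>) (snd \<eta>))) \<in> borel_measurable ?WD"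
      proof -
        have "(\<lambda>\<eta>. r (k, i) (X m) (X m') (fst \<eta> (k, i)) (snd \<eta> (k, i, 1)) (snd \<eta> (k, i, 2)))
          \<in> borel_measurable ?WD" if q: "(k, i) \<in> frames N L" for k i
        proof -
          note q' = frames_slotsD[OF q]
          have [measurable]: "(\<lambda>\<eta>. fst \<eta> (k, i)) \<in> borel_measurable ?WD"
            "(\<lambda>\<eta>. snd \<eta> (k, i, 1)) \<in> borel_measurable ?WD"
            "(\<lambda>\<eta>. snd \<eta> (k, i, 2)) \<in> borel_measurable ?WD"
            unfolding relay_noise_def dest_noise_def
            using q q' by (auto intro!: measurable_compose[OF measurable_fst] measurable_compose[OF measurable_snd]
                measurable_component_cnormal)
          show ?thesis unfolding r_def by measurable
        qed
        then show ?thesis unfolding R_def by (intro measurable_compose[OF _ measurable_ennreal] borel_measurable_prod) (auto split: prod.splits)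
      qed
      then show "(\<integral>\<^sup>+\<eta>. ennreal (R (X m) (X m') (fst \<eta>) (snd \<eta>)) \<partial>?WD) =
        (\<integral>\<^sup>+w. \<integral>\<^sup>+v. ennreal (R (X m) (X m') w v) \<partial>dest_noise N L sv \<partial>relay_noise N L sw)"
        by (subst D.nn_integral_fst[symmetric]) auto
    qed
    also have "\<dots> = (\<integral>\<^sup>+X. \<phi> (X m) (X m') \<partial>?CB)" unfolding noise ..
    also have "\<dots> \<le> C"
    proof -
      interpret PX: product_sigma_finite "\<lambda>_. \<Pi>\<^sub>M p\<in>slots N L. cnormal E"
        unfolding product_sigma_finite_def by (auto intro!: prob_space_imp_sigma_finite prob_space_PiM_cnormal E)
      interpret PI: prob_space "\<Pi>\<^sub>M m\<in>{..<M} - {m'}. \<Pi>\<^sub>M p\<in>slots N L. cnormal E"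
        by (intro prob_space_PiM prob_space_PiM_cnormal E)
      \<comment> \<open>The competitor becomes the innermost coordinate: the other codewords, the
        sent one among them, are fixed while it is averaged.\<close>
      have ins: "{..<M} = insert m' ({..<M} - {m'})" using m'M by auto
      have \<phi>m: "(\<lambda>X. \<phi> (X m) (X m')) \<in> borel_measurable ?CB"
      proof -
        have "(\<lambda>X. ennreal (exp (- (1 / (4 * sv)) * sqmod (e1 (k, i) (X m) (X m'))
          - (1 / (4 * s2 i)) * sqmod (e2 (k, i) (X m) (X m'))))) \<in> borel_measurable ?CB"
          if q: "(k, i) \<in> frames N L" for k i
        proof -
          note q' = frames_slotsD[OF q]
          note [measurable] = measurable_codebook_component[OF m q'(1), of E] measurable_codebook_component[OF m q'(2), of E]
            measurable_codebook_component[OF m'M(1) q'(1), of E] measurable_codebook_component[OF m'M(1) q'(2), of E]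
          show ?thesis unfolding e1_def e2_def fst_conv snd_conv by measurable
        qed
        then show ?thesis unfolding \<phi>_def by (intro borel_measurable_prod_ennreal) (auto split: prod.splits)
      qed
      have "(\<integral>\<^sup>+X. \<phi> (X m) (X m') \<partial>?CB) = (\<integral>\<^sup>+X. \<integral>\<^sup>+x'. \<phi> (X m) x' \<partial>?CW \<partial>(\<Pi>\<^sub>M m\<in>{..<M} - {m'}. \<Pi>\<^sub>M p\<in>slots N L. cnormal E))"
        using \<phi>m m'M(2) unfolding codebook_def by (subst (asm) ins, subst ins, subst PX.product_nn_integral_insert) auto
      also have "\<dots> \<le> (\<integral>\<^sup>+X. C \<partial>(\<Pi>\<^sub>M m\<in>{..<M} - {m'}. \<Pi>\<^sub>M p\<in>slots N L. cnormal E))" by (intro nn_integral_mono \<phi>C)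
      also have "\<dots> = C" by (simp add: PI.emeasure_space_1)
      finally show ?thesis .
    qed
    finally show ?thesis .
  qed
  have ev: "{\<omega> \<in> space T. \<not> correct_event N L M sw sv g h \<beta> m \<omega>} \<in> sets T"
    using pred_correct_event[OF sw sv m, where N = N and L = L and E = E and g = g and h = h and \<beta> = \<beta>, folded T_def] by measurable
  have "cond_error N L M E sw sv g h \<beta> m = (\<integral>\<^sup>+\<omega>. indicator {\<omega> \<in> space T. \<not> correct_event N L M sw sv g h \<beta> m \<omega>} \<omega> \<partial>T)"
    using ev unfolding cond_error_def T_def[symmetric] by simp
  also have "\<dots> \<le> (\<integral>\<^sup>+\<omega>. (\<Sum>m'\<in>{..<M} - {m}. ennreal (R (fst \<omega> m) (fst \<omega> m') (fst (snd \<omega>)) (snd (snd \<omega>)))) \<partial>T)"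
  proof (rule nn_integral_mono)
    fix \<omega> assume "\<omega> \<in> space T"
    obtain X w v where \<omega>: "\<omega> = (X, w, v)" by (cases \<omega>)
    show "indicator {\<omega> \<in> space T. \<not> correct_event N L M sw sv g h \<beta> m \<omega>} \<omega> \<le>
      (\<Sum>m'\<in>{..<M} - {m}. ennreal (R (fst \<omega> m) (fst \<omega> m') (fst (snd \<omega>)) (snd (snd \<omega>))))"
    proof (cases "correct_event N L M sw sv g h \<beta> m \<omega>")
      case False
      then have "ml_decode N L M sw sv g h \<beta> X (received g h \<beta> (X m) w v) \<noteq> m" by (simp add: correct_event_def \<omega>)
      from ml_decode_neqD[OF m this] obtain m' where m': "m' \<in> {..<M} - {m}" and
        "likelihood N L sw sv g h \<beta> (X m) (received g h \<beta> (X m) w v) \<le> likelihood N L sw sv g h \<beta> (X m') (received g h \<beta> (X m) w v)"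
        by auto
      then have "1 \<le> R (X m) (X m') w v" by (intro chernoff)
      then have "1 \<le> ennreal (R (X m) (X m') w v)" by simp
      also have "\<dots> \<le> (\<Sum>m'\<in>{..<M} - {m}. ennreal (R (X m) (X m') w v))" using m' by (intro member_le_sum) auto
      finally show ?thesis by (simp add: \<omega> indicator_def)
    qed simp
  qed
  also have "\<dots> = (\<Sum>m'\<in>{..<M} - {m}. \<integral>\<^sup>+\<omega>. ennreal (R (fst \<omega> m) (fst \<omega> m') (fst (snd \<omega>)) (snd (snd \<omega>))) \<partial>T)"
    by (rule nn_integral_sum) (use Rm in auto)
  also have "\<dots> \<le> (\<Sum>m'\<in>{..<M} - {m}. C)" by (intro sum_mono pair)
  also have "\<dots> = of_nat (card ({..<M} - {m})) * C" by simp
  also have "\<dots> \<le> of_nat M * C" using card_Diff1_le[of "{..<M}" m] by (intro mult_right_mono) (auto simp del: card_Diff_insert)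
  also have "\<dots> = ennreal (real M * pairwise_bound N L E sw sv g h \<beta>)"
    unfolding C_def by (simp add: ennreal_mult' ennreal_of_nat_eq_real_of_nat)
  finally show ?thesis .
qed

section \<open>Strong converse\<close>

lemma nn_integral_lborel_gauss:
  assumes t: "t > 0"
  shows "(\<integral>\<^sup>+y. ennreal (exp (- t * sqmod (y - a))) \<partial>lborel) = ennreal (pi / t)"
proof -
  have "(\<integral>\<^sup>+y. ennreal (exp (- t * sqmod (y - a))) \<partial>lborel) =
    (\<integral>\<^sup>+y. ennreal (pi / t) * ennreal (cnormal_density (1 / t) (y + (- a))) \<partial>lborel)"
    using t by (intro nn_integral_cong) (simp add: cnormal_density_def ennreal_mult[symmetric] mult.commute)
  also have "\<dots> = ennreal (pi / t) * (\<integral>\<^sup>+y. ennreal (cnormal_density (1 / t) (y + (- a))) \<partial>lborel)"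
    by (rule nn_integral_cmult) measurable
  also have "\<dots> = ennreal (pi / t)"
    by (subst nn_integral_lborel_translate) (use t in \<open>auto simp: nn_integral_cnormal_density\<close>)
  finally show ?thesis .
qed

lemma frame_form_measurable [measurable]:
  assumes [measurable]: "f \<in> borel_measurable K" "f' \<in> borel_measurable K"
  shows "(\<lambda>z. frame_form E t1 t2 g c (f z) (f' z)) \<in> borel_measurable K"
  unfolding frame_form_def Let_def by measurable

text \<open>This is \<open>frame_integral\<close> read backwards: the exponential is the determinant
  times an average over the transmitted pair. After exchanging the integrals the received pair is
  integrated first, against two plain Gaussians centred at the signals.\<close>

lemma nn_integral_exp_frame_form:
  assumes E: "E > 0" and t1: "t1 > 0" and t2: "t2 > 0"
  shows "(\<integral>\<^sup>+y1. \<integral>\<^sup>+y2. ennreal (exp (- frame_form E t1 t2 g c y1 y2)) \<partial>lborel \<partial>lborel) =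
    ennreal (frame_det E t1 t2 (sqmod g) (sqmod c) * (pi / t1 * (pi / t2)))"
proof -
  interpret C: prob_space "cnormal E" by (rule prob_space_cnormal[OF E])
  interpret CC: pair_prob_space "cnormal E" "cnormal E" ..
  interpret LL: pair_sigma_finite "lborel :: complex measure" "lborel :: complex measure" ..
  interpret P: pair_sigma_finite "cnormal E \<Otimes>\<^sub>M cnormal E" "lborel \<Otimes>\<^sub>M (lborel :: complex measure)" ..
  let ?C2 = "cnormal E \<Otimes>\<^sub>M cnormal E"
  let ?L2 = "lborel \<Otimes>\<^sub>M (lborel :: complex measure)"
  define d where "d = frame_det E t1 t2 (sqmod g) (sqmod c)"
  have d: "d \<ge> 1" unfolding d_def by (rule frame_det_pos) (use E t1 t2 in auto)
  define K where "K y x = ennreal (exp (- t1 * sqmod (fst y - g * fst x) - t2 * sqmod (snd y - g * snd x - c * fst x)))" for y x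
  have sb: "sets ?C2 = sets (borel \<Otimes>\<^sub>M borel)" "sets (lborel \<Otimes>\<^sub>M (lborel :: complex measure)) = sets (borel \<Otimes>\<^sub>M borel)"
    by (auto intro!: sets_pair_measure_cong)
  have K1: "K y \<in> borel_measurable ?C2" for y unfolding K_def measurable_cong_sets[OF sb(1) refl] by measurable
  have K2: "(\<lambda>y. K y x) \<in> borel_measurable ?L2" for x unfolding K_def measurable_cong_sets[OF sb(2) refl] by measurable
  have K3: "(\<lambda>z. K (snd z) (fst z)) \<in> borel_measurable (?C2 \<Otimes>\<^sub>M ?L2)"
    unfolding K_def measurable_cong_sets[OF sets_pair_measure_cong[OF sb] refl] by measurable
  have K4: "case_prod K \<in> borel_measurable (?L2 \<Otimes>\<^sub>M ?C2)"
    unfolding K_def measurable_cong_sets[OF sets_pair_measure_cong[OF sb(2,1)] refl] by measurable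
  have form: "ennreal (exp (- frame_form E t1 t2 g c y1 y2)) = ennreal d * (\<integral>\<^sup>+x. K (y1, y2) x \<partial>?C2)" for y1 y2
  proof -
    have "(\<integral>\<^sup>+x. K (y1, y2) x \<partial>?C2) = ennreal (exp (- frame_form E t1 t2 g c y1 y2) / d)"
      using K1[of "(y1, y2)"] frame_integral[OF E less_imp_le[OF t1] less_imp_le[OF t2], of y1 g y2 c]
      by (subst C.nn_integral_fst[symmetric]) (auto simp: K_def d_def)
    then show ?thesis using d by (simp add: ennreal_mult[symmetric])
  qed
  have "(\<integral>\<^sup>+y1. \<integral>\<^sup>+y2. ennreal (exp (- frame_form E t1 t2 g c y1 y2)) \<partial>lborel \<partial>lborel) =
    (\<integral>\<^sup>+y. ennreal (exp (- frame_form E t1 t2 g c (fst y) (snd y))) \<partial>?L2)"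
    by (subst lborel.nn_integral_fst[symmetric]) (auto simp: measurable_cong_sets[OF sb(2) refl])
  also have "\<dots> = (\<integral>\<^sup>+y. ennreal d * (\<integral>\<^sup>+x. K y x \<partial>?C2) \<partial>?L2)" by (simp add: form)
  also have "\<dots> = ennreal d * (\<integral>\<^sup>+y. (\<integral>\<^sup>+x. K y x \<partial>?C2) \<partial>?L2)"
    by (rule nn_integral_cmult) (rule CC.P.borel_measurable_nn_integral[OF K4])
  also have "(\<integral>\<^sup>+y. (\<integral>\<^sup>+x. K y x \<partial>?C2) \<partial>?L2) = (\<integral>\<^sup>+x. (\<integral>\<^sup>+y. K y x \<partial>?L2) \<partial>?C2)" using P.Fubini[OF K3] by simp
  also have "\<dots> = (\<integral>\<^sup>+x. ennreal (pi / t1 * (pi / t2)) \<partial>?C2)"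
  proof (rule nn_integral_cong)
    fix x
    have "(\<integral>\<^sup>+y. K y x \<partial>?L2) =
      (\<integral>\<^sup>+y1. \<integral>\<^sup>+y2. ennreal (exp (- t1 * sqmod (y1 - g * fst x))) * ennreal (exp (- t2 * sqmod (y2 - (g * snd x + c * fst x)))) \<partial>lborel \<partial>lborel)"
      using K2[of x] by (subst lborel.nn_integral_fst[symmetric])
        (auto simp: K_def ennreal_mult[symmetric] exp_add[symmetric] algebra_simps intro!: nn_integral_cong)
    also have "\<dots> = (\<integral>\<^sup>+y1. ennreal (exp (- t1 * sqmod (y1 - g * fst x))) * ennreal (pi / t2) \<partial>lborel)"
      by (intro nn_integral_cong) (subst nn_integral_cmult, simp, subst nn_integral_lborel_gauss[OF t2], rule refl)
    also have "\<dots> = ennreal (pi / t1) * ennreal (pi / t2)"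
      by (subst nn_integral_multc, simp, subst nn_integral_lborel_gauss[OF t1], rule refl)
    finally show "(\<integral>\<^sup>+y. K y x \<partial>?L2) = ennreal (pi / t1 * (pi / t2))" using t1 t2 by (subst ennreal_mult) auto
  qed
  also have "\<dots> = ennreal (pi / t1 * (pi / t2))" by (simp add: CC.P.emeasure_space_1)
  finally show ?thesis using d t1 t2 by (simp add: d_def[symmetric] ennreal_mult[symmetric])
qed

text \<open>
  The square root halves the quadratic form, which the substitution \<open>y = sqrt 2 z\<close> undoes; hence the
  form need not be diagonalised.
\<close>

lemma nn_integral_sqrt_frame:
  fixes g c :: complex
  assumes E: "E > 0" and s: "s > 0"
  defines "d \<equiv> frame_det E (2 / s) (2 / s) (sqmod g) (sqmod c)"
  shows "(\<integral>\<^sup>+y1. \<integral>\<^sup>+y2. ennreal (sqrt (exp (- frame_form E (2 / s) (2 / s) g c y1 (y2 - a)) / (d * (pi * s) ^ 4))) \<partial>lborel \<partial>lborel) =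
    ennreal (sqrt d)"
proof -
  have d: "d \<ge> 1" unfolding d_def by (rule frame_det_pos) (use E s in auto)
  define Q where "Q = frame_form E (2 / s) (2 / s) g c"
  define k where "k = 1 / (sqrt d * (pi * s)\<^sup>2)"
  have k: "k \<ge> 0" using d by (simp add: k_def)
  have sq: "sqrt (exp (- Q y1 y2) / (d * (pi * s) ^ 4)) = k * exp (- Q y1 y2 / 2)" for y1 y2
  proof -
    have "sqrt (exp (- Q y1 y2)) = exp (- Q y1 y2 / 2)" by (rule real_sqrt_unique) (simp_all add: exp_double[symmetric])
    moreover have "sqrt ((pi * s) ^ 4) = (pi * s)\<^sup>2" by (rule real_sqrt_unique) simp_all
    ultimately show ?thesis by (simp only: k_def real_sqrt_divide real_sqrt_mult) simp
  qed
  have scale: "Q (sqrt 2 *\<^sub>R y1) (sqrt 2 *\<^sub>R y2) / 2 = Q y1 y2" for y1 y2 unfolding Q_def frame_form_scale by simp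
  have m1: "(\<lambda>y1. \<integral>\<^sup>+y2. ennreal (exp (- Q y1 y2 / 2)) \<partial>lborel) \<in> borel_measurable borel" unfolding Q_def by measurable
  have "(\<integral>\<^sup>+y1. \<integral>\<^sup>+y2. ennreal (sqrt (exp (- Q y1 (y2 - a)) / (d * (pi * s) ^ 4))) \<partial>lborel \<partial>lborel) =
    (\<integral>\<^sup>+y1. \<integral>\<^sup>+y2. ennreal k * ennreal (exp (- Q y1 y2 / 2)) \<partial>lborel \<partial>lborel)"
  proof (rule nn_integral_cong)
    fix y1
    have "(\<integral>\<^sup>+y2. ennreal k * ennreal (exp (- Q y1 (y2 + (- a)) / 2)) \<partial>lborel) =
      (\<integral>\<^sup>+y2. ennreal k * ennreal (exp (- Q y1 y2 / 2)) \<partial>lborel)"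
      unfolding Q_def by (rule nn_integral_lborel_translate) measurable
    then show "(\<integral>\<^sup>+y2. ennreal (sqrt (exp (- Q y1 (y2 - a)) / (d * (pi * s) ^ 4))) \<partial>lborel) =
      (\<integral>\<^sup>+y2. ennreal k * ennreal (exp (- Q y1 y2 / 2)) \<partial>lborel)"
      unfolding sq using k by (simp add: ennreal_mult)
  qed
  also have "\<dots> = ennreal k * (\<integral>\<^sup>+y1. \<integral>\<^sup>+y2. ennreal (exp (- Q y1 y2 / 2)) \<partial>lborel \<partial>lborel)"
    unfolding Q_def by (simp add: nn_integral_cmult)
  also have "(\<integral>\<^sup>+y1. \<integral>\<^sup>+y2. ennreal (exp (- Q y1 y2 / 2)) \<partial>lborel \<partial>lborel) =
    ennreal 2 * (\<integral>\<^sup>+z1. \<integral>\<^sup>+y2. ennreal (exp (- Q (sqrt 2 *\<^sub>R z1) y2 / 2)) \<partial>lborel \<partial>lborel)"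
    using nn_integral_lborel_scale_complex[OF m1, of "sqrt 2"] by simp
  also have "(\<integral>\<^sup>+z1. \<integral>\<^sup>+y2. ennreal (exp (- Q (sqrt 2 *\<^sub>R z1) y2 / 2)) \<partial>lborel \<partial>lborel) =
    (\<integral>\<^sup>+z1. ennreal 2 * (\<integral>\<^sup>+z2. ennreal (exp (- Q z1 z2)) \<partial>lborel) \<partial>lborel)"
  proof (rule nn_integral_cong)
    fix z1
    have "(\<lambda>y2. ennreal (exp (- Q (sqrt 2 *\<^sub>R z1) y2 / 2))) \<in> borel_measurable borel" unfolding Q_def by measurable
    from nn_integral_lborel_scale_complex[OF this, of "sqrt 2"]
    show "(\<integral>\<^sup>+y2. ennreal (exp (- Q (sqrt 2 *\<^sub>R z1) y2 / 2)) \<partial>lborel) = ennreal 2 * (\<integral>\<^sup>+z2. ennreal (exp (- Q z1 z2)) \<partial>lborel)"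
      using scale by simp
  qed
  also have "\<dots> = ennreal 2 * (\<integral>\<^sup>+z1. \<integral>\<^sup>+z2. ennreal (exp (- Q z1 z2)) \<partial>lborel \<partial>lborel)"
    unfolding Q_def by (rule nn_integral_cmult) measurable
  also have "(\<integral>\<^sup>+z1. \<integral>\<^sup>+z2. ennreal (exp (- Q z1 z2)) \<partial>lborel \<partial>lborel) = ennreal (d * (pi / (2 / s) * (pi / (2 / s))))"
    unfolding Q_def d_def by (rule nn_integral_exp_frame_form) (use E s in auto)
  also have "ennreal k * (ennreal 2 * (ennreal 2 * ennreal (d * (pi / (2 / s) * (pi / (2 / s)))))) =
    ennreal (k * (2 * (2 * (d * (pi / (2 / s) * (pi / (2 / s)))))))"
    using k d s by (simp add: ennreal_mult[symmetric] del: ennreal_numeral)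
  \<comment> \<open>Each of the two substitutions by \<open>sqrt 2\<close> contributes a factor 2, a
    complex coordinate having real dimension two; together they cancel the halves in
    \<open>pi / (2 / s)\<close>.\<close>
  also have "k * (2 * (2 * (d * (pi / (2 / s) * (pi / (2 / s)))))) = d / sqrt d"
    using s by (simp add: k_def power2_eq_square)
  also have "\<dots> = sqrt d" using d by (simp add: real_div_sqrt)
  finally show ?thesis unfolding Q_def .
qed

text \<open>The determinants of the converse. The precision \<open>2 / sv\<close> comes from
  squaring the density, and only the destination noise appears because the relay noise is treated as
  known.\<close>

definition frame_dets where
  "frame_dets N L E sv g h \<beta> = (\<Prod>(k, i)\<in>frames N L. frame_det E (2 / sv) (2 / sv)
       (sqmod (g 1)) (sqmod (fwd_gain g \<beta> i * h (i + 1))))"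

text \<open>The conditional follows \<open>received\<close>, which takes every \<open>j\<close>
  other than 1 as the second interval; on the slots it is just \<open>v p\<close>.\<close>

lemma received_add_noise:
  "received g h \<beta> x w v p = received g h \<beta> x w (\<lambda>_. 0) p + (if snd (snd p) = 1 then v (fst p, fst (snd p), 1) else v (fst p, fst (snd p), 2))"
  by (cases p) auto

lemma measurable_component_lborel:
  "i \<in> I \<Longrightarrow> (\<lambda>x. x i) \<in> borel_measurable (\<Pi>\<^sub>M i\<in>I. lborel)"
  using measurable_component_singleton[of i I "\<lambda>_. lborel"] by simp

text \<open>
  The decoding regions are disjoint, so the likelihoods over them sum to at most \<open>sqrt (\<Sum>m. p(y | x m)^2)\<close>,
  and the codebook average goes under the root. Revealing the relay noise only helps the decoder.
\<close>

lemma sum_cond_correct_le: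
  assumes E: "E > 0" and sw: "sw > 0" and sv: "sv > 0" and M: "M > 0"
  shows "(\<Sum>m<M. cond_correct N L M E sw sv g h \<beta> m) \<le> ennreal (sqrt (real M * frame_dets N L E sv g h \<beta>))"
proof -
  define Y where "Y = (\<Pi>\<^sub>M p\<in>slots N L. (lborel :: complex measure))"
  interpret D: prob_space "dest_noise N L sv" by (rule prob_space_dest_noise[OF sv])
  interpret W: prob_space "relay_noise N L sw" by (rule prob_space_relay_noise[OF sw])
  interpret CB: prob_space "codebook N L M E" by (rule prob_space_codebook[OF E])
  interpret LB: finite_product_sigma_finite "\<lambda>_::nat \<times> nat \<times> nat. lborel :: complex measure" "slots N L"
    by standard auto
  interpret Y: sigma_finite_measure Y unfolding Y_def by (rule LB.sigma_finite_measure_axioms)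
  interpret WD: prob_space "relay_noise N L sw \<Otimes>\<^sub>M dest_noise N L sv" by (intro prob_space_pair) unfold_locales
  interpret WY: pair_sigma_finite "relay_noise N L sw" Y ..
  interpret CWY: pair_sigma_finite "codebook N L M E" "relay_noise N L sw \<Otimes>\<^sub>M Y" ..
  let ?WD = "relay_noise N L sw \<Otimes>\<^sub>M dest_noise N L sv"
  let ?CW = "\<Pi>\<^sub>M p\<in>slots N L. cnormal E"
  let ?CB = "codebook N L M E"
  define \<gamma> where "\<gamma> i = fwd_gain g \<beta> i" for i
  define dec where "dec X y = ml_decode N L M sw sv g h \<beta> X y" for X y
  \<comment> \<open>The density given the relay noise as well. The decision \<open>dec\<close>
    ignores \<open>w\<close>, and the bound below is proved for each \<open>w\<close>
    separately.\<close>
  define p where "p x w y = (\<Prod>q\<in>slots N L. cnormal_density sv (y q - received g h \<beta> x w (\<lambda>_. 0) q))" for x w y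
  have p0: "p x w y \<ge> 0" for x w y unfolding p_def using sv by (intro prod_nonneg) auto
  define ind where "ind m X y = (if dec X y = m then 1 else 0 :: real)" for m X y
  let ?B = "relay_noise N L sw \<Otimes>\<^sub>M Y"
  let ?K = "?CB \<Otimes>\<^sub>M ?B"
  let ?f = "\<lambda>m X \<eta>. ennreal (p (X m) (fst \<eta>) (snd \<eta>) * ind m X (snd \<eta>))"
  have Kc: "m < M \<Longrightarrow> q \<in> slots N L \<Longrightarrow> (\<lambda>\<omega>. fst \<omega> m q) \<in> borel_measurable ?K"
     "q' \<in> frames N L \<Longrightarrow> (\<lambda>\<omega>. fst (snd \<omega>) q') \<in> borel_measurable ?K"
     "q \<in> slots N L \<Longrightarrow> (\<lambda>\<omega>. snd (snd \<omega>) q) \<in> borel_measurable ?K" for m q q'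
    by (auto intro!: measurable_compose[OF measurable_fst measurable_codebook_component]
      measurable_compose[OF measurable_compose[OF measurable_snd measurable_fst]]
      measurable_compose[OF measurable_compose[OF measurable_snd measurable_snd]]
      measurable_component_cnormal measurable_component_lborel simp: relay_noise_def Y_def)
  have pm: "(\<lambda>\<omega>. p (fst \<omega> m) (fst (snd \<omega>)) (snd (snd \<omega>))) \<in> borel_measurable ?K" if "m < M" for m
  proof -
    have "(\<lambda>\<omega>. snd (snd \<omega>) q - received g h \<beta> (fst \<omega> m) (fst (snd \<omega>)) (\<lambda>_. 0) q) \<in> borel_measurable ?K"
      if q: "q \<in> slots N L" for q
      by (intro borel_measurable_diff Kc q borel_measurable_received[OF q, where K = ?K]) (auto intro: Kc \<open>m < M\<close>)
    then show ?thesis unfolding p_def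
      by (intro borel_measurable_prod measurable_compose[OF _ cnormal_density_measurable]) auto
  qed
  have im: "(\<lambda>\<omega>. ind m (fst \<omega>) (snd (snd \<omega>))) \<in> borel_measurable ?K" if "m < M" for m
  proof -
    have "Measurable.pred ?K (\<lambda>\<omega>. dec (fst \<omega>) (snd (snd \<omega>)) = m)" unfolding dec_def
      by (intro pred_ml_decode[OF that] borel_measurable_likelihood[OF sw sv, where K = ?K]) (auto intro: Kc)
    then show ?thesis unfolding ind_def by measurable
  qed
  have fm: "(\<lambda>\<omega>. ?f m (fst \<omega>) (snd \<omega>)) \<in> borel_measurable ?K"
    if "m < M" for m
    using pm[OF that] im[OF that] by measurable
  \<comment> \<open>Translating the noise by the signal \<open>\<mu>\<close> makes the received
    block the variable of integration, over regions that depend on the codebook but not on which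
    message was sent.\<close>
  have cc: "cond_correct N L M E sw sv g h \<beta> m = (\<integral>\<^sup>+X. \<integral>\<^sup>+\<eta>. ?f m X \<eta> \<partial>?B \<partial>?CB)" if m: "m < M" for m
  proof -
    note ce = pred_correct_event[OF sw sv m, where N = N and L = L and E = E and g = g and h = h and \<beta> = \<beta>]
    define P where "P = correct_event N L M sw sv g h \<beta> m"
    let ?A = "\<lambda>X. {\<eta> \<in> space ?WD. P (X, \<eta>)}"
    have "cond_correct N L M E sw sv g h \<beta> m = (\<integral>\<^sup>+X. emeasure ?WD (?A X) \<partial>?CB)"
      unfolding cond_correct_def P_def[symmetric] transmission_def
      by (rule emeasure_pair_pred(1)[OF WD.sigma_finite_measure_axioms]) (use ce in \<open>simp add: transmission_def P_def\<close>)
    also have "\<dots> = (\<integral>\<^sup>+X. \<integral>\<^sup>+\<eta>. ?f m X \<eta> \<partial>?B \<partial>?CB)"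
    proof (rule nn_integral_cong)
      fix X assume X: "X \<in> space ?CB"
      have P1: "Measurable.pred ?WD (\<lambda>\<eta>. P (X, \<eta>))"
        using measurable_compose[OF measurable_Pair1'[OF X] ce[unfolded transmission_def]] unfolding P_def by simp
      have f1: "(\<lambda>\<eta>. ?f m X \<eta>) \<in> borel_measurable ?B"
        using measurable_compose[OF measurable_Pair1'[OF X] fm[OF m]] by simp
      have "emeasure ?WD (?A X)
        = (\<integral>\<^sup>+w. emeasure (dest_noise N L sv) {v \<in> space (dest_noise N L sv). P (X, w, v)} \<partial>relay_noise N L sw)"
        by (rule emeasure_pair_pred(1)[OF D.sigma_finite_measure_axioms P1])
      also have "\<dots> = (\<integral>\<^sup>+w. \<integral>\<^sup>+y. ennreal (p (X m) w y * ind m X y) \<partial>Y \<partial>relay_noise N L sw)"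
      proof (rule nn_integral_cong)
        fix w assume w: "w \<in> space (relay_noise N L sw)"
        let ?V = "{v \<in> space (dest_noise N L sv). P (X, w, v)}"
        define \<mu> where "\<mu> = received g h \<beta> (X m) w (\<lambda>_. 0)"
        have P2: "Measurable.pred (dest_noise N L sv) (\<lambda>v. P (X, w, v))"
          using measurable_compose[OF measurable_Pair1'[OF w] P1] by simp
        have Pi: "P (X, w, v) \<longleftrightarrow> dec X (\<lambda>q\<in>slots N L. \<mu> q + v q) = m" for v
        proof -
          have "dec X (\<lambda>q\<in>slots N L. \<mu> q + v q) = dec X (received g h \<beta> (X m) w v)" unfolding dec_def
          proof (rule ml_decode_cong_slots[OF sw sv])
            fix q assume q: "q \<in> slots N L"
            then have "(if snd (snd q) = 1 then v (fst q, fst (snd q), 1) else v (fst q, fst (snd q), 2)) = v q"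
              by (auto simp: slots_def)
            then show "(\<lambda>q\<in>slots N L. \<mu> q + v q) q = received g h \<beta> (X m) w v q"
              using q unfolding received_add_noise[of g h \<beta> "X m" w v q] \<mu>_def by simp
          qed
          then show ?thesis by (simp add: P_def correct_event_def dec_def)
        qed
        have dm: "(\<lambda>y. ennreal (ind m X y)) \<in> borel_measurable (\<Pi>\<^sub>M q\<in>slots N L. borel)"
        proof -
          have c: "(\<lambda>y. y q) \<in> borel_measurable (\<Pi>\<^sub>M q\<in>slots N L. borel)" if "q \<in> slots N L" for q
            using measurable_component_singleton[OF that, of "\<lambda>_. borel"] .
          have "Measurable.pred (\<Pi>\<^sub>M q\<in>slots N L. borel) (\<lambda>y. dec X y = m)" unfolding dec_def
            by (intro pred_ml_decode[OF m] borel_measurable_likelihood[OF sw sv, where K = "\<Pi>\<^sub>M q\<in>slots N L. borel"]) (auto intro: c)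
          then show ?thesis unfolding ind_def by measurable
        qed
        have "emeasure (dest_noise N L sv) ?V = (\<integral>\<^sup>+v. indicator ?V v \<partial>dest_noise N L sv)"
          using P2 by (subst nn_integral_indicator) (auto simp: pred_def)
        also have "\<dots> = (\<integral>\<^sup>+v. ennreal (ind m X (\<lambda>q\<in>slots N L. \<mu> q + v q)) \<partial>dest_noise N L sv)"
          by (intro nn_integral_cong) (auto simp: indicator_def ind_def Pi)
        also have "\<dots> = (\<integral>\<^sup>+y. (\<Prod>q\<in>slots N L. ennreal (cnormal_density sv (y q - \<mu> q))) * ennreal (ind m X y) \<partial>Y)"
          unfolding dest_noise_def Y_def by (rule nn_integral_PiM_cnormal_shift[OF sv finite_slots dm])
        also have "\<dots> = (\<integral>\<^sup>+y. ennreal (p (X m) w y * ind m X y) \<partial>Y)"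
          using sv by (intro nn_integral_cong) (simp add: p_def \<mu>_def prod_ennreal ennreal_mult prod_nonneg ind_def)
        finally show "emeasure (dest_noise N L sv) ?V = (\<integral>\<^sup>+y. ennreal (p (X m) w y * ind m X y) \<partial>Y)" .
      qed
      also have "\<dots> = (\<integral>\<^sup>+\<eta>. ?f m X \<eta> \<partial>?B)" using Y.nn_integral_fst[OF f1] by simp
      finally show "emeasure ?WD (?A X) = (\<integral>\<^sup>+\<eta>. ?f m X \<eta> \<partial>?B)" .
    qed
    finally show ?thesis .
  qed
  define c where "c i = \<gamma> i * h (i + 1)" for i
  define d where "d i = frame_det E (2 / sv) (2 / sv) (sqmod (g 1)) (sqmod (c i))" for i
  have d: "d i \<ge> 1" for i unfolding d_def by (rule frame_det_pos) (use E sv in auto)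
  \<comment> \<open>One frame of the codebook average of the squared density; its four density
    factors leave \<open>(pi * sv) ^ 4\<close>, and the relay noise only translates the second
    argument.\<close>
  define G where "G w k i y1 y2 = exp (- frame_form E (2 / sv) (2 / sv) (g 1) (c i) y1 (y2 - \<gamma> i * w (k, i))) / (d i * (pi * sv) ^ 4)"
    for w :: "nat \<times> nat \<Rightarrow> complex" and k i y1 y2
  have G: "G w k i y1 y2 > 0" for w k i y1 y2 unfolding G_def using d[of i] sv by simp
  define F where "F w y = (\<Prod>(k, i)\<in>frames N L. G w k i (y (k, i, 1)) (y (k, i, 2)))"
    for w and y :: "nat \<times> nat \<times> nat \<Rightarrow> complex"
  have F: "F w y > 0" for w y unfolding F_def by (intro prod_pos) (auto simp: G)
  have pF: "(\<integral>\<^sup>+x. ennreal ((p x w y)\<^sup>2) \<partial>?CW) = ennreal (F w y)" for w y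
  proof -
    define f where "f q x1 x2 = ennreal ((cnormal_density sv (y (fst q, snd q, 1) - g 1 * x1))\<^sup>2 *
        (cnormal_density sv (y (fst q, snd q, 2) - \<gamma> (snd q) * w q - g 1 * x2 - c (snd q) * x1))\<^sup>2)" for q x1 x2
    have fm': "case_prod (f q) \<in> borel_measurable (borel \<Otimes>\<^sub>M borel)" for q unfolding f_def by measurable
    have "ennreal ((p x w y)\<^sup>2) = (\<Prod>(k, i)\<in>frames N L. f (k, i) (x (k, i, 1)) (x (k, i, 2)))" for x
      unfolding p_def slots_eq_frame_slots prod_frame_slots[OF finite_frames] prod_power_distrib f_def case_prod_unfold
      by (subst prod_ennreal) (auto simp: power_mult_distrib c_def \<gamma>_def fwd_gain_def algebra_simps
          intro!: prod.cong arg_cong2[where f = "(*)"] arg_cong[where f = "\<lambda>z. (cnormal_density sv z)\<^sup>2"])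
    then have "(\<integral>\<^sup>+x. ennreal ((p x w y)\<^sup>2) \<partial>?CW) = (\<Prod>q\<in>frames N L. \<integral>\<^sup>+x1. \<integral>\<^sup>+x2. f q x1 x2 \<partial>cnormal E \<partial>cnormal E)"
      unfolding slots_eq_frame_slots
      using fm' by (subst nn_integral_frame_slots[where \<mu> = "cnormal E", symmetric]) (simp_all add: sigma_finite_cnormal E)
    also have "\<dots> = (\<Prod>q\<in>frames N L. ennreal (G w (fst q) (snd q) (y (fst q, snd q, 1)) (y (fst q, snd q, 2))))"
    proof (rule prod.cong[OF refl])
      fix q :: "nat \<times> nat"
      define k4 where "k4 = 1 / (pi * sv) ^ 4"
      have k4: "k4 \<ge> 0" using sv by (simp add: k4_def)
      have dens: "(cnormal_density sv z1)\<^sup>2 * (cnormal_density sv z2)\<^sup>2 =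
        k4 * exp (- (2 / sv) * sqmod z1 - (2 / sv) * sqmod z2)" for z1 z2
        unfolding k4_def cnormal_density_def power_divide exp_double[symmetric]
        by (simp add: exp_add[symmetric] power4_eq_xxxx power2_eq_square)
      have "(\<integral>\<^sup>+x1. \<integral>\<^sup>+x2. f q x1 x2 \<partial>cnormal E \<partial>cnormal E) = ennreal k4 *
        (\<integral>\<^sup>+x1. \<integral>\<^sup>+x2. ennreal (exp (- (2 / sv) * sqmod (y (fst q, snd q, 1) - g 1 * x1)
          - (2 / sv) * sqmod (y (fst q, snd q, 2) - \<gamma> (snd q) * w q - g 1 * x2 - c (snd q) * x1))) \<partial>cnormal E \<partial>cnormal E)"
      proof -
        interpret sigma_finite_measure "cnormal E" by (rule sigma_finite_cnormal[OF E])
        show ?thesis unfolding f_def dens using k4 by (simp add: ennreal_mult' nn_integral_cmult)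
      qed
      also have "\<dots> = ennreal (k4 * (exp (- frame_form E (2 / sv) (2 / sv) (g 1) (c (snd q))
          (y (fst q, snd q, 1)) (y (fst q, snd q, 2) - \<gamma> (snd q) * w q)) / d (snd q)))"
        using sv k4 d[of "snd q"] by (subst frame_integral[OF E]) (auto simp: ennreal_mult[symmetric] d_def)
      also have "\<dots> = ennreal (G w (fst q) (snd q) (y (fst q, snd q, 1)) (y (fst q, snd q, 2)))"
        by (simp add: G_def k4_def mult.commute)
      finally show "(\<integral>\<^sup>+x1. \<integral>\<^sup>+x2. f q x1 x2 \<partial>cnormal E \<partial>cnormal E) = \<dots>" .
    qed
    also have "\<dots> = ennreal (F w y)"
      unfolding F_def using G by (subst prod_ennreal) (auto simp: less_imp_le case_prod_unfold)
    finally show ?thesis .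
  qed
  define \<Lambda> where "\<Lambda> w y = sqrt (real M * F w y)" for w y
  let ?J = "\<lambda>m w y. \<integral>\<^sup>+X. ennreal ((p (X m) w y)\<^sup>2) \<partial>?CB"
  have \<Lambda>: "\<Lambda> w y > 0" for w y unfolding \<Lambda>_def using F M by simp
  have marg: "?J m w y = ennreal (F w y)" if m: "m < M" for m w y
  proof -
    interpret PX: product_prob_space "\<lambda>_. \<Pi>\<^sub>M p\<in>slots N L. cnormal E" "{..<M}"
      unfolding product_prob_space_def product_prob_space_axioms_def product_sigma_finite_def
      by (auto intro!: prob_space_imp_sigma_finite prob_space_PiM_cnormal E)
    have pmx: "(\<lambda>x. ennreal ((p x w y)\<^sup>2)) \<in> borel_measurable ?CW"
    proof -
      have "(\<lambda>x. y q - received g h \<beta> x w (\<lambda>_. 0) q) \<in> borel_measurable ?CW" if "q \<in> slots N L" for q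
        by (intro borel_measurable_diff borel_measurable_received[OF that, where K = "\<Pi>\<^sub>M q\<in>slots N L. cnormal E"])
          (auto intro: measurable_component_cnormal)
      then show ?thesis unfolding p_def
        by (intro measurable_compose[OF _ measurable_ennreal] borel_measurable_power borel_measurable_prod
           measurable_compose[OF _ cnormal_density_measurable]) auto
    qed
    have mc: "(\<lambda>X. X m) \<in> ?CB \<rightarrow>\<^sub>M ?CW" unfolding codebook_def using m by (intro measurable_component_singleton) auto
    have "?J m w y = (\<integral>\<^sup>+x. ennreal ((p x w y)\<^sup>2) \<partial>distr ?CB ?CW (\<lambda>X. X m))"
      using pmx by (subst nn_integral_distr[OF mc]) simp_all
    also have "distr ?CB ?CW (\<lambda>X. X m) = ?CW" unfolding codebook_def using m by (intro PX.PiM_component) auto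
    finally show ?thesis unfolding pF .
  qed
  have inner: "(\<integral>\<^sup>+X. (\<Sum>m<M. ennreal (p (X m) w y * ind m X y)) \<partial>?CB) \<le> ennreal (\<Lambda> w y)"
    if w: "w \<in> space (relay_noise N L sw)" and y: "y \<in> space Y" for w y
  proof -
    \<comment> \<open>For \<open>l > 0\<close> each density satisfies
      \<open>p \<le> p ^ 2 / (2 * l) + l / 2\<close>, which takes the place of Jensen's inequality
      for the square root. The term \<open>l / 2\<close> is paid only once, since at most one
      decoding region contains \<open>y\<close>. The mean of the sum of squares is
      \<open>l ^ 2\<close> for this choice of \<open>l\<close>, so both terms contribute
      \<open>l / 2\<close>.\<close>
    define l where "l = \<Lambda> w y"
    have l: "l > 0" unfolding l_def by (rule \<Lambda>)
    have pmX: "(\<lambda>X. p (X m) w y) \<in> borel_measurable ?CB" if "m < M" for m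
    proof -
      have "(w, y) \<in> space ?B" using w y by (simp add: space_pair_measure)
      from measurable_compose[OF measurable_Pair2'[OF this] pm[OF that]] show ?thesis by simp
    qed
    have "(\<Sum>m<M. p (X m) w y * ind m X y) \<le> (\<Sum>m<M. (p (X m) w y)\<^sup>2) / (2 * l) + l / 2" for X
    proof -
      have "(\<Sum>m<M. p (X m) w y * ind m X y) \<le> (\<Sum>m<M. (p (X m) w y)\<^sup>2 / (2 * l) + (l / 2) * ind m X y)"
      proof (rule sum_mono)
        fix m
        have "0 \<le> (p (X m) w y - l)\<^sup>2" by simp
        then have "p (X m) w y \<le> (p (X m) w y)\<^sup>2 / (2 * l) + l / 2" using l by (simp add: field_simps power2_eq_square)
        then show "p (X m) w y * ind m X y \<le> (p (X m) w y)\<^sup>2 / (2 * l) + (l / 2) * ind m X y"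
          using l by (auto simp: ind_def)
      qed
      also have "\<dots> = (\<Sum>m<M. (p (X m) w y)\<^sup>2) / (2 * l) + (l / 2) * (\<Sum>m<M. ind m X y)"
        by (simp add: sum.distrib sum_divide_distrib sum_distrib_left)
      also have "(\<Sum>m<M. ind m X y) \<le> 1" unfolding ind_def by (subst sum.delta') auto
      finally show ?thesis using l by (simp add: mult_left_le)
    qed
    then have "(\<integral>\<^sup>+X. (\<Sum>m<M. ennreal (p (X m) w y * ind m X y)) \<partial>?CB) \<le>
      (\<integral>\<^sup>+X. ennreal (1 / (2 * l)) * (\<Sum>m<M. ennreal ((p (X m) w y)\<^sup>2)) + ennreal (l / 2) \<partial>?CB)"
      using l p0 by (intro nn_integral_mono)
        (auto simp: sum_ennreal ind_def ennreal_mult[symmetric] ennreal_plus[symmetric] sum_nonneg simp del: ennreal_plus intro!: ennreal_leI)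
    also have "\<dots> = ennreal (1 / (2 * l)) * (\<Sum>m<M. ?J m w y) + ennreal (l / 2)"
    proof -
      have sqm: "(\<lambda>X. ennreal ((p (X m) w y)\<^sup>2)) \<in> borel_measurable ?CB" if "m \<in> {..<M}" for m
      proof -
        have [measurable]: "(\<lambda>X. p (X m) w y) \<in> borel_measurable ?CB" using that by (intro pmX) simp
        show ?thesis by measurable
      qed
      have sm: "(\<lambda>X. \<Sum>m<M. ennreal ((p (X m) w y)\<^sup>2)) \<in> borel_measurable ?CB" by (rule borel_measurable_sum) (rule sqm)
      have "(\<integral>\<^sup>+X. (\<Sum>m<M. ennreal ((p (X m) w y)\<^sup>2)) \<partial>?CB) = (\<Sum>m<M. ?J m w y)" by (rule nn_integral_sum) (rule sqm)
      with sm show ?thesis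
        by (simp add: nn_integral_add nn_integral_cmult CB.emeasure_space_1 del: sum_ennreal)
    qed
    also have "(\<Sum>m<M. ?J m w y) = ennreal (real M * F w y)"
      using F[of w y] by (simp add: marg ennreal_mult ennreal_of_nat_eq_real_of_nat)
    also have "real M * F w y = l\<^sup>2" using F[of w y] M by (simp add: l_def \<Lambda>_def)
    also have "ennreal (1 / (2 * l)) * ennreal (l\<^sup>2) + ennreal (l / 2) = ennreal l"
      using l by (simp add: ennreal_mult[symmetric] ennreal_plus[symmetric] power2_eq_square del: ennreal_plus)
    finally show ?thesis unfolding l_def .
  qed
  \<comment> \<open>Translation invariance of Lebesgue measure removes the relay noise, so the value
    is the same for every \<open>w\<close>.\<close>
  have sqrtF: "(\<integral>\<^sup>+y. ennreal (\<Lambda> w y) \<partial>Y) = ennreal (sqrt (real M * frame_dets N L E sv g h \<beta>))" for w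
  proof -
    define f where "f q y1 y2 = ennreal (sqrt (G w (fst q) (snd q) y1 y2))" for q y1 y2
    have sp: "sqrt (\<Prod>q\<in>A. u q) = (\<Prod>q\<in>A. sqrt (u q))" for u :: "nat \<times> nat \<Rightarrow> real" and A
      by (induction A rule: infinite_finite_induct) (auto simp: real_sqrt_mult)
    have fm': "case_prod (f q) \<in> borel_measurable (borel \<Otimes>\<^sub>M borel)" for q unfolding f_def G_def by measurable
    have "ennreal (\<Lambda> w y) = ennreal (sqrt (real M)) * (\<Prod>(k, i)\<in>frames N L. f (k, i) (y (k, i, 1)) (y (k, i, 2)))" for y
      unfolding \<Lambda>_def F_def f_def case_prod_unfold real_sqrt_mult sp
      using G by (subst prod_ennreal) (auto simp: less_imp_le ennreal_mult prod_nonneg)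
    moreover have "(\<lambda>y. \<Prod>(k, i)\<in>frames N L. f (k, i) (y (k, i, 1)) (y (k, i, 2))) \<in> borel_measurable Y"
    proof -
      have "(\<lambda>y. f (k, i) (y (k, i, 1)) (y (k, i, 2))) \<in> borel_measurable Y" if "(k, i) \<in> frames N L" for k i
        using measurable_compose[OF measurable_Pair[OF measurable_component_lborel[OF frames_slotsD(1)[OF that]]
            measurable_component_lborel[OF frames_slotsD(2)[OF that]]] fm'[of "(k, i)"]]
        unfolding Y_def by simp
      then show ?thesis by (intro borel_measurable_prod_ennreal) (auto split: prod.splits)
    qed
    ultimately have "(\<integral>\<^sup>+y. ennreal (\<Lambda> w y) \<partial>Y) = ennreal (sqrt (real M)) *
      (\<integral>\<^sup>+y. (\<Prod>(k, i)\<in>frames N L. f (k, i) (y (k, i, 1)) (y (k, i, 2))) \<partial>Y)"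
      by (simp add: nn_integral_cmult)
    also have "(\<integral>\<^sup>+y. (\<Prod>(k, i)\<in>frames N L. f (k, i) (y (k, i, 1)) (y (k, i, 2))) \<partial>Y) =
      (\<Prod>q\<in>frames N L. \<integral>\<^sup>+y1. \<integral>\<^sup>+y2. f q y1 y2 \<partial>lborel \<partial>lborel)"
      unfolding Y_def slots_eq_frame_slots
      by (rule nn_integral_frame_slots) (auto simp: lborel.sigma_finite_measure_axioms fm')
    also have "\<dots> = (\<Prod>q\<in>frames N L. ennreal (sqrt (d (snd q))))"
      unfolding f_def G_def d_def by (intro prod.cong refl nn_integral_sqrt_frame E sv)
    also have "\<dots> = ennreal (sqrt (\<Prod>q\<in>frames N L. d (snd q)))"
      unfolding sp using d by (subst prod_ennreal) (auto intro: order.trans[OF zero_le_one])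
    also have "(\<Prod>q\<in>frames N L. d (snd q)) = frame_dets N L E sv g h \<beta>"
      unfolding frame_dets_def d_def c_def \<gamma>_def by (simp add: case_prod_unfold)
    finally show ?thesis by (simp add: ennreal_mult'[symmetric] real_sqrt_mult)
  qed
  have "(\<Sum>m<M. cond_correct N L M E sw sv g h \<beta> m) = (\<Sum>m<M. \<integral>\<^sup>+\<omega>. ?f m (fst \<omega>) (snd \<omega>) \<partial>?K)"
  proof (rule sum.cong[OF refl])
    fix m assume "m \<in> {..<M}"
    then show "cond_correct N L M E sw sv g h \<beta> m = (\<integral>\<^sup>+\<omega>. ?f m (fst \<omega>) (snd \<omega>) \<partial>?K)"
      using sigma_finite_measure.nn_integral_fst[OF pair_sigma_finite.axioms(2)[OF CWY.pair_sigma_finite_axioms] fm[of m]] cc[of m] by simp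
  qed
  also have "\<dots> = (\<integral>\<^sup>+\<omega>. (\<Sum>m<M. ?f m (fst \<omega>) (snd \<omega>)) \<partial>?K)" by (rule nn_integral_sum[symmetric]) (use fm in auto)
  also have "\<dots> = (\<integral>\<^sup>+\<eta>. \<integral>\<^sup>+X. (\<Sum>m<M. ?f m X \<eta>) \<partial>?CB \<partial>?B)"
    by (subst CWY.nn_integral_snd[symmetric]) (use fm in \<open>auto simp: case_prod_unfold intro!: borel_measurable_sum\<close>)
  also have "\<dots> \<le> (\<integral>\<^sup>+\<eta>. ennreal (\<Lambda> (fst \<eta>) (snd \<eta>)) \<partial>?B)"
    by (rule nn_integral_mono) (auto simp: space_pair_measure intro!: inner)
  also have "\<dots> = (\<integral>\<^sup>+w. \<integral>\<^sup>+y. ennreal (\<Lambda> w y) \<partial>Y \<partial>relay_noise N L sw)"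
  proof -
    have "(\<lambda>\<eta>. G (fst \<eta>) k i (snd \<eta> (k, i, 1)) (snd \<eta> (k, i, 2))) \<in> borel_measurable ?B" if q: "(k, i) \<in> frames N L" for k i
    proof -
      note q' = frames_slotsD[OF q]
      have [measurable]: "(\<lambda>\<eta>. fst \<eta> (k, i)) \<in> borel_measurable ?B"
        "(\<lambda>\<eta>. snd \<eta> (k, i, 1)) \<in> borel_measurable ?B" "(\<lambda>\<eta>. snd \<eta> (k, i, 2)) \<in> borel_measurable ?B"
        unfolding relay_noise_def Y_def using q q'
        by (auto intro!: measurable_compose[OF measurable_fst] measurable_compose[OF measurable_snd]
            measurable_component_cnormal measurable_component_lborel)
      show ?thesis unfolding G_def by measurable
    qed
    then have "(\<lambda>\<eta>. ennreal (\<Lambda> (fst \<eta>) (snd \<eta>))) \<in> borel_measurable ?B" unfolding \<Lambda>_def F_def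
      by (intro measurable_compose[OF _ measurable_ennreal] borel_measurable_sqrt borel_measurable_times borel_measurable_prod)
         (auto split: prod.splits)
    from Y.nn_integral_fst[OF this] show ?thesis by simp
  qed
  also have "\<dots> = ennreal (sqrt (real M * frame_dets N L E sv g h \<beta>))" by (simp add: sqrtF W.emeasure_space_1)
  finally show ?thesis .
qed

section \<open>Fading averages\<close>

abbreviation disc :: "real \<Rightarrow> complex set" where
  "disc t \<equiv> {z. sqmod z \<le> t}"

text \<open>A square of side \<open>2 * sqrt t\<close> contains the disc, and the density is at most
  \<open>1 / pi \<le> 1 / 2\<close>. Only the order in \<open>t\<close> matters, so squares replace
  polar coordinates.\<close>

lemma cnormal_disc_le:
  assumes t: "t \<ge> 0"
  shows "emeasure (cnormal 1) (disc t) \<le> ennreal (2 * t)"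
proof -
  define a where "a = Complex (- sqrt t) (- sqrt t)"
  define b where "b = Complex (sqrt t) (sqrt t)"
  have sub: "(disc t) \<subseteq> cbox a b"
  proof
    fix z assume "z \<in> (disc t)"
    then have "cmod z \<le> sqrt t" by (simp add: real_le_rsqrt)
    with abs_Re_le_cmod[of z] abs_Im_le_cmod[of z] have "\<bar>Re z\<bar> \<le> sqrt t" "\<bar>Im z\<bar> \<le> sqrt t" by linarith+
    then show "z \<in> cbox a b" by (auto simp: a_def b_def in_cbox_complex_iff)
  qed
  have "emeasure (cnormal 1) (disc t) = (\<integral>\<^sup>+z. ennreal (cnormal_density 1 z) * indicator (disc t) z \<partial>lborel)"
    unfolding cnormal_def by (rule emeasure_density) measurable
  also have "\<dots> \<le> (\<integral>\<^sup>+z. ennreal (1 / 2) * indicator (cbox a b) z \<partial>lborel)"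
  proof (rule nn_integral_mono)
    fix z
    have "exp (- sqmod z) * 2 \<le> 1 * pi" by (intro mult_mono) (use pi_ge_two in auto)
    then have "cnormal_density 1 z \<le> 1 / 2" by (simp add: cnormal_density_def field_simps)
    then have "ennreal (cnormal_density 1 z) \<le> ennreal (1 / 2)" by (rule ennreal_leI)
    then show "ennreal (cnormal_density 1 z) * indicator (disc t) z \<le> ennreal (1 / 2) * indicator (cbox a b) z"
      using sub by (auto simp: indicator_def)
  qed
  also have "\<dots> = ennreal (1 / 2) * emeasure lborel (cbox a b)" by (subst nn_integral_cmult_indicator) auto
  also have "emeasure lborel (cbox a b) = ennreal (4 * t)"
    using t by (subst emeasure_lborel_cbox_eq) (auto simp: a_def b_def Basis_complex_def inner_complex_def)
  also have "ennreal (1 / 2) * ennreal (4 * t) = ennreal (2 * t)" using t by (subst ennreal_mult[symmetric]) auto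
  finally show ?thesis .
qed

text \<open>The inscribed square has area \<open>2 * t\<close>, and on it the density is at least
  \<open>exp (- 1) / pi \<ge> 1 / 12\<close>.\<close>

lemma cnormal_disc_ge:
  assumes t: "0 \<le> t" "t \<le> 1"
  shows "ennreal (t / 6) \<le> emeasure (cnormal 1) (disc t)"
proof -
  define a where "a = Complex (- sqrt (t / 2)) (- sqrt (t / 2))"
  define b where "b = Complex (sqrt (t / 2)) (sqrt (t / 2))"
  have sub: "cbox a b \<subseteq> (disc t)"
  proof
    fix z assume "z \<in> cbox a b"
    then have "\<bar>Re z\<bar> \<le> sqrt (t / 2)" "\<bar>Im z\<bar> \<le> sqrt (t / 2)" by (auto simp: a_def b_def in_cbox_complex_iff)
    then have "(Re z)\<^sup>2 \<le> (sqrt (t / 2))\<^sup>2" "(Im z)\<^sup>2 \<le> (sqrt (t / 2))\<^sup>2" by (metis abs_ge_zero power2_abs power_mono)+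
    then show "z \<in> (disc t)" using t by (simp add: cmod_power2)
  qed
  have "ennreal (t / 6) = ennreal (1 / 12) * emeasure lborel (cbox a b)" using t by (subst emeasure_lborel_cbox_eq)
      (auto simp: a_def b_def Basis_complex_def inner_complex_def ennreal_mult[symmetric] real_sqrt_mult[symmetric])
  also have "\<dots> = (\<integral>\<^sup>+z. ennreal (1 / 12) * indicator (cbox a b) z \<partial>lborel)" by (subst nn_integral_cmult_indicator) auto
  also have "\<dots> \<le> (\<integral>\<^sup>+z. ennreal (cnormal_density 1 z) * indicator (disc t) z \<partial>lborel)"
  proof (rule nn_integral_mono)
    fix z
    have "ennreal (1 / 12) \<le> ennreal (cnormal_density 1 z)" if "z \<in> cbox a b"
    proof -
      have "sqmod z \<le> 1" using that sub t by force
      then have "exp (- 1) \<le> exp (- sqmod z)" by simp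
      moreover have "1 / 3 \<le> exp (- 1 :: real)" using exp_le by (simp add: exp_minus field_simps)
      ultimately have "1 / 3 \<le> exp (- sqmod z)" by linarith
      then have "1 / 12 \<le> cnormal_density 1 z" using pi_less_4 by (simp add: cnormal_density_def field_simps)
      then show ?thesis by (rule ennreal_leI)
    qed
    then show "ennreal (1 / 12) * indicator (cbox a b) z \<le> ennreal (cnormal_density 1 z) * indicator (disc t) z"
      using sub by (auto simp: indicator_def)
  qed
  also have "\<dots> = emeasure (cnormal 1) (disc t)" unfolding cnormal_def by (rule emeasure_density[symmetric]) measurable
  finally show ?thesis .
qed

text \<open>Dyadic layers: if \<open>(1 / 2) ^ Suc k < a \<le> (1 / 2) ^ k\<close>, the term with
  index \<open>k\<close> alone is at least the left side. This turns a negative moment into a series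
  of probabilities of small discs.\<close>

lemma powr_neg_le_dyadic:
  fixes a u :: real
  assumes a: "0 < a" and u: "0 \<le> u"
  shows "ennreal (a powr - u) \<le> 1 + (\<Sum>k. ennreal ((2 powr u) ^ Suc k) * indicator {..(1 / 2) ^ k} a)"
proof (cases "a \<le> 1")
  case False
  then have "a powr - u \<le> a powr 0" using u by (intro powr_mono) auto
  then have "ennreal (a powr - u) \<le> 1" using a by simp
  then show ?thesis by (rule order.trans) simp
next
  case True
  define n where "n = (LEAST n. (1 / 2) ^ n < a)"
  obtain n0 where "(1 / 2 :: real) ^ n0 < a" using real_arch_pow_inv[OF a, of "1 / 2"] by auto
  then have n: "(1 / 2) ^ n < a" unfolding n_def by (rule LeastI)
  then obtain k where k: "n = Suc k" using True by (cases n) auto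
  have le: "a \<le> (1 / 2) ^ k" using not_less_Least[of k "\<lambda>n. (1 / 2) ^ n < a"] k unfolding n_def[symmetric] by simp
  have "a powr - u \<le> ((1 / 2) ^ Suc k) powr - u" using n k a u by (intro powr_mono2') auto
  also have "((1 / 2) ^ Suc k :: real) = 2 powr - real (Suc k)"
    by (simp add: powr_minus powr_realpow power_one_over inverse_eq_divide del: of_nat_Suc power_Suc)
  also have "(2 powr - real (Suc k)) powr - u = (2 powr u) powr real (Suc k)"
    by (simp add: powr_powr mult.commute del: of_nat_Suc)
  also have "\<dots> = (2 powr u) ^ Suc k" by (rule powr_realpow) simp
  finally have le': "a powr - u \<le> (2 powr u) ^ Suc k" .
  define f where "f k = ennreal ((2 powr u) ^ Suc k) * indicator {..(1 / 2) ^ k} a" for k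
  have "ennreal (a powr - u) \<le> f k" using le ennreal_leI[OF le'] by (simp add: f_def del: power_Suc)
  also have "\<dots> \<le> suminf f" using sum_le_suminf[of f "{k}"] by simp
  finally show ?thesis unfolding f_def by (rule order.trans) simp
qed

text \<open>Layer \<open>k\<close> contributes a multiple of \<open>c ^ k\<close> times a disc
  probability of order \<open>(1 / 2) ^ k\<close>. The geometric series converges because
  \<open>c = 2 powr u < 2\<close>, which is where \<open>u < 1\<close> enters.\<close>

lemma cnormal_negative_moment_finite:
  assumes u: "0 \<le> u" "u < 1"
  shows "(\<integral>\<^sup>+z. ennreal (sqmod z powr - u) \<partial>cnormal 1) < \<infinity>"
proof -
  interpret prob_space "cnormal 1" by (rule prob_space_cnormal) simp
  define c where "c = (2::real) powr u"
  have c: "0 < c" "c < 2" using u powr_less_mono[of u 1 2] by (auto simp: c_def)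
  let ?S = "\<lambda>z. \<Sum>k. ennreal (c ^ Suc k) * indicator (disc ((1 / 2) ^ k)) z"
  have "(\<integral>\<^sup>+z. ennreal (sqmod z powr - u) \<partial>cnormal 1) \<le> (\<integral>\<^sup>+z. 1 + ?S z \<partial>cnormal 1)"
  proof (rule nn_integral_mono)
    fix z :: complex
    show "ennreal (sqmod z powr - u) \<le> 1 + ?S z"
    \<comment> \<open>The value of \<open>0 powr - u\<close> is 0, so the bound holds at the
      singular point too.\<close>
    proof (cases "z = 0")
      case False
      have "indicator (disc t) z = (indicator {..t} (sqmod z) :: ennreal)" for t by (simp add: indicator_def)
      moreover have "0 < sqmod z" using False by simp
      ultimately show ?thesis using powr_neg_le_dyadic[of "sqmod z" u] u(1) unfolding c_def by presburger
    qed simp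
  qed
  also have "\<dots> = 1 + (\<Sum>k. ennreal (c ^ Suc k) * emeasure (cnormal 1) (disc ((1 / 2) ^ k)))"
  proof -
    have m: "(\<lambda>z. ennreal (c ^ Suc k) * indicator (disc ((1 / 2) ^ k)) z) \<in> borel_measurable borel" for k by measurable
    have i: "(\<integral>\<^sup>+z. ennreal (c ^ Suc k) * indicator (disc ((1 / 2) ^ k)) z \<partial>cnormal 1) =
       ennreal (c ^ Suc k) * emeasure (cnormal 1) (disc ((1 / 2) ^ k))" for k
      by (rule nn_integral_cmult_indicator) (simp, measurable)
    have "(\<integral>\<^sup>+z. 1 + ?S z \<partial>cnormal 1) = (\<integral>\<^sup>+z. 1 \<partial>cnormal 1) + (\<integral>\<^sup>+z. ?S z \<partial>cnormal 1)"
      by (rule nn_integral_add) (use m in \<open>auto intro!: borel_measurable_suminf_order\<close>)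
    also have "(\<integral>\<^sup>+z. ?S z \<partial>cnormal 1) = (\<Sum>k. ennreal (c ^ Suc k) * emeasure (cnormal 1) (disc ((1 / 2) ^ k)))"
      unfolding i[symmetric] by (rule nn_integral_suminf) (use m in simp)
    finally show ?thesis using emeasure_space_1 by simp
  qed
  also have "\<dots> \<le> 1 + (\<Sum>k. ennreal (2 * c * (c / 2) ^ k))"
  proof (intro add_left_mono suminf_le)
    fix k
    have "ennreal (c ^ Suc k) * emeasure (cnormal 1) (disc ((1 / 2) ^ k)) \<le> ennreal (c ^ Suc k) * ennreal (2 * (1 / 2) ^ k)"
      by (intro mult_left_mono cnormal_disc_le) auto
    also have "\<dots> = ennreal (2 * c * (c / 2) ^ k)" using c by (simp add: ennreal_mult[symmetric] power_divide)
    finally show "ennreal (c ^ Suc k) * emeasure (cnormal 1) (disc ((1 / 2) ^ k)) \<le> ennreal (2 * c * (c / 2) ^ k)" .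
  qed auto
  also have "\<dots> < \<infinity>"
  proof -
    have "summable (\<lambda>k. 2 * c * (c / 2) ^ k)" using c by (intro summable_mult summable_geometric) auto
    then have "(\<Sum>k. ennreal (2 * c * (c / 2) ^ k)) = ennreal (\<Sum>k. 2 * c * (c / 2) ^ k)"
      using c by (intro suminf_ennreal2) auto
    then show ?thesis by simp
  qed
  finally show ?thesis .
qed

section \<open>Weighted moments of the fading gains\<close>

lemma AE_cnormal_neq_0: "AE z in cnormal s. z \<noteq> 0"
  unfolding cnormal_def
  by (subst AE_density) (auto intro: AE_mp[OF AE_lborel_singleton[of 0]])

text \<open>The squared factor pays for the forwarded relay noise: with \<open>\<kappa>\<close> the
  ratio of destination to relay noise variance, the noise grows by a factor of at most
  \<open>1 + sqmod z / \<kappa>\<close>, which is later raised to a power of at most 2.\<close>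

abbreviation fade_weight :: "real \<Rightarrow> real \<Rightarrow> real \<Rightarrow> complex \<Rightarrow> real" where
  "fade_weight \<kappa> u x z \<equiv> (1 + sqmod z / \<kappa>)\<^sup>2 * (1 + x * sqmod z) powr - u"

abbreviation relay_weight :: "real \<Rightarrow> real \<Rightarrow> real \<Rightarrow> complex \<Rightarrow> complex \<Rightarrow> real" where
  "relay_weight \<kappa> w x z z' \<equiv> (1 + sqmod z / \<kappa>)\<^sup>2 * (1 + x * (sqmod z * sqmod z' / (1 + sqmod z'))) powr - w"

text \<open>Split at \<open>sqmod z = 1\<close>. Inside, the weight is at most \<open>D\<close> and
  the negative moment is finite; outside, the negative power is at most 1 and the Gaussian tail
  beats the weight.\<close>

lemma cnormal_weighted_bound:
  assumes u: "0 \<le> u" "u < 1" and \<kappa>: "\<kappa> > 0"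
  shows "\<exists>K>0. \<forall>x>0. (\<integral>\<^sup>+z. ennreal (fade_weight \<kappa> u x z) \<partial>cnormal 1) \<le> ennreal (K * x powr - u)"
proof -
  define J where "J = (\<integral>\<^sup>+z. ennreal (sqmod z powr - u) \<partial>cnormal 1)"
  have J: "J < \<infinity>" unfolding J_def by (rule cnormal_negative_moment_finite[OF u])
  \<comment> \<open>From \<open>(1 + q) ^ 2 \<le> 2 + 2 * q ^ 2\<close> and
    \<open>A ^ 2 / 8 \<le> exp (A / 2)\<close>. The exponent \<open>A / 2\<close> is half of the
    Gaussian one, so \<open>exp (A / 2)\<close> still has a finite mean, namely 2.\<close>
  define C where "C = 2 + 16 / \<kappa>\<^sup>2"
  define D where "D = (1 + 1 / \<kappa>)\<^sup>2"
  have C: "C > 0" and D: "D \<ge> 0" using \<kappa> by (auto simp: C_def D_def add_pos_nonneg)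
  have wt: "(1 + A / \<kappa>)\<^sup>2 \<le> C * exp (A / 2)" if "A \<ge> 0" for A
  proof -
    have "1 + A / 2 + (A / 2)\<^sup>2 / 2 \<le> exp (A / 2)" by (rule exp_lower_Taylor_quadratic) (use that in simp)
    then have e: "A\<^sup>2 / 8 \<le> exp (A / 2)" "1 \<le> exp (A / 2)" using that by (auto simp: power2_eq_square)
    have "(1 + q)\<^sup>2 \<le> 2 + 2 * q\<^sup>2" for q :: real
      using zero_le_power2[of "1 - q"] by (simp add: power2_eq_square algebra_simps)
    then have "(1 + A / \<kappa>)\<^sup>2 \<le> 2 + 2 * (A / \<kappa>)\<^sup>2" .
    also have "\<dots> = 2 * 1 + 16 / \<kappa>\<^sup>2 * (A\<^sup>2 / 8)" by (simp add: power_divide)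
    also have "\<dots> \<le> 2 * exp (A / 2) + 16 / \<kappa>\<^sup>2 * exp (A / 2)" using e by (intro add_mono mult_left_mono) auto
    finally show ?thesis by (simp add: C_def algebra_simps)
  qed
  define K' where "K' = ennreal D * J + ennreal (2 * C)"
  have K': "K' < \<infinity>" using J by (simp add: K'_def ennreal_mult_less_top)
  define K where "K = enn2real K' + 1"
  have "(\<integral>\<^sup>+z. ennreal (fade_weight \<kappa> u x z) \<partial>cnormal 1) \<le> ennreal (K * x powr - u)"
    if x: "x > 0" for x
  proof -
    have pt: "ennreal (fade_weight \<kappa> u x z) \<le>
        ennreal (x powr - u) * (ennreal D * ennreal (sqmod z powr - u) + ennreal C * ennreal (exp (2 * Re (cnj 0 * z) - (- 1 / 2) * sqmod z)))"
      if "z \<noteq> 0" for z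
    proof -
      define A where "A = sqmod z"
      have A: "A > 0" using that by (simp add: A_def)
      have "(1 + x * A) powr - u \<le> (x * A) powr - u" using A x u by (intro powr_mono2') auto
      also have "\<dots> = x powr - u * A powr - u" using A x by (simp add: powr_mult)
      finally have 1: "(1 + x * A) powr - u \<le> x powr - u * A powr - u" .
      have 2: "(1 + A / \<kappa>)\<^sup>2 * A powr - u \<le> D * A powr - u + C * exp (A / 2)"
      proof (cases "A \<le> 1")
        case True
        then have "(1 + A / \<kappa>)\<^sup>2 \<le> D" unfolding D_def using A \<kappa> by (intro power_mono) (auto simp: divide_right_mono)
        then have "(1 + A / \<kappa>)\<^sup>2 * A powr - u \<le> D * A powr - u" by (rule mult_right_mono) simp
        then show ?thesis using C by (simp add: add_increasing2)
      next
        case False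
        then have "A powr - u \<le> A powr 0" using u by (intro powr_mono) auto
        then have "A powr - u \<le> 1" using A by simp
        then have "(1 + A / \<kappa>)\<^sup>2 * A powr - u \<le> (1 + A / \<kappa>)\<^sup>2" by (simp add: mult_left_le)
        also have "\<dots> \<le> C * exp (A / 2)" using wt A by simp
        finally show ?thesis using D by (simp add: add_increasing)
      qed
      have "(1 + A / \<kappa>)\<^sup>2 * (1 + x * A) powr - u \<le> (1 + A / \<kappa>)\<^sup>2 * (x powr - u * A powr - u)"
        using 1 by (intro mult_left_mono) auto
      also have "\<dots> = x powr - u * ((1 + A / \<kappa>)\<^sup>2 * A powr - u)" by simp
      also have "\<dots> \<le> x powr - u * (D * A powr - u + C * exp (A / 2))" using 2 by (intro mult_left_mono) auto
      finally have "ennreal ((1 + A / \<kappa>)\<^sup>2 * (1 + x * A) powr - u) \<le> ennreal (x powr - u * (D * A powr - u + C * exp (A / 2)))"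
        by (rule ennreal_leI)
      also have "\<dots> = ennreal (x powr - u) * (ennreal D * ennreal (A powr - u) + ennreal C * ennreal (exp (A / 2)))"
        using C D by (simp add: ennreal_mult)
      finally show ?thesis by (simp add: A_def)
    qed
    have "(\<integral>\<^sup>+z. ennreal (fade_weight \<kappa> u x z) \<partial>cnormal 1) \<le>
      (\<integral>\<^sup>+z. ennreal (x powr - u) * (ennreal D * ennreal (sqmod z powr - u) + ennreal C * ennreal (exp (2 * Re (cnj 0 * z) - (- 1 / 2) * sqmod z))) \<partial>cnormal 1)"
      by (rule nn_integral_mono_AE) (use AE_cnormal_neq_0[of 1] pt in auto)
    also have "\<dots> = ennreal (x powr - u) * (ennreal D * J + ennreal C * (\<integral>\<^sup>+z. ennreal (exp (2 * Re (cnj 0 * z) - (- 1 / 2) * sqmod z)) \<partial>cnormal 1))"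
      unfolding J_def by (subst nn_integral_cmult, simp, subst nn_integral_add) (simp_all add: nn_integral_cmult)
    also have "(\<integral>\<^sup>+z. ennreal (exp (2 * Re (cnj 0 * z) - (- 1 / 2) * sqmod z)) \<partial>cnormal 1) = ennreal 2"
      by (subst cnormal_exp_quadratic) auto
    also have "ennreal (x powr - u) * (ennreal D * J + ennreal C * ennreal 2) = ennreal (x powr - u) * K'"
      using C by (simp add: K'_def ennreal_mult[symmetric] mult.commute del: ennreal_numeral)
    also have "K' = ennreal (enn2real K')" using K' by simp
    also have "ennreal (x powr - u) * ennreal (enn2real K') \<le> ennreal (x powr - u) * ennreal K"
      unfolding K_def by (intro mult_left_mono ennreal_leI) auto
    also have "\<dots> = ennreal (K * x powr - u)" by (subst ennreal_mult[symmetric]) (auto simp: K_def mult.commute)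
    finally show ?thesis .
  qed
  moreover have "K > 0" by (simp add: K_def add_nonneg_pos)
  ultimately show ?thesis by blast
qed

text \<open>For a fixed source-relay gain the two-hop path is a single fading gain with
  \<open>x\<close> scaled by \<open>y = B / (1 + B)\<close>. Since \<open>y\<close> is at least half
  the minimum of \<open>B\<close> and 1, the cost \<open>y powr - w\<close> again has a finite mean:
  the second hop loses no power of \<open>x\<close>.\<close>

lemma cnormal_relay_bound:
  assumes w: "0 \<le> w" "w < 1" and \<kappa>: "\<kappa> > 0"
  shows "\<exists>K>0. \<forall>x>0. (\<integral>\<^sup>+z'. \<integral>\<^sup>+z. ennreal (relay_weight \<kappa> w x z z') \<partial>cnormal 1 \<partial>cnormal 1) \<le> ennreal (K * x powr - w)"
proof -
  interpret prob_space "cnormal 1" by (rule prob_space_cnormal) simp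
  obtain K where K: "K > 0" and Kb: "\<And>x. x > 0 \<Longrightarrow> (\<integral>\<^sup>+z. ennreal (fade_weight \<kappa> w x z) \<partial>cnormal 1) \<le> ennreal (K * x powr - w)"
    using cnormal_weighted_bound[OF w \<kappa>] by blast
  define J where "J = (\<integral>\<^sup>+z. ennreal (sqmod z powr - w) \<partial>cnormal 1)"
  have J: "J < \<infinity>" unfolding J_def by (rule cnormal_negative_moment_finite[OF w])
  define H where "H = 2 + 2 * J"
  have H: "H < \<infinity>" using J by (simp add: H_def ennreal_mult_less_top)
  define K2 where "K2 = K * (enn2real H + 1)"
  have K2: "K2 > 0" unfolding K2_def using K by (intro mult_pos_pos add_nonneg_pos) auto
  have "(\<integral>\<^sup>+z'. \<integral>\<^sup>+z. ennreal (relay_weight \<kappa> w x z z') \<partial>cnormal 1 \<partial>cnormal 1) \<le> ennreal (K2 * x powr - w)"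
    if x: "x > 0" for x
  proof -
    have pt: "(\<integral>\<^sup>+z. ennreal (relay_weight \<kappa> w x z z') \<partial>cnormal 1)
       \<le> ennreal (K * x powr - w) * (2 + 2 * ennreal (sqmod z' powr - w))" if "z' \<noteq> 0" for z'
    proof -
      define B where "B = sqmod z'"
      have B: "B > 0" using that by (simp add: B_def)
      define y where "y = B / (1 + B)"
      have y: "y > 0" using B by (simp add: y_def)
      have "y powr - w \<le> 2 + 2 * B powr - w"
      proof (cases "B \<le> 1")
        case True
        then have "B / 2 \<le> y" using B by (simp add: y_def field_simps)
        then have "y powr - w \<le> (B / 2) powr - w" using B w by (intro powr_mono2') auto
        also have "\<dots> = B powr - w * 2 powr w" using B by (simp add: powr_divide powr_minus_divide)
        also have "\<dots> \<le> B powr - w * 2 powr 1" using w by (intro mult_left_mono powr_mono) auto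
        finally show ?thesis by simp
      next
        case False
        then have "1 / 2 \<le> y" by (simp add: y_def field_simps)
        then have "y powr - w \<le> (1 / 2) powr - w" using w by (intro powr_mono2') auto
        also have "\<dots> = 2 powr w" by (simp add: powr_divide powr_minus_divide)
        also have "\<dots> \<le> 2 powr 1" using w by (intro powr_mono) auto
        finally show ?thesis by (simp add: add_increasing2)
      qed
      then have "ennreal (y powr - w) \<le> ennreal (2 + 2 * B powr - w)" by (rule ennreal_leI)
      also have "\<dots> = 2 + 2 * ennreal (B powr - w)" by (simp add: ennreal_mult)
      finally have yb: "ennreal (y powr - w) \<le> 2 + 2 * ennreal (B powr - w)" .
      have e: "x * (sqmod z * sqmod z' / (1 + sqmod z')) = (x * y) * sqmod z" for z by (simp add: y_def B_def)
      have "(\<integral>\<^sup>+z. ennreal (relay_weight \<kappa> w x z z') \<partial>cnormal 1) \<le> ennreal (K * (x * y) powr - w)"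
        unfolding e by (rule Kb) (use x y in simp)
      also have "\<dots> = ennreal (K * x powr - w) * ennreal (y powr - w)"
        using K x y by (simp add: powr_mult ennreal_mult[symmetric] mult.assoc)
      also have "\<dots> \<le> ennreal (K * x powr - w) * (2 + 2 * ennreal (B powr - w))" using yb by (rule mult_left_mono) simp
      finally show ?thesis by (simp add: B_def)
    qed
    have "(\<integral>\<^sup>+z'. \<integral>\<^sup>+z. ennreal (relay_weight \<kappa> w x z z') \<partial>cnormal 1 \<partial>cnormal 1) \<le>
      (\<integral>\<^sup>+z'. ennreal (K * x powr - w) * (2 + 2 * ennreal (sqmod z' powr - w)) \<partial>cnormal 1)"
      by (rule nn_integral_mono_AE) (use AE_cnormal_neq_0[of 1] pt in auto)
    also have "\<dots> = ennreal (K * x powr - w) * (2 * 1 + 2 * J)" unfolding J_def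
      by (subst nn_integral_cmult, simp, subst nn_integral_add)
        (simp_all add: nn_integral_cmult emeasure_space_1[simplified])
    also have "\<dots> = ennreal (K * x powr - w) * ennreal (enn2real H)" using H by (simp add: H_def)
    also have "\<dots> \<le> ennreal (K * x powr - w) * ennreal (enn2real H + 1)" by (intro mult_left_mono ennreal_leI) auto
    also have "\<dots> = ennreal (K2 * x powr - w)" using K by (subst ennreal_mult[symmetric]) (auto simp: K2_def mult_ac)
    finally show ?thesis .
  qed
  with K2 show ?thesis by blast
qed

text \<open>The direct gain is the only one shared by all frames; once \<open>f1\<close> isolates
  it, the relays contribute equal independent factors.\<close>

lemma nn_integral_fading_prod:
  fixes f1 :: "complex \<Rightarrow> ennreal" and f2 :: "complex \<Rightarrow> complex \<Rightarrow> ennreal"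
  assumes N: "N \<ge> 1" and [measurable]: "f1 \<in> borel_measurable borel"
    and f2[measurable]: "case_prod f2 \<in> borel_measurable (borel \<Otimes>\<^sub>M borel)"
  shows "(\<integral>\<^sup>+(g, h). f1 (g 1) * (\<Prod>i\<in>{2..N}. f2 (g i) (h i)) \<partial>fading N) =
    (\<integral>\<^sup>+z. f1 z \<partial>cnormal 1) * (\<integral>\<^sup>+z'. \<integral>\<^sup>+z. f2 z z' \<partial>cnormal 1 \<partial>cnormal 1) ^ (N - 1)"
proof -
  interpret C: product_sigma_finite "\<lambda>_. cnormal 1" by (rule product_sigma_finite_cnormal) simp
  interpret C1: sigma_finite_measure "cnormal 1" by (rule sigma_finite_cnormal) simp
  interpret G: prob_space "\<Pi>\<^sub>M i\<in>{1..N}. cnormal 1" by (rule prob_space_PiM_cnormal) simp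
  interpret H: prob_space "\<Pi>\<^sub>M i\<in>{2..N}. cnormal 1" by (rule prob_space_PiM_cnormal) simp
  interpret GH: pair_sigma_finite "\<Pi>\<^sub>M i\<in>{1..N}. cnormal 1" "\<Pi>\<^sub>M i\<in>{2..N}. cnormal 1" ..
  let ?G = "\<Pi>\<^sub>M i\<in>{1..N}. cnormal 1"
  let ?H = "\<Pi>\<^sub>M i\<in>{2..N}. cnormal 1"
  let ?F = "\<lambda>z'. \<integral>\<^sup>+z. f2 z z' \<partial>cnormal 1"
  have ins: "{1..N} = insert 1 {2..N}" using N by auto
  have m: "(\<lambda>\<omega>. f1 (fst \<omega> 1) * (\<Prod>i\<in>{2..N}. f2 (fst \<omega> i) (snd \<omega> i))) \<in> borel_measurable (fading N)"
  proof -
    have c: "(\<lambda>\<omega>. f2 (fst \<omega> i) (snd \<omega> i)) \<in> borel_measurable (fading N)" if "i \<in> {2..N}" for i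
    proof -
      have [measurable]: "(\<lambda>\<omega>. fst \<omega> i) \<in> borel_measurable (fading N)" "(\<lambda>\<omega>. snd \<omega> i) \<in> borel_measurable (fading N)"
        using that by (auto intro!: fading_components)
      show ?thesis by measurable
    qed
    have [measurable]: "(\<lambda>\<omega>. fst \<omega> 1) \<in> borel_measurable (fading N)" using N by (auto intro!: fading_components)
    have "(\<lambda>\<omega>. f1 (fst \<omega> 1)) \<in> borel_measurable (fading N)" by measurable
    then show ?thesis using c by (intro borel_measurable_times_ennreal borel_measurable_prod_ennreal)
  qed
  have "(\<integral>\<^sup>+(g, h). f1 (g 1) * (\<Prod>i\<in>{2..N}. f2 (g i) (h i)) \<partial>fading N) =
    (\<integral>\<^sup>+h. \<integral>\<^sup>+g. f1 (g 1) * (\<Prod>i\<in>{2..N}. f2 (g i) (h i)) \<partial>?G \<partial>?H)"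
    using m unfolding fading_def by (subst GH.nn_integral_snd[symmetric]) (auto simp: case_prod_unfold)
  also have "\<dots> = (\<integral>\<^sup>+h. (\<integral>\<^sup>+z. f1 z \<partial>cnormal 1) * (\<Prod>i\<in>{2..N}. ?F (h i)) \<partial>?H)"
  proof (rule nn_integral_cong)
    fix h :: "nat \<Rightarrow> complex"
    define F where "F i z = (if i = 1 then f1 z else f2 z (h i))" for i z
    have "(\<integral>\<^sup>+g. f1 (g 1) * (\<Prod>i\<in>{2..N}. f2 (g i) (h i)) \<partial>?G) = (\<integral>\<^sup>+g. (\<Prod>i\<in>{1..N}. F i (g i)) \<partial>?G)"
      unfolding ins by (intro nn_integral_cong) (auto simp: F_def intro!: arg_cong2[where f = "(*)"] prod.cong)
    also have "\<dots> = (\<Prod>i\<in>{1..N}. \<integral>\<^sup>+z. F i z \<partial>cnormal 1)"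
    proof (rule C.product_nn_integral_prod)
      fix i show "F i \<in> borel_measurable (cnormal 1)"
        unfolding F_def by (cases "i = 1") (simp_all, measurable)
    qed simp
    also have "\<dots> = (\<integral>\<^sup>+z. f1 z \<partial>cnormal 1) * (\<Prod>i\<in>{2..N}. ?F (h i))"
      unfolding ins by (auto simp: F_def intro!: arg_cong2[where f = "(*)"] prod.cong)
    finally show "(\<integral>\<^sup>+g. f1 (g 1) * (\<Prod>i\<in>{2..N}. f2 (g i) (h i)) \<partial>?G) = \<dots>" .
  qed
  also have "\<dots> = (\<integral>\<^sup>+z. f1 z \<partial>cnormal 1) * (\<integral>\<^sup>+h. (\<Prod>i\<in>{2..N}. ?F (h i)) \<partial>?H)"
  proof (rule nn_integral_cmult)
    have "(\<lambda>h. \<integral>\<^sup>+z. f2 z (h i) \<partial>cnormal 1) \<in> borel_measurable ?H" if "i \<in> {2..N}" for i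
    proof -
      note [measurable] = measurable_component_cnormal[OF that, of 1]
      show ?thesis by measurable
    qed
    then show "(\<lambda>h. \<Prod>i\<in>{2..N}. \<integral>\<^sup>+z. f2 z (h i) \<partial>cnormal 1) \<in> borel_measurable ?H"
      by (intro borel_measurable_prod_ennreal)
  qed
  also have "(\<integral>\<^sup>+h. (\<Prod>i\<in>{2..N}. ?F (h i)) \<partial>?H) = (\<Prod>i\<in>{2..N}. \<integral>\<^sup>+z'. \<integral>\<^sup>+z. f2 z z' \<partial>cnormal 1 \<partial>cnormal 1)"
    by (rule C.product_nn_integral_prod[where f = "\<lambda>i z'. \<integral>\<^sup>+z. f2 z z' \<partial>cnormal 1"]) (simp_all, measurable)
  finally show ?thesis by simp
qed

section \<open>Bounds on the error probability\<close>

text \<open>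
  This gain meets the energy constraint as soon as the relay noise variance is at most \<open>E\<close>. Being at
  most 1, it keeps the amplified relay noise bounded even when the source-relay gain is small.
\<close>

definition naf_gain :: "complex \<Rightarrow> complex" where
  "naf_gain h = complex_of_real (1 / sqrt (1 + sqmod h))"

lemma naf_gain_measurable [measurable]: "naf_gain \<in> borel_measurable borel"
  unfolding naf_gain_def by measurable

lemma cmod_naf_gain: "cmod (naf_gain h) = 1 / sqrt (1 + sqmod h)"
proof -
  have "0 \<le> 1 / sqrt (1 + sqmod h)" by (intro divide_nonneg_nonneg real_sqrt_ge_zero add_nonneg_nonneg) auto
  then show ?thesis unfolding naf_gain_def norm_of_real by (rule abs_of_nonneg)
qed

lemma cmod_naf_gain_power2: "sqmod (naf_gain h) = 1 / (1 + sqmod h)"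
  unfolding cmod_naf_gain power_divide by (simp add: add_nonneg_nonneg)

lemma cmod_fwd_gain:
  "sqmod (fwd_gain g (\<lambda>i. naf_gain (h i)) i) = sqmod (g (i + 1)) / (1 + sqmod (h (i + 1)))"
  "sqmod (fwd_gain g (\<lambda>i. naf_gain (h i)) i * h (i + 1)) = sqmod (g (i + 1)) * sqmod (h (i + 1)) / (1 + sqmod (h (i + 1)))"
  by (simp_all add: fwd_gain_def norm_mult power_mult_distrib cmod_naf_gain_power2)

text \<open>\<open>A\<close> and \<open>B\<close> stand for the squared relay-destination and
  source-relay gains, and \<open>s\<close> is the relative growth of the noise. The direct gain is
  shared by \<open>n\<close> frames and its summand is a square, hence the share
  \<open>u / (2 * n)\<close> per frame. Each lower bound on the determinant is divided by
  \<open>s\<close>; the lost powers of \<open>s\<close> have total exponent at most 2, and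
  \<open>s \<le> 1 + A / \<kappa>\<close> moves them into a weight free of \<open>B\<close>.\<close>

lemma frame_det_powr_le:
  fixes a A B \<kappa> \<rho> sv u w n :: real
  assumes pos: "\<kappa> > 0" "\<rho> > 0" "sv > 0" and nn: "a \<ge> 0" "A \<ge> 0" "B \<ge> 0"
    and u: "0 \<le> u" "u \<le> 1" and w: "0 \<le> w" "w \<le> 1" and n: "n \<ge> 1"
  shows "frame_det (\<rho> * sv) (1 / (4 * sv)) (1 / (4 * (sv + A / (1 + B) * (sv / \<kappa>)))) a (A * B / (1 + B)) powr - (u / (2 * n) + w)
     \<le> (1 + \<rho> / 4 * a) powr - (u / n) * ((1 + A / \<kappa>)\<^sup>2 * (1 + \<rho> / 4 * (A * B / (1 + B))) powr - w)"
proof -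
  define s where "s = 1 + A / (1 + B) / \<kappa>"
  define x where "x = \<rho> / 4"
  define C where "C = A * B / (1 + B)"
  have s1: "s \<ge> 1" using pos nn by (simp add: s_def)
  have x: "x > 0" using pos by (simp add: x_def)
  have C: "C \<ge> 0" using nn by (simp add: C_def)
  have sA: "s \<le> 1 + A / \<kappa>"
  proof -
    have "A / (1 + B) \<le> A" using nn by (simp add: field_simps)
    from divide_right_mono[OF this, of \<kappa>] show ?thesis unfolding s_def using pos by simp
  qed
  have den: "sv + A / (1 + B) * (sv / \<kappa>) = sv * s" using pos by (simp add: s_def field_simps)
  define D where "D = frame_det (\<rho> * sv) (1 / (4 * sv)) (1 / (4 * (sv + A / (1 + B) * (sv / \<kappa>)))) a C"
  have D: "D = (1 + x * a) * (1 + x * a / s) + x * C / s"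
    unfolding D_def frame_det_def den x_def using pos s1 by (simp add: field_simps)
  have p: "1 + x * a \<ge> 1" "1 + x * C \<ge> 1" using x nn C by auto
  have D1: "(1 + x * a)\<^sup>2 / s \<le> D"
  proof -
    have "(1 + x * a) / s \<le> 1 + x * a / s" using s1 by (simp add: add_divide_distrib)
    then have "(1 + x * a) * ((1 + x * a) / s) \<le> (1 + x * a) * (1 + x * a / s)" using p by (intro mult_left_mono) auto
    moreover have "0 \<le> x * C / s" using x C s1 by auto
    ultimately show ?thesis unfolding D power2_eq_square by simp
  qed
  have D2: "(1 + x * C) / s \<le> D"
  proof -
    have "1 * 1 \<le> (1 + x * a) * (1 + x * a / s)" using x nn s1 by (intro mult_mono) auto
    moreover have "1 / s \<le> 1" using s1 by simp
    ultimately show ?thesis unfolding D by (simp add: add_divide_distrib)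
  qed
  have q1: "0 < (1 + x * a)\<^sup>2 / s" and q2: "0 < (1 + x * C) / s" using p s1 by auto
  have "D powr - (u / (2 * n) + w) = D powr - (u / (2 * n)) * D powr - w" by (simp add: powr_add[symmetric])
  also have "\<dots> \<le> ((1 + x * a)\<^sup>2 / s) powr - (u / (2 * n)) * ((1 + x * C) / s) powr - w"
    using D1 D2 q1 q2 u w n by (intro mult_mono powr_mono2') auto
  also have "\<dots> = (1 + x * a) powr - (u / n) * ((s powr (u / (2 * n)) * s powr w) * (1 + x * C) powr - w)"
  proof -
    have "(1 + x * a)\<^sup>2 = (1 + x * a) powr 2" using p by (simp add: powr_numeral)
    then have "((1 + x * a)\<^sup>2) powr - (u / (2 * n)) = (1 + x * a) powr - (u / n)" using n by (simp add: powr_powr)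
    then show ?thesis using p s1 by (simp add: powr_divide powr_minus_divide)
  qed
  also have "s powr (u / (2 * n)) * s powr w = s powr (u / (2 * n) + w)" by (simp add: powr_add)
  also have "(1 + x * a) powr - (u / n) * (s powr (u / (2 * n) + w) * (1 + x * C) powr - w) \<le>
     (1 + x * a) powr - (u / n) * ((1 + A / \<kappa>)\<^sup>2 * (1 + x * C) powr - w)"
  proof (intro mult_left_mono mult_right_mono)
    have "u / (2 * n) \<le> 1" using u n by (simp add: field_simps)
    then have "s powr (u / (2 * n) + w) \<le> s powr 2" using s1 w by (intro powr_mono) auto
    also have "\<dots> = s\<^sup>2" using s1 by (simp add: powr_numeral)
    also have "\<dots> \<le> (1 + A / \<kappa>)\<^sup>2" using s1 sA by (intro power_mono) auto
    finally show "s powr (u / (2 * n) + w) \<le> (1 + A / \<kappa>)\<^sup>2" .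
  qed auto
  finally show ?thesis unfolding D_def C_def x_def .
qed

lemma prod_powr_const:
  fixes f :: "'a \<Rightarrow> real"
  assumes "\<And>i. i \<in> A \<Longrightarrow> f i \<ge> 0"
  shows "(\<Prod>i\<in>A. f i) powr c = (\<Prod>i\<in>A. f i powr c)"
proof (cases "finite A")
  case True
  then show ?thesis using assms by (induction A rule: finite_induct) (auto simp: powr_mult prod_nonneg)
qed simp

text \<open>The constant depends on the noise variances only through \<open>\<kappa>\<close> and not
  on \<open>M\<close>, so all of these may vary with \<rho>.\<close>

lemma naf_error_prob_upper:
  assumes N: "N \<ge> 2" and L: "L \<ge> 2" and \<kappa>: "\<kappa> > 0" and u: "0 \<le> u" "u < 1" and w: "0 \<le> w" "w < 1"
  shows "\<exists>K>0. \<forall>\<rho>>0. \<forall>sv>0. \<forall>M\<ge>1. naf_error_prob N L M (\<rho> * sv) (sv / \<kappa>) sv (\<lambda>_. naf_gain) \<le>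
     K * real M powr ((u / (2 * (real N - 1)) + w) / real L) * \<rho> powr - (u + (real N - 1) * w)"
proof -
  define n where "n = real N - 1"
  have n: "n \<ge> 1" using N by (simp add: n_def)
  have nN: "real (N - 1) = n" using N by (simp add: n_def)
  \<comment> \<open>Chosen so that \<open>L * \<theta>\<close> is the exponent of one frame
    determinant in \<open>frame_det_powr_le\<close>; the factor \<open>L\<close> arises because all
    super-frames see the same gains.\<close>
  define \<theta> where "\<theta> = (u / (2 * n) + w) / real L"
  have \<theta>0: "0 \<le> \<theta>" using u w n by (simp add: \<theta>_def)
  have \<theta>1: "\<theta> \<le> 1"
  proof -
    have "u / (2 * n) \<le> 1" using u n by (simp add: field_simps)
    then show ?thesis using L w by (simp add: \<theta>_def field_simps)
  qed
  obtain K1 where K1: "K1 > 0" and K1b: "\<And>x. x > 0 \<Longrightarrow>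
      (\<integral>\<^sup>+z. ennreal (fade_weight \<kappa> u x z) \<partial>cnormal 1) \<le> ennreal (K1 * x powr - u)"
    using cnormal_weighted_bound[OF u \<kappa>] by blast
  obtain K2 where K2: "K2 > 0" and K2b: "\<And>x. x > 0 \<Longrightarrow> (\<integral>\<^sup>+z'. \<integral>\<^sup>+z. ennreal (relay_weight \<kappa> w x z z') \<partial>cnormal 1 \<partial>cnormal 1) \<le> ennreal (K2 * x powr - w)"
    using cnormal_relay_bound[OF w \<kappa>] by blast
  \<comment> \<open>The power of \<open>1 / 4\<close> passes from \<open>x = \<rho> / 4\<close>, the
    scale of the Chernoff precisions, back to \<rho>.\<close>
  define K where "K = K1 * K2 ^ (N - 1) * (1 / 4) powr - (u + n * w)"
  have K: "K > 0" using K1 K2 by (simp add: K_def)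
  have main: "naf_error_prob N L M (\<rho> * sv) (sv / \<kappa>) sv (\<lambda>_. naf_gain) \<le> K * real M powr \<theta> * \<rho> powr - (u + n * w)"
    if \<rho>: "\<rho> > 0" and sv: "sv > 0" and M: "M \<ge> 1" for \<rho> sv :: real and M :: nat
  proof -
    define E where "E = \<rho> * sv"
    define sw where "sw = sv / \<kappa>"
    define x where "x = \<rho> / 4"
    have E: "E > 0" and sw: "sw > 0" and x: "x > 0" using \<rho> sv \<kappa> by (auto simp: E_def sw_def x_def)
  let ?err = "\<lambda>m g h. cond_error N L M E sw sv g h (\<lambda>i. naf_gain (h i)) m"
    define f1 where "f1 z = ennreal ((1 + x * sqmod z) powr - u)" for z
  let ?r = "\<lambda>z z'. relay_weight \<kappa> w x z z'"
    define f2 where "f2 z z' = ennreal (?r z z')" for z z'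
    have ce: "?err m g h \<le> ennreal (real M powr \<theta>) * (f1 (g 1) * (\<Prod>i\<in>{2..N}. f2 (g i) (h i)))" if m: "m < M" for m g h
    proof -
      define \<beta> where "\<beta> = (\<lambda>i. naf_gain (h i))"
      define d where "d i = frame_det E (1 / (4 * sv)) (1 / (4 * noise_var sw sv (fwd_gain g \<beta> i)))
         (sqmod (g 1)) (sqmod (fwd_gain g \<beta> i * h (i + 1)))" for i
      have d1: "d i \<ge> 1" for i
        unfolding d_def using E sv noise_var_pos[OF sw sv, of "fwd_gain g \<beta> i"] by (intro frame_det_pos) auto
      have d0: "d i > 0" for i using d1[of i] by linarith
      have dp: "d i powr - (u / (2 * n) + w) \<le> (1 + x * sqmod (g 1)) powr - (u / n) * (?r (g (i + 1)) (h (i + 1)))" for i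
        unfolding d_def \<beta>_def noise_var_def cmod_fwd_gain E_def sw_def x_def
        by (rule frame_det_powr_le) (use \<kappa> \<rho> sv u w n in auto)
      define PB where "PB = pairwise_bound N L E sw sv g h \<beta>"
      have PB: "PB = (\<Prod>i\<in>{1..N - 1}. (1 / d i) ^ L)"
      proof -
        have "PB = (\<Prod>q\<in>{..<L} \<times> {1..N - 1}. 1 / d (snd q))"
          unfolding PB_def pairwise_bound_def frames_def d_def by (simp add: case_prod_unfold)
        also have "\<dots> = (\<Prod>k\<in>{..<L}. \<Prod>i\<in>{1..N - 1}. 1 / d i)" by (subst prod.cartesian_product) (simp add: case_prod_unfold)
        also have "\<dots> = (\<Prod>i\<in>{1..N - 1}. (1 / d i) ^ L)" by (simp add: prod_power_distrib)
        finally show ?thesis .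
      qed
      have PB0: "PB > 0" unfolding PB using d0 by (intro prod_pos) auto
      have "PB powr \<theta> = (\<Prod>i\<in>{1..N - 1}. ((1 / d i) ^ L) powr \<theta>)"
        unfolding PB using d0 by (intro prod_powr_const) (auto intro: less_imp_le)
      also have "\<dots> = (\<Prod>i\<in>{1..N - 1}. d i powr - (u / (2 * n) + w))"
      proof (rule prod.cong[OF refl])
        fix i
        have "((1 / d i) ^ L) powr \<theta> = (d i powr - real L) powr \<theta>"
          using d0[of i] by (simp add: powr_minus powr_realpow power_one_over inverse_eq_divide)
        also have "\<dots> = d i powr - (real L * \<theta>)" by (simp add: powr_powr)
        also have "real L * \<theta> = u / (2 * n) + w" using L by (simp add: \<theta>_def)
        finally show "((1 / d i) ^ L) powr \<theta> = d i powr - (u / (2 * n) + w)" .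
      qed
      also have "\<dots> \<le> (\<Prod>i\<in>{1..N - 1}. (1 + x * sqmod (g 1)) powr - (u / n) * (?r (g (i + 1)) (h (i + 1))))"
        by (intro prod_mono conjI dp) auto
      also have "\<dots> = ((1 + x * sqmod (g 1)) powr - (u / n)) ^ (N - 1) * (\<Prod>i\<in>{1..N - 1}. ?r (g (i + 1)) (h (i + 1)))"
        by (simp add: prod.distrib)
      also have "((1 + x * sqmod (g 1)) powr - (u / n)) ^ (N - 1) = (1 + x * sqmod (g 1)) powr - u"
      proof -
        have "1 + x * sqmod (g 1) > 0" using x by (simp add: add_pos_nonneg)
        then have "((1 + x * sqmod (g 1)) powr - (u / n)) ^ (N - 1) = ((1 + x * sqmod (g 1)) powr - (u / n)) powr real (N - 1)"
          by (subst powr_realpow) auto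
        also have "\<dots> = (1 + x * sqmod (g 1)) powr - u" using n unfolding nN powr_powr by simp
        finally show ?thesis .
      qed
      also have "(\<Prod>i\<in>{1..N - 1}. ?r (g (i + 1)) (h (i + 1)))
        = (\<Prod>i\<in>{2..N}. (1 + sqmod (g i) / \<kappa>)\<^sup>2 * (1 + x * (sqmod (g i) * sqmod (h i) / (1 + sqmod (h i)))) powr - w)"
        by (rule prod.reindex_bij_witness[of _ "\<lambda>i. i - 1" "\<lambda>i. i + 1"]) auto
      finally have PBt: "PB powr \<theta> \<le> (1 + x * sqmod (g 1)) powr - u *
         (\<Prod>i\<in>{2..N}. (1 + sqmod (g i) / \<kappa>)\<^sup>2 * (1 + x * (sqmod (g i) * sqmod (h i) / (1 + sqmod (h i)))) powr - w)" .
      have "cond_error N L M E sw sv g h \<beta> m \<le> ennreal ((real M * PB) powr \<theta>)"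
      proof (cases "real M * PB \<le> 1")
        case True
        have "cond_error N L M E sw sv g h \<beta> m \<le> ennreal (real M * PB)"
          unfolding PB_def by (rule cond_error_le[OF E sw sv m])
        also have "real M * PB = (real M * PB) powr 1" using PB0 M by simp
        also have "ennreal \<dots> \<le> ennreal ((real M * PB) powr \<theta>)" using True PB0 M \<theta>1 by (intro ennreal_leI powr_mono') auto
        finally show ?thesis .
      next
        case False
        have "cond_error N L M E sw sv g h \<beta> m \<le> ennreal 1" using cond_error_le_1[OF E sw sv] by simp
        also have "\<dots> \<le> ennreal ((real M * PB) powr \<theta>)" using False \<theta>0 by (intro ennreal_leI ge_one_powr_ge_zero) auto
        finally show ?thesis .
      qed
      also have "\<dots> \<le> ennreal (real M powr \<theta> * ((1 + x * sqmod (g 1)) powr - u *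
         (\<Prod>i\<in>{2..N}. (1 + sqmod (g i) / \<kappa>)\<^sup>2 * (1 + x * (sqmod (g i) * sqmod (h i) / (1 + sqmod (h i)))) powr - w)))"
        using PBt PB0 by (intro ennreal_leI) (simp add: powr_mult mult_left_mono)
      also have "\<dots> = ennreal (real M powr \<theta>) * (f1 (g 1) * (\<Prod>i\<in>{2..N}. f2 (g i) (h i)))"
      proof -
        define r where "r i = (1 + sqmod (g i) / \<kappa>)\<^sup>2 * (1 + x * (sqmod (g i) * sqmod (h i) / (1 + sqmod (h i)))) powr - w" for i
        have r: "r i \<ge> 0" for i by (simp add: r_def)
        then have "(\<Prod>i\<in>{2..N}. f2 (g i) (h i)) = ennreal (\<Prod>i\<in>{2..N}. r i)"
          unfolding f2_def r_def[symmetric] by (intro prod_ennreal)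
        then show ?thesis using r unfolding f1_def r_def[symmetric] by (simp add: ennreal_mult prod_nonneg)
      qed
      finally show ?thesis unfolding \<beta>_def .
    qed
    have f1m: "f1 \<in> borel_measurable borel" unfolding f1_def by measurable
    have f2m: "case_prod f2 \<in> borel_measurable (borel \<Otimes>\<^sub>M borel)" unfolding f2_def by measurable
    have int1: "(\<integral>\<^sup>+z. f1 z \<partial>cnormal 1) \<le> ennreal (K1 * x powr - u)"
    proof -
      \<comment> \<open>The direct link has no noise weight; inserting one, which is at least 1,
        lets the same moment bound cover it.\<close>
      have "f1 z \<le> ennreal (fade_weight \<kappa> u x z)" for z
      proof -
        have "1 \<le> (1 + sqmod z / \<kappa>)\<^sup>2" using \<kappa> by (intro one_le_power) auto
        then have "1 * (1 + x * sqmod z) powr - u \<le> fade_weight \<kappa> u x z" by (intro mult_right_mono) auto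
        then show ?thesis unfolding f1_def by (intro ennreal_leI) simp
      qed
      then have "(\<integral>\<^sup>+z. f1 z \<partial>cnormal 1) \<le> (\<integral>\<^sup>+z. ennreal (fade_weight \<kappa> u x z) \<partial>cnormal 1)" by (rule nn_integral_mono)
      also have "\<dots> \<le> ennreal (K1 * x powr - u)" by (rule K1b[OF x])
      finally show ?thesis .
    qed
    have fad: "(\<integral>\<^sup>+(g, h). ?err m g h \<partial>fading N) \<le> ennreal (K * real M powr \<theta> * \<rho> powr - (u + n * w))" if m: "m < M" for m
    proof -
      have mm: "(\<lambda>(g, h). f1 (g 1) * (\<Prod>i\<in>{2..N}. f2 (g i) (h i))) \<in> borel_measurable (fading N)"
      proof -
        have c: "(\<lambda>\<omega>. f2 (fst \<omega> i) (snd \<omega> i)) \<in> borel_measurable (fading N)" if "i \<in> {2..N}" for i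
          using measurable_compose[OF measurable_Pair[OF fading_components(1)[of i N] fading_components(2)[OF that]] f2m] that
          by simp
        have "(\<lambda>\<omega>. f1 (fst \<omega> 1)) \<in> borel_measurable (fading N)"
          by (rule measurable_compose[OF fading_components(1) f1m]) (use N in auto)
        then show ?thesis unfolding case_prod_unfold using c
          by (intro borel_measurable_times_ennreal borel_measurable_prod_ennreal)
      qed
      have "(\<integral>\<^sup>+(g, h). ?err m g h \<partial>fading N) \<le>
        (\<integral>\<^sup>+\<omega>. ennreal (real M powr \<theta>) * (case \<omega> of (g, h) \<Rightarrow> f1 (g 1) * (\<Prod>i\<in>{2..N}. f2 (g i) (h i))) \<partial>fading N)"
        by (intro nn_integral_mono) (use ce[OF m] in \<open>simp add: case_prod_unfold\<close>)
      also have "\<dots> = ennreal (real M powr \<theta>) * (\<integral>\<^sup>+(g, h). f1 (g 1) * (\<Prod>i\<in>{2..N}. f2 (g i) (h i)) \<partial>fading N)"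
        by (rule nn_integral_cmult[OF mm])
      also have "(\<integral>\<^sup>+(g, h). f1 (g 1) * (\<Prod>i\<in>{2..N}. f2 (g i) (h i)) \<partial>fading N) =
        (\<integral>\<^sup>+z. f1 z \<partial>cnormal 1) * (\<integral>\<^sup>+z'. \<integral>\<^sup>+z. f2 z z' \<partial>cnormal 1 \<partial>cnormal 1) ^ (N - 1)"
        by (rule nn_integral_fading_prod) (use N f1m f2m in auto)
      also have "\<dots> \<le> ennreal (K1 * x powr - u) * ennreal (K2 * x powr - w) ^ (N - 1)"
        using int1 K2b[OF x] unfolding f2_def by (intro mult_mono power_mono) auto
      also have "\<dots> = ennreal ((K1 * x powr - u) * (K2 * x powr - w) ^ (N - 1))"
        using K1 K2 by (simp add: ennreal_power ennreal_mult[symmetric])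
      also have "(K1 * x powr - u) * (K2 * x powr - w) ^ (N - 1) = K * \<rho> powr - (u + n * w)"
      proof -
        have "(x powr - w) ^ (N - 1) = x powr - (n * w)"
        proof -
          have "(x powr - w) ^ (N - 1) = (x powr - w) powr real (N - 1)" using x by (subst powr_realpow) auto
          then show ?thesis unfolding nN powr_powr by (simp add: mult.commute)
        qed
        then have "(K1 * x powr - u) * (K2 * x powr - w) ^ (N - 1) = K1 * K2 ^ (N - 1) * (x powr - u * x powr - (n * w))"
          by (simp add: power_mult_distrib)
        also have "x powr - u * x powr - (n * w) = x powr - (u + n * w)" by (simp add: powr_add[symmetric])
        also have "x powr - (u + n * w) = (1 / 4) powr - (u + n * w) * \<rho> powr - (u + n * w)"
          using \<rho> unfolding x_def by (subst powr_mult[symmetric]) auto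
        finally show ?thesis by (simp add: K_def)
      qed
      also have "ennreal (real M powr \<theta>) * ennreal (K * \<rho> powr - (u + n * w)) = ennreal (K * real M powr \<theta> * \<rho> powr - (u + n * w))"
        using K by (subst ennreal_mult[symmetric]) (auto simp: mult_ac)
      finally show ?thesis by (simp add: mult_left_mono)
    qed
    have "ennreal (real M * naf_error_prob N L M E sw sv (\<lambda>_. naf_gain)) = (\<Sum>m<M. \<integral>\<^sup>+(g, h). ?err m g h \<partial>fading N)"
      by (rule naf_error_prob_eq(1)) (use E sw sv M in auto)
    also have "\<dots> \<le> (\<Sum>m<M. ennreal (K * real M powr \<theta> * \<rho> powr - (u + n * w)))" by (intro sum_mono fad) auto
    also have "\<dots> = ennreal (real M * (K * real M powr \<theta> * \<rho> powr - (u + n * w)))"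
      using K by (simp add: ennreal_mult ennreal_of_nat_eq_real_of_nat)
    finally have "real M * naf_error_prob N L M E sw sv (\<lambda>_. naf_gain) \<le> real M * (K * real M powr \<theta> * \<rho> powr - (u + n * w))"
      using K by (subst (asm) ennreal_le_iff) auto
    then show ?thesis using M unfolding E_def sw_def by simp
  qed
  show ?thesis using K main unfolding n_def[symmetric] \<theta>_def by (intro exI[of _ K]) auto
qed

text \<open>The source-relay gains are left free: \<open>naf_gain\<close> caps the relayed path by
  the relay-destination gain, so it is enough to restrict \<open>g\<close>. The constant does not
  depend on \<open>r'\<close>, \<open>M\<close> or the noise variances.\<close>

lemma naf_error_prob_lower:
  assumes N: "N \<ge> 2" and L: "L \<ge> 1"
  shows "\<exists>c>0. \<forall>\<rho>\<ge>1. \<forall>sv>0. \<forall>sw>0. \<forall>r'\<in>{0..1}. \<forall>M. 2 * \<rho> powr (2 * (real N - 1) * real L * r') \<le> real M \<longrightarrow>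
     c * \<rho> powr - ((1 - r') + (real N - 1) * max (1 - 2 * r') 0) \<le> naf_error_prob N L M (\<rho> * sv) sw sv (\<lambda>_. naf_gain)"
proof -
  define n where "n = real N - 1"
  have n: "n \<ge> 1" using N by (simp add: n_def)
  have nN: "real (N - 1) = n" using N by (simp add: n_def)
  \<comment> \<open>Makes \<open>(1 + 10 * \<delta>) ^ (L * (N - 1)) \<le> exp (1 / 4) \<le> 3 /
    2\<close>, where \<open>1 + 10 * \<delta>\<close> is the excess of one determinant.\<close>
  define \<delta> where "\<delta> = 1 / (40 * n * real L)"
  have nL: "n * real L \<ge> 1" using mult_mono[OF n, of 1 "real L"] L n by simp
  have \<delta>: "0 < \<delta>" "\<delta> \<le> 1" using nL by (auto simp: \<delta>_def divide_simps)
  \<comment> \<open>\<open>cnormal_disc_ge\<close> gives \<open>\<delta> / 6\<close> for each of the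
    \<open>N\<close> gains, and \<open>1 / 10\<close> is the error probability on the event.\<close>
  define c where "c = (1 / 10) * (\<delta> / 6) ^ N"
  have c: "c > 0" using \<delta> by (simp add: c_def)
  have main: "c * \<rho> powr - ((1 - r') + n * max (1 - 2 * r') 0) \<le> naf_error_prob N L M (\<rho> * sv) sw sv (\<lambda>_. naf_gain)"
    if \<rho>: "\<rho> \<ge> 1" and sv: "sv > 0" and sw: "sw > 0" and r: "0 \<le> r'" "r' \<le> 1"
      and Mb: "2 * \<rho> powr (2 * n * real L * r') \<le> real M" for \<rho> sv sw r' :: real and M :: nat
  proof -
    define E where "E = \<rho> * sv"
    have E: "E > 0" using \<rho> sv by (simp add: E_def)
  let ?err = "\<lambda>m g h. cond_error N L M E sw sv g h (\<lambda>i. naf_gain (h i)) m"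
  let ?G = "\<Pi>\<^sub>M i\<in>{1..N}. cnormal 1"
    define e where "e = max (1 - 2 * r') 0"
    \<comment> \<open>With \<open>R = \<rho> powr r'\<close>, these thresholds bound
      \<open>\<rho> * sqmod (g 1)\<close> by \<open>\<delta> * R\<close> and the relayed terms by
      \<open>\<delta> * R ^ 2\<close>, so that no summand of the determinant exceeds the order
      \<open>R ^ 2\<close>.\<close>
    define t where "t i = \<delta> * \<rho> powr - (if i = 1 then 1 - r' else e)" for i :: nat
    have t: "0 \<le> t i" "t i \<le> 1" for i
    proof -
      have "\<rho> powr - (if i = 1 then 1 - r' else e) \<le> \<rho> powr 0" using \<rho> r by (intro powr_mono) (auto simp: e_def)
      then have "t i \<le> \<delta> * 1" unfolding t_def using \<rho> \<delta> by (intro mult_left_mono) auto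
      then show "t i \<le> 1" using \<delta> by simp
      show "0 \<le> t i" using \<delta> by (simp add: t_def)
    qed
    have Mpos: "M > 0"
    proof -
      have "0 < 2 * \<rho> powr (2 * n * real L * r')" using \<rho> by simp
      then show ?thesis using Mb by (cases M) auto
    qed
    define G where "G = (\<Pi>\<^sub>E i\<in>{1..N}. (disc (t i)))"
    define Out where "Out = G \<times> space (\<Pi>\<^sub>M i\<in>{2..N}. cnormal 1)"
    interpret G: prob_space "\<Pi>\<^sub>M i\<in>{1..N}. cnormal 1" by (rule prob_space_PiM_cnormal) simp
    interpret H: prob_space "\<Pi>\<^sub>M i\<in>{2..N}. cnormal 1" by (rule prob_space_PiM_cnormal) simp
    interpret C: product_sigma_finite "\<lambda>_. cnormal 1" by (rule product_sigma_finite_cnormal) simp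
    have disc: "(disc (t i)) \<in> sets borel" for i by measurable
    have Gs: "G \<in> sets ?G" unfolding G_def by (rule sets_PiM_I_finite) (use disc in auto)
    have Outs: "Out \<in> sets (fading N)" unfolding Out_def fading_def using Gs by (intro pair_measureI) auto
    have PO: "ennreal (10 * c * \<rho> powr - ((1 - r') + n * e)) \<le> emeasure (fading N) Out"
    proof -
      have "10 * c * \<rho> powr - ((1 - r') + n * e) = (\<Prod>i\<in>{1..N}. t i / 6)"
      proof -
        have ins: "{1..N} = insert 1 {2..N}" using N by auto
        have "(\<Prod>i\<in>{1..N}. t i / 6) = (\<delta> / 6 * \<rho> powr - (1 - r')) * (\<Prod>i\<in>{2..N}. \<delta> / 6 * \<rho> powr - e)"
          unfolding ins by (subst prod.insert) (auto simp: t_def intro!: prod.cong)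
        also have "(\<Prod>i\<in>{2..N}. \<delta> / 6 * \<rho> powr - e) = (\<delta> / 6) ^ (N - 1) * (\<rho> powr - e) ^ (N - 1)"
          by (simp only: prod_constant power_mult_distrib) simp
        also have "(\<rho> powr - e) ^ (N - 1) = \<rho> powr - (n * e)"
        proof -
          have "(\<rho> powr - e) ^ (N - 1) = (\<rho> powr - e) powr real (N - 1)" using \<rho> by (subst powr_realpow) auto
          then show ?thesis unfolding nN powr_powr by (simp add: mult.commute)
        qed
        also have "(\<delta> / 6 * \<rho> powr - (1 - r')) * ((\<delta> / 6) ^ (N - 1) * \<rho> powr - (n * e)) =
          (\<delta> / 6 * (\<delta> / 6) ^ (N - 1)) * (\<rho> powr - (1 - r') * \<rho> powr - (n * e))" by (simp only: mult_ac)
        also have "\<delta> / 6 * (\<delta> / 6) ^ (N - 1) = (\<delta> / 6) ^ N" using N by (simp add: power_Suc[symmetric] del: power_Suc)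
        also have "\<rho> powr - (1 - r') * \<rho> powr - (n * e) = \<rho> powr - ((1 - r') + n * e)" by (simp add: powr_add[symmetric])
        finally show ?thesis by (simp add: c_def)
      qed
      then have "ennreal (10 * c * \<rho> powr - ((1 - r') + n * e)) = (\<Prod>i\<in>{1..N}. ennreal (t i / 6))"
        using t by (simp add: prod_ennreal)
      also have "\<dots> \<le> (\<Prod>i\<in>{1..N}. emeasure (cnormal 1) (disc (t i)))" using t by (intro prod_mono_ennreal cnormal_disc_ge)
      also have "\<dots> = emeasure ?G G" unfolding G_def using disc by (subst C.emeasure_PiM) auto
      also have "\<dots> = emeasure (fading N) Out"
        unfolding Out_def fading_def using Gs by (subst H.emeasure_pair_measure_Times) (auto simp: H.emeasure_space_1)
      finally show ?thesis .
    qed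
    have out: "ennreal (real M / 10) \<le> (\<Sum>m<M. ?err m g h)"
      if gh: "(g, h) \<in> Out" for g h
    proof -
      define \<beta> where "\<beta> = (\<lambda>i. naf_gain (h i))"
      define R where "R = \<rho> powr r'"
      have R1: "R \<ge> 1" unfolding R_def using \<rho> r by (simp add: ge_one_powr_ge_zero)
      define d where "d i = frame_det E (2 / sv) (2 / sv) (sqmod (g 1)) (sqmod (fwd_gain g \<beta> i * h (i + 1)))" for i
      have gt: "sqmod (g i) \<le> t i" if "i \<in> {1..N}" for i
        using gh that unfolding Out_def G_def by (auto simp: PiE_def Pi_def)
      have dle: "d i \<le> R\<^sup>2 * (1 + 10 * \<delta>)" if i: "i \<in> {1..N - 1}" for i
      proof -
        have "\<rho> * sqmod (g 1) \<le> \<rho> * t 1" using gt[of 1] N \<rho> by (intro mult_left_mono) auto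
        also have "\<dots> = \<delta> * (\<rho> powr 1 * \<rho> powr - (1 - r'))" using \<rho> by (simp add: t_def)
        also have "\<rho> powr 1 * \<rho> powr - (1 - r') = R" unfolding powr_add[symmetric] R_def by simp
        finally have a: "\<rho> * sqmod (g 1) \<le> \<delta> * R" .
        have "\<rho> * sqmod (g (i + 1)) \<le> \<rho> * t (i + 1)" using gt[of "i + 1"] i \<rho> by (intro mult_left_mono) auto
        also have "\<dots> = \<delta> * (\<rho> powr 1 * \<rho> powr - e)" using \<rho> i by (simp add: t_def)
        also have "\<rho> powr 1 * \<rho> powr - e = \<rho> powr (1 - e)" unfolding powr_add[symmetric] by simp
        \<comment> \<open>\<open>1 - e\<close> is the minimum of \<open>1\<close> and
          \<open>2 * r'\<close>.\<close>
        also have "\<dots> \<le> \<rho> powr (r' + r')" using \<rho> by (intro powr_mono) (auto simp: e_def)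
        also have "\<dots> = R\<^sup>2" by (simp only: R_def powr_add power2_eq_square)
        finally have A: "\<rho> * sqmod (g (i + 1)) \<le> \<delta> * R\<^sup>2" using \<delta> by simp
        have c1: "sqmod (fwd_gain g \<beta> i * h (i + 1)) \<le> sqmod (g (i + 1))"
        proof -
          have "sqmod (h (i + 1)) / (1 + sqmod (h (i + 1))) \<le> 1" by (subst divide_le_eq_1_pos) (auto simp: add_pos_nonneg)
          from mult_left_mono[OF this, of "sqmod (g (i + 1))"] show ?thesis
            unfolding \<beta>_def cmod_fwd_gain by simp
        qed
        have "\<rho> * sqmod (fwd_gain g \<beta> i * h (i + 1)) \<le> \<delta> * R\<^sup>2" using mult_left_mono[OF c1, of \<rho>] A \<rho> by linarith
        moreover have "d i = (1 + 2 * (\<rho> * sqmod (g 1))) * (1 + 2 * (\<rho> * sqmod (g 1))) +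
            2 * (\<rho> * sqmod (fwd_gain g \<beta> i * h (i + 1)))"
          unfolding d_def frame_det_def E_def using sv by (simp add: mult.assoc)
        moreover have "0 \<le> \<rho> * sqmod (g 1)" using \<rho> by simp
        ultimately have "d i \<le> (1 + 2 * (\<delta> * R)) * (1 + 2 * (\<delta> * R)) + 2 * (\<delta> * R\<^sup>2)"
          using a \<rho> \<delta> R1 by (auto intro!: add_mono mult_mono add_nonneg_nonneg mult_nonneg_nonneg)
        also have "\<dots> \<le> R * (1 + 2 * \<delta>) * (R * (1 + 2 * \<delta>)) + 2 * (\<delta> * R\<^sup>2)"
        proof -
          have "1 + 2 * (\<delta> * R) \<le> R * (1 + 2 * \<delta>)" using R1 by (simp add: algebra_simps)
          then show ?thesis using \<delta> R1 by (intro add_mono mult_mono) auto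
        qed
        also have "\<dots> = R\<^sup>2 * (1 + 6 * \<delta> + 4 * (\<delta> * \<delta>))" by (simp add: power2_eq_square algebra_simps)
        also have "\<dots> \<le> R\<^sup>2 * (1 + 10 * \<delta>)"
        proof (rule mult_left_mono)
          have "\<delta> * \<delta> \<le> \<delta> * 1" using \<delta> by (intro mult_left_mono) auto
          then show "1 + 6 * \<delta> + 4 * (\<delta> * \<delta>) \<le> 1 + 10 * \<delta>" by simp
        qed simp
        finally show ?thesis .
      qed
      have d1: "d i \<ge> 1" for i unfolding d_def using E sv by (intro frame_det_pos) auto
      have "frame_dets N L E sv g h \<beta> = (\<Prod>q\<in>{..<L} \<times> {1..N - 1}. d (snd q))"
        unfolding frame_dets_def frames_def d_def by (simp add: case_prod_unfold)
      also have "\<dots> \<le> (\<Prod>q\<in>{..<L} \<times> {1..N - 1}. R\<^sup>2 * (1 + 10 * \<delta>))"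
        using dle d1 by (intro prod_mono) (auto intro: order.trans[OF zero_le_one])
      also have "\<dots> = (R\<^sup>2 * (1 + 10 * \<delta>)) ^ (L * (N - 1))" by simp
      also have "\<dots> = R ^ (2 * (L * (N - 1))) * (1 + 10 * \<delta>) ^ (L * (N - 1))" by (simp only: power_mult_distrib power_mult)
      also have "\<dots> \<le> R ^ (2 * (L * (N - 1))) * (3 / 2)"
      proof (rule mult_left_mono)
        have "1 + 10 * \<delta> \<le> exp (10 * \<delta>)" by (rule exp_ge_add_one_self)
        then have "(1 + 10 * \<delta>) ^ (L * (N - 1)) \<le> exp (10 * \<delta>) ^ (L * (N - 1))" using \<delta> by (intro power_mono) auto
        also have "\<dots> = exp (real (L * (N - 1)) * (10 * \<delta>))" by (rule exp_of_nat_mult[symmetric])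
        also have "real (L * (N - 1)) * (10 * \<delta>) = 1 / 4" using n L unfolding of_nat_mult nN \<delta>_def by simp
        also have "exp (1 / 4 :: real) \<le> 1 + 1 / 4 + (1 / 4)\<^sup>2" by (rule exp_bound) auto
        also have "\<dots> \<le> 3 / 2" by (simp add: power2_eq_square)
        finally show "(1 + 10 * \<delta>) ^ (L * (N - 1)) \<le> 3 / 2" .
      qed (use R1 in simp)
      also have "R ^ (2 * (L * (N - 1))) = \<rho> powr (2 * n * real L * r')"
      proof -
        have "R ^ (2 * (L * (N - 1))) = R powr real (2 * (L * (N - 1)))" using R1 by (subst powr_realpow) auto
        also have "\<dots> = \<rho> powr (r' * real (2 * (L * (N - 1))))" by (simp add: R_def powr_powr)
        also have "r' * real (2 * (L * (N - 1))) = 2 * n * real L * r'" unfolding of_nat_mult nN by simp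
        finally show ?thesis .
      qed
      also have "\<rho> powr (2 * n * real L * r') * (3 / 2) \<le> 3 / 4 * real M" using Mb by simp
      finally have fd: "frame_dets N L E sv g h \<beta> \<le> 3 / 4 * real M" .
      have "real M * frame_dets N L E sv g h \<beta> \<le> real M * (3 / 4 * real M)" using fd by (intro mult_left_mono) auto
      \<comment> \<open>\<open>3 / 4\<close> is below \<open>81 / 100\<close>, so at least one tenth
        of the decisions fails.\<close>
      also have "\<dots> \<le> (9 / 10 * real M)\<^sup>2" by (simp add: power2_eq_square)
      finally have "sqrt (real M * frame_dets N L E sv g h \<beta>) \<le> 9 / 10 * real M" by (intro real_le_lsqrt) auto
      then have cc: "(\<Sum>m<M. cond_correct N L M E sw sv g h \<beta> m) \<le> ennreal (9 / 10 * real M)"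
        using sum_cond_correct_le[OF E sw sv Mpos, of N L g h \<beta>] by (meson ennreal_leI order.trans)
      have "(\<Sum>m<M. cond_error N L M E sw sv g h \<beta> m) + (\<Sum>m<M. cond_correct N L M E sw sv g h \<beta> m) = (\<Sum>m<M. 1)"
        unfolding sum.distrib[symmetric] by (intro sum.cong refl cond_error_add_cond_correct E sw sv) auto
      also have "\<dots> = ennreal (real M)" by (simp add: ennreal_of_nat_eq_real_of_nat)
      finally have s: "(\<Sum>m<M. cond_error N L M E sw sv g h \<beta> m) + (\<Sum>m<M. cond_correct N L M E sw sv g h \<beta> m) = ennreal (real M)" .
      have "ennreal (real M / 10) + ennreal (9 / 10 * real M) = ennreal (real M)" by (subst ennreal_plus[symmetric]) auto
      also have "\<dots> \<le> (\<Sum>m<M. cond_error N L M E sw sv g h \<beta> m) + ennreal (9 / 10 * real M)"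
        unfolding s[symmetric] by (intro add_left_mono cc)
      finally show ?thesis unfolding \<beta>_def
        by (subst (asm) (1 2) add.commute) (subst (asm) ennreal_add_left_cancel_le, simp)
    qed
    have b: "(\<lambda>_. naf_gain) i \<in> borel_measurable borel" for i :: nat by measurable
    have "ennreal (real M / 10) * ennreal (10 * c * \<rho> powr - ((1 - r') + n * e)) \<le> ennreal (real M / 10) * emeasure (fading N) Out"
      using PO by (rule mult_left_mono) simp
    also have "\<dots> = (\<integral>\<^sup>+gh. ennreal (real M / 10) * indicator Out gh \<partial>fading N)"
      by (rule nn_integral_cmult_indicator[OF Outs, symmetric])
    also have "\<dots> \<le> (\<integral>\<^sup>+gh. (\<Sum>m<M. case gh of (g, h) \<Rightarrow> ?err m g h) \<partial>fading N)"
    proof (rule nn_integral_mono)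
      fix gh :: "(nat \<Rightarrow> complex) \<times> (nat \<Rightarrow> complex)"
      show "ennreal (real M / 10) * indicator Out gh \<le> (\<Sum>m<M. case gh of (g, h) \<Rightarrow> ?err m g h)"
        using out[of "fst gh" "snd gh"] by (cases "gh \<in> Out") (auto simp: case_prod_unfold)
    qed
    also have "\<dots> = (\<Sum>m<M. \<integral>\<^sup>+(g, h). ?err m g h \<partial>fading N)"
      by (rule nn_integral_sum) (use naf_error_prob_eq(2)[OF E sw sv Mpos, of N "\<lambda>_. naf_gain"] b in auto)
    also have "\<dots> = ennreal (real M * naf_error_prob N L M E sw sv (\<lambda>_. naf_gain))"
      by (rule naf_error_prob_eq(1)[symmetric]) (use E sw sv Mpos b in auto)
    finally have "ennreal (real M * (c * \<rho> powr - ((1 - r') + n * e))) \<le> ennreal (real M * naf_error_prob N L M E sw sv (\<lambda>_. naf_gain))"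
      using c by (subst (asm) ennreal_mult[symmetric]) auto
    moreover have "0 < real M * (c * \<rho> powr - ((1 - r') + n * e))" using Mpos c \<rho> by simp
    ultimately have "real M * (c * \<rho> powr - ((1 - r') + n * e)) \<le> real M * naf_error_prob N L M E sw sv (\<lambda>_. naf_gain)"
      by (metis ennreal_le_iff2 linorder_not_less)
    then show ?thesis using Mpos unfolding e_def E_def by simp
  qed
  show ?thesis using c main unfolding n_def[symmetric] by (intro exI[of _ c]) auto
qed

section \<open>The tradeoff\<close>

definition dmt :: "real \<Rightarrow> real \<Rightarrow> real" where
  "dmt n r = (1 - r) + n * max (1 - 2 * r) 0"

text \<open>Lipschitz continuity in the rate: lowering \<open>r\<close> slightly, to make room for
  subpolynomial factors in \<open>M\<close>, costs an arbitrarily small part of the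
  exponent.\<close>

lemma dmt_le_add:
  assumes "n \<ge> 0" "r' \<le> r"
  shows "dmt n r' \<le> dmt n r + (r - r') * (1 + 2 * n)"
proof -
  have "max (1 - 2 * r') 0 \<le> max (1 - 2 * r) 0 + 2 * (r - r')" using assms by auto
  from mult_left_mono[OF this assms(1)] show ?thesis unfolding dmt_def by (simp add: algebra_simps)
qed

lemma tendsto_const_div_log: "((\<lambda>\<rho>. c / log 2 \<rho>) \<longlongrightarrow> (0::real)) at_top"
proof -
  have "((\<lambda>\<rho>. (c * ln 2) / ln \<rho>) \<longlongrightarrow> (0::real)) at_top"
    by (intro tendsto_divide_0[OF tendsto_const] filterlim_at_top_imp_at_infinity ln_at_top)
  then show ?thesis by (simp add: log_def)
qed

text \<open>The channel enters only through \<open>upper\<close> and \<open>lower\<close>; what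
  remains is a comparison of exponents, in which constants vanish after division by
  \<open>log 2 \<rho>\<close>. The lower bound comes first because it also supplies the positivity
  that the logarithm needs.\<close>

lemma diversity_gain_from_bounds:
  fixes P :: "real \<Rightarrow> real" and M :: "real \<Rightarrow> nat"
  assumes n: "n \<ge> 1" and L: "L > 0" and r: "0 \<le> r" "r \<le> 1"
    and M2: "\<forall>\<^sub>F \<rho> in at_top. 2 \<le> M \<rho>"
    and M: "((\<lambda>\<rho>. log 2 (real (M \<rho>)) / log 2 \<rho>) \<longlongrightarrow> 2 * n * L * r) at_top"
    and upper: "\<And>u w. 0 \<le> u \<Longrightarrow> u < 1 \<Longrightarrow> 0 \<le> w \<Longrightarrow> w < 1 \<Longrightarrow>
      \<exists>K>0. \<forall>\<^sub>F \<rho> in at_top. P \<rho> \<le> K * real (M \<rho>) powr ((u / (2 * n) + w) / L) * \<rho> powr - (u + n * w)"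
    and lower: "\<And>r'. 0 \<le> r' \<Longrightarrow> r' \<le> 1 \<Longrightarrow>
      \<exists>c>0. \<forall>\<^sub>F \<rho> in at_top. 2 * \<rho> powr (2 * n * L * r') \<le> real (M \<rho>) \<longrightarrow> c * \<rho> powr - dmt n r' \<le> P \<rho>"
  shows "has_diversity_gain P (dmt n r)"
proof -
  have low: "\<exists>c>0. \<forall>\<^sub>F \<rho> in at_top. c * \<rho> powr - s \<le> P \<rho>" if "s > dmt n r" for s
  proof -
    \<comment> \<open>Lowering the rate by \<open>q\<close> then costs half of
      \<open>s - dmt n r\<close> by \<open>dmt_le_add\<close>.\<close>
    define q where "q = (s - dmt n r) / (2 * (1 + 2 * n))"
    have q: "q > 0" using that n by (simp add: q_def)
    define r' where "r' = max 0 (r - q)"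
    have r': "0 \<le> r'" "r' \<le> r" "r' \<le> 1" "r - r' \<le> q" using q r by (auto simp: r'_def)
    have "dmt n r' \<le> dmt n r + (r - r') * (1 + 2 * n)" using n r' by (intro dmt_le_add) auto
    also have "\<dots> \<le> dmt n r + q * (1 + 2 * n)" using r' n by (intro add_left_mono mult_right_mono) auto
    also have "\<dots> = dmt n r + (s - dmt n r) / 2" using n by (simp add: q_def field_simps)
    also have "\<dots> \<le> s" using that by argo
    finally have ds: "dmt n r' \<le> s" .
    \<comment> \<open>For \<open>r > 0\<close> the gap between \<open>r'\<close> and
      \<open>r\<close> beats the factor 2, which appears as \<open>1 / log 2 \<rho>\<close>. For
      \<open>r = 0\<close> also \<open>r' = 0\<close>, and the claim is just
      \<open>2 \<le> M \<rho>\<close>.\<close>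
    have big: "\<forall>\<^sub>F \<rho> in at_top. 2 * \<rho> powr (2 * n * L * r') \<le> real (M \<rho>)"
    proof (cases "r = 0")
      case True
      have "r' = 0" using True r' by simp
      show ?thesis using M2 eventually_gt_at_top[of 0] by eventually_elim (use \<open>r' = 0\<close> in simp)
    next
      case False
      then have "r' < r" using q r by (auto simp: r'_def)
      then have "2 * n * L * r' < 2 * n * L * r - 0" using n L by simp
      moreover have "((\<lambda>\<rho>. log 2 (real (M \<rho>)) / log 2 \<rho> - 1 / log 2 \<rho>) \<longlongrightarrow> 2 * n * L * r - 0) at_top"
        by (intro tendsto_diff M tendsto_const_div_log)
      ultimately have "\<forall>\<^sub>F \<rho> in at_top. 2 * n * L * r' < log 2 (real (M \<rho>)) / log 2 \<rho> - 1 / log 2 \<rho>"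
        by (rule order_tendstoD(1)[rotated])
      then show ?thesis using M2 eventually_gt_at_top[of 1]
      proof eventually_elim
        case (elim \<rho>)
        have l: "log 2 \<rho> > 0" using elim by simp
        have "2 * n * L * r' * log 2 \<rho> + 1 < log 2 (real (M \<rho>))" using elim(1) l by (simp add: field_simps)
        then have "2 powr (2 * n * L * r' * log 2 \<rho> + 1) \<le> 2 powr log 2 (real (M \<rho>))" by simp
        also have "\<dots> = real (M \<rho>)" using elim by simp
        also have "2 powr (2 * n * L * r' * log 2 \<rho> + 1) = 2 * \<rho> powr (2 * n * L * r')"
        proof -
          have "\<rho> powr (2 * n * L * r') = (2 powr log 2 \<rho>) powr (2 * n * L * r')" using elim by simp
          then show ?thesis by (simp add: powr_add powr_powr mult.commute)
        qed
        finally show ?case .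
      qed
    qed
    obtain c where c: "c > 0" "\<forall>\<^sub>F \<rho> in at_top. 2 * \<rho> powr (2 * n * L * r') \<le> real (M \<rho>) \<longrightarrow> c * \<rho> powr - dmt n r' \<le> P \<rho>"
      using lower[of r'] r' by blast
    have "\<forall>\<^sub>F \<rho> in at_top. c * \<rho> powr - s \<le> P \<rho>" using c(2) big eventually_gt_at_top[of 1]
    proof eventually_elim
      case (elim \<rho>)
      have "c * \<rho> powr - s \<le> c * \<rho> powr - dmt n r'" using ds c(1) elim by (intro mult_left_mono powr_mono) auto
      then show ?case using elim by linarith
    qed
    then show ?thesis using c(1) by blast
  qed
  have pos: "\<forall>\<^sub>F \<rho> in at_top. 0 < P \<rho>"
  proof -
    obtain c where c: "c > 0" and ev: "\<forall>\<^sub>F \<rho> in at_top. c * \<rho> powr - (dmt n r + 1) \<le> P \<rho>"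
      using low[of "dmt n r + 1"] by auto
    show ?thesis using ev eventually_gt_at_top[of 0]
    proof eventually_elim
      case (elim \<rho>)
      have "0 < c * \<rho> powr - (dmt n r + 1)" using c elim by simp
      then show ?case using elim by linarith
    qed
  qed
  have "((\<lambda>\<rho>. - (log 2 (P \<rho>) / log 2 \<rho>)) \<longlongrightarrow> dmt n r) at_top"
  proof (rule order_tendstoI)
    fix a assume a: "dmt n r < a"
    define s where "s = (dmt n r + a) / 2"
    have s: "dmt n r < s" "s < a" using a by (auto simp: s_def)
    obtain c where c: "c > 0" and ev: "\<forall>\<^sub>F \<rho> in at_top. c * \<rho> powr - s \<le> P \<rho>" using low[OF s(1)] by auto
    have "((\<lambda>\<rho>. s - log 2 c / log 2 \<rho>) \<longlongrightarrow> s - 0) at_top" by (intro tendsto_intros tendsto_const_div_log)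
    then have "\<forall>\<^sub>F \<rho> in at_top. s - log 2 c / log 2 \<rho> < a" using s(2) by (intro order_tendstoD(2)) auto
    then show "\<forall>\<^sub>F \<rho> in at_top. - (log 2 (P \<rho>) / log 2 \<rho>) < a" using ev pos eventually_gt_at_top[of 1]
    proof eventually_elim
      case (elim \<rho>)
      have l: "log 2 \<rho> > 0" using elim by simp
      have "log 2 (c * \<rho> powr - s) \<le> log 2 (P \<rho>)" using elim c by (subst log_le_cancel_iff) auto
      also have "log 2 (c * \<rho> powr - s) = log 2 c - s * log 2 \<rho>" using c elim by (simp add: log_mult log_powr)
      finally have "- (log 2 (P \<rho>) / log 2 \<rho>) \<le> s - log 2 c / log 2 \<rho>" using l by (simp add: field_simps)
      then show ?case using elim by linarith
    qed
  next
    fix a assume a: "a < dmt n r"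
    have d0: "dmt n r \<ge> 0" using n r by (auto simp: dmt_def)
    \<comment> \<open>Small enough that \<open>\<eta> * dmt n r < dmt n r - a\<close>; the added 1
      keeps the denominator positive at \<open>r = 1\<close>, where the exponent is 0. The cap
      \<open>1 / 2\<close> keeps the shares nonnegative.\<close>
    define \<eta> where "\<eta> = min (1 / 2) ((dmt n r - a) / (2 * (dmt n r + 1)))"
    have \<eta>: "0 < \<eta>" "\<eta> < 1" using a d0 by (auto simp: \<eta>_def)
    define u where "u = 1 - \<eta>"
    define w where "w = (if r \<le> 1 / 2 then 1 - \<eta> else 0)"
    have uw: "0 \<le> u" "u < 1" "0 \<le> w" "w < 1" using \<eta> by (auto simp: u_def w_def)
    define \<theta> where "\<theta> = (u / (2 * n) + w) / L"
    obtain K where K: "K > 0" and ev: "\<forall>\<^sub>F \<rho> in at_top. P \<rho> \<le> K * real (M \<rho>) powr \<theta> * \<rho> powr - (u + n * w)"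
      using upper[OF uw] unfolding \<theta>_def by auto
    have lim: "((\<lambda>\<rho>. (u + n * w) - \<theta> * (log 2 (real (M \<rho>)) / log 2 \<rho>) - log 2 K / log 2 \<rho>) \<longlongrightarrow>
        (u + n * w) - \<theta> * (2 * n * L * r) - 0) at_top"
      by (intro tendsto_intros M tendsto_const_div_log)
    \<comment> \<open>The block length cancels here, so the limiting exponent is the same for every
      \<open>L\<close>.\<close>
    have "\<theta> * (2 * n * L * r) = (u + 2 * n * w) * r" using n L by (simp add: \<theta>_def field_simps)
    then have "(u + n * w) - \<theta> * (2 * n * L * r) - 0 = u * (1 - r) + n * (w * (1 - 2 * r))" by (simp add: algebra_simps)
    also have "w * (1 - 2 * r) = (1 - \<eta>) * max (1 - 2 * r) 0" by (auto simp: w_def max_def)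
    also have "u * (1 - r) + n * ((1 - \<eta>) * max (1 - 2 * r) 0) = (1 - \<eta>) * dmt n r"
      unfolding u_def dmt_def by (simp add: algebra_simps)
    also have "a < (1 - \<eta>) * dmt n r"
    proof -
      have "\<eta> * dmt n r \<le> (dmt n r - a) / (2 * (dmt n r + 1)) * dmt n r"
        unfolding \<eta>_def using d0 by (intro mult_right_mono) auto
      also have "\<dots> = (dmt n r - a) / 2 * (dmt n r / (dmt n r + 1))" by simp
      also have "\<dots> \<le> (dmt n r - a) / 2 * 1" using d0 a by (intro mult_left_mono) auto
      also have "\<dots> < dmt n r - a" using a by simp
      finally show ?thesis by (simp add: algebra_simps)
    qed
    finally have "a < (u + n * w) - \<theta> * (2 * n * L * r) - 0" .
    from order_tendstoD(1)[OF lim this]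
    show "\<forall>\<^sub>F \<rho> in at_top. a < - (log 2 (P \<rho>) / log 2 \<rho>)" using ev pos M2 eventually_gt_at_top[of 1]
    proof eventually_elim
      case (elim \<rho>)
      have l: "log 2 \<rho> > 0" using elim by simp
      have "log 2 (P \<rho>) \<le> log 2 (K * real (M \<rho>) powr \<theta> * \<rho> powr - (u + n * w))"
        using elim K by (subst log_le_cancel_iff) auto
      also have "\<dots> = log 2 K + \<theta> * log 2 (real (M \<rho>)) - (u + n * w) * log 2 \<rho>"
        using K elim by (simp add: log_mult log_powr algebra_simps)
      finally have "log 2 (P \<rho>) / log 2 \<rho> \<le> (log 2 K + \<theta> * log 2 (real (M \<rho>)) - (u + n * w) * log 2 \<rho>) / log 2 \<rho>"
        using l by (intro divide_right_mono) auto
      also have "\<dots> = log 2 K / log 2 \<rho> + \<theta> * (log 2 (real (M \<rho>)) / log 2 \<rho>) - (u + n * w)"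
        using l by (simp add: add_divide_distrib diff_divide_distrib)
      finally show ?case using elim by linarith
    qed
  qed
  with pos show ?thesis by (simp add: has_diversity_gain_def)
qed

theorem theorem3:
  fixes N :: nat and sw sv :: "real \<Rightarrow> real" and \<kappa> :: real
  assumes N: "N \<ge> 2"
    and sw_pos: "\<And>\<rho>. \<rho> > 0 \<Longrightarrow> sw \<rho> > 0"
    and sv_pos: "\<And>\<rho>. \<rho> > 0 \<Longrightarrow> sv \<rho> > 0"
    and ratio: "\<And>\<rho>. \<rho> > 0 \<Longrightarrow> sv \<rho> / sw \<rho> = \<kappa>"
  shows "\<exists>b :: real \<Rightarrow> nat \<Rightarrow> complex \<Rightarrow> complex. (\<forall>\<rho>>0. \<forall>i\<in>{2..N}. admissible_gain (\<rho> * sv \<rho>) (sw \<rho>) (b \<rho> i)) \<and>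
    (\<forall>r\<in>{0..1}. \<forall>\<^sub>F L in sequentially. \<forall>M :: real \<Rightarrow> nat. (\<forall>\<^sub>F \<rho> in at_top. 2 \<le> M \<rho>) \<longrightarrow>
       has_multiplexing_gain (\<lambda>\<rho>. code_rate N L (M \<rho>)) r \<longrightarrow> has_diversity_gain
         (\<lambda>\<rho>. naf_error_prob N L (M \<rho>) (\<rho> * sv \<rho>) (sw \<rho>) (sv \<rho>) (b \<rho>)) ((1 - r) + (real N - 1) * max (1 - 2 * r) 0))"
proof -
  have \<kappa>: "\<kappa> > 0" using ratio[of 1] sw_pos[of 1] sv_pos[of 1] by (metis divide_pos_pos zero_less_one)
  have sw_eq: "sw \<rho> = sv \<rho> / \<kappa>" if "\<rho> > 0" for \<rho> using ratio[OF that] sw_pos[OF that] \<kappa> by (simp add: field_simps)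
  define n where "n = real N - 1"
  have n: "n \<ge> 1" using N by (simp add: n_def)
  have nN: "real (N - 1) = n" using N by (simp add: n_def)
  \<comment> \<open>\<open>naf_gain\<close> meets the energy constraint once the relay noise
    variance is at most \<open>E\<close>, that is, for \<open>\<rho> * \<kappa> \<ge> 1\<close>.
    Below that the relays stay silent, and the limit in \<rho> does not see this range.\<close>
  define b :: "real \<Rightarrow> nat \<Rightarrow> complex \<Rightarrow> complex" where
    "b \<rho> i = (if \<rho> * \<kappa> \<ge> 1 then naf_gain else (\<lambda>_. 0))" for \<rho> i
  have "admissible_gain (\<rho> * sv \<rho>) (sw \<rho>) (b \<rho> i)" if \<rho>: "\<rho> > 0" for \<rho> i
  proof -
    define E where "E = \<rho> * sv \<rho>"
    have E: "E > 0" using \<rho> sv_pos by (simp add: E_def)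
    have den: "sqmod h * E + sw \<rho> > 0" for h using E sw_pos[OF \<rho>] by (intro add_nonneg_pos) auto
    have "cmod (b \<rho> i h) \<le> sqrt (E / (sqmod h * E + sw \<rho>))" for h
    proof (cases "\<rho> * \<kappa> \<ge> 1")
      case True
      have "sv \<rho> * 1 \<le> sv \<rho> * (\<rho> * \<kappa>)" using True sv_pos[OF \<rho>] by (intro mult_left_mono) auto
      then have "sw \<rho> \<le> E" unfolding sw_eq[OF \<rho>] E_def using \<kappa> by (simp add: field_simps)
      then have "sqmod h * E + sw \<rho> \<le> E * (1 + sqmod h)" by (simp add: algebra_simps)
      moreover have "0 < 1 + sqmod h" by (simp add: add_pos_nonneg)
      ultimately have "1 / (1 + sqmod h) \<le> E / (sqmod h * E + sw \<rho>)"
        using den[of h] by (simp add: divide_simps)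
      then have "sqrt (1 / (1 + sqmod h)) \<le> sqrt (E / (sqmod h * E + sw \<rho>))" by simp
      then show ?thesis using True by (simp add: b_def cmod_naf_gain real_sqrt_divide)
    next
      case False
      then show ?thesis using E den[of h] by (simp add: b_def)
    qed
    moreover have "b \<rho> i \<in> borel_measurable borel" by (simp add: b_def)
    ultimately show ?thesis by (simp add: admissible_gain_def E_def)
  qed
  moreover have "has_diversity_gain (\<lambda>\<rho>. naf_error_prob N L (M \<rho>) (\<rho> * sv \<rho>) (sw \<rho>) (sv \<rho>) (b \<rho>)) (dmt n r)"
    if r: "0 \<le> r" "r \<le> 1" and L: "L \<ge> 2" and M2: "\<forall>\<^sub>F \<rho> in at_top. 2 \<le> M \<rho>"
      and mg: "has_multiplexing_gain (\<lambda>\<rho>. code_rate N L (M \<rho>)) r" for r L and M :: "real \<Rightarrow> nat"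
  proof -
    have large: "\<forall>\<^sub>F \<rho> in at_top. 1 \<le> \<rho> \<and> 1 \<le> \<rho> * \<kappa>" using eventually_ge_at_top[of 1] eventually_ge_at_top[of "1 / \<kappa>"]
      by eventually_elim (use \<kappa> in \<open>simp add: field_simps\<close>)
    have beq: "b \<rho> = (\<lambda>_. naf_gain)" if "1 \<le> \<rho> * \<kappa>" for \<rho> using that by (simp add: b_def fun_eq_iff)
    have nL: "2 * n * real L > 0" using n L by simp
  let ?P = "\<lambda>\<rho>. naf_error_prob N L (M \<rho>) (\<rho> * sv \<rho>) (sw \<rho>) (sv \<rho>) (b \<rho>)"
    have lim: "((\<lambda>\<rho>. 2 * n * real L * (code_rate N L (M \<rho>) / log 2 \<rho>)) \<longlongrightarrow> 2 * n * real L * r) at_top"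
      using mg unfolding has_multiplexing_gain_def by (rule tendsto_mult_left)
    have eq: "2 * n * real L * (code_rate N L (M \<rho>) / log 2 \<rho>) = log 2 (real (M \<rho>)) / log 2 \<rho>" for \<rho>
    proof -
      have "real (2 * (N - 1) * L) = 2 * n * real L" unfolding of_nat_mult nN by simp
      then show ?thesis unfolding code_rate_def using n L by (simp only: divide_divide_eq_left) simp
    qed
    have M: "((\<lambda>\<rho>. log 2 (real (M \<rho>)) / log 2 \<rho>) \<longlongrightarrow> 2 * n * real L * r) at_top" using lim unfolding eq .
    show ?thesis
    proof (rule diversity_gain_from_bounds[OF n _ r M2 M])
      show "real L > 0" using L by simp
    next
      fix u w :: real
      assume uw: "0 \<le> u" "u < 1" "0 \<le> w" "w < 1"
      obtain K where K: "K > 0" and Kb: "\<And>\<rho> sv M. \<rho> > 0 \<Longrightarrow> sv > 0 \<Longrightarrow> M \<ge> 1 \<Longrightarrow>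
        naf_error_prob N L M (\<rho> * sv) (sv / \<kappa>) sv (\<lambda>_. naf_gain) \<le>
          K * real M powr ((u / (2 * n) + w) / real L) * \<rho> powr - (u + n * w)"
        using naf_error_prob_upper[OF N L \<kappa> uw] unfolding n_def by blast
      have "\<forall>\<^sub>F \<rho> in at_top. ?P \<rho> \<le> K * real (M \<rho>) powr ((u / (2 * n) + w) / real L) * \<rho> powr - (u + n * w)"
        using large M2
      proof eventually_elim
        case (elim \<rho>)
        then show ?case using Kb[of \<rho> "sv \<rho>" "M \<rho>"] sv_pos[of \<rho>] beq[of \<rho>] sw_eq[of \<rho>] by simp
      qed
      then show "\<exists>K>0. \<forall>\<^sub>F \<rho> in at_top. ?P \<rho> \<le> K * real (M \<rho>) powr ((u / (2 * n) + w) / real L) * \<rho> powr - (u + n * w)"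
        using K by blast
    next
      fix r' :: real
      assume r': "0 \<le> r'" "r' \<le> 1"
      have L1: "L \<ge> 1" using L by simp
      obtain c where c: "c > 0" and cb: "\<And>\<rho> sv sw M. \<rho> \<ge> 1 \<Longrightarrow> sv > 0 \<Longrightarrow> sw > 0 \<Longrightarrow> 2 * \<rho> powr (2 * n * real L * r') \<le> real M \<Longrightarrow>
          c * \<rho> powr - dmt n r' \<le> naf_error_prob N L M (\<rho> * sv) sw sv (\<lambda>_. naf_gain)"
        using naf_error_prob_lower[OF N L1] r' unfolding n_def[symmetric] dmt_def by auto
      have "\<forall>\<^sub>F \<rho> in at_top. 2 * \<rho> powr (2 * n * real L * r') \<le> real (M \<rho>) \<longrightarrow> c * \<rho> powr - dmt n r' \<le> ?P \<rho>" using large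
      proof eventually_elim
        case (elim \<rho>)
        then show ?case using cb[of \<rho> "sv \<rho>" "sw \<rho>" "M \<rho>"] sv_pos[of \<rho>] sw_pos[of \<rho>] beq[of \<rho>] by simp
      qed
      then show "\<exists>c>0. \<forall>\<^sub>F \<rho> in at_top. 2 * \<rho> powr (2 * n * real L * r') \<le> real (M \<rho>) \<longrightarrow> c * \<rho> powr - dmt n r' \<le> ?P \<rho>"
        using c by blast
    qed
  qed
  \<comment> \<open>The same block length bound, 2, serves every \<open>r\<close>.\<close>
  ultimately show ?thesis unfolding n_def dmt_def eventually_sequentially
    by (intro exI[of _ b] conjI ballI allI impI exI[of _ 2]) auto
qed

end
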